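(* Let $\theta\in[0,1]$. (i) Assume the step-size condition (S) stated in the context. Then there is a constant $C>0$, independent of $n$ and $\tau$, such that for all $x\in[0,1]$, $$\int_0^\infty\int_0^1|G(t,x,y)-G^{n,\tau}_2(t,x,y)|^2\,dy\,dt\le C\Big(\frac1n+\sqrt\tau\Big).$$ (ii) Assume that one of the following holds: $\theta\in[0,\frac12]$ and the step-size condition (S) (parts (i), (ii)) holds; or $\theta=1$; or $\theta\in(\frac12,1)$ and $u_0\in H^1$. Then for any $\alpha\in(\frac12,1)$ there is a constant $C=C(\alpha)>0$, independent of $n$ and $\tau$, such that $$\Big|\int_0^1\big(G(t,x,y)-G^{n,\tau}_1(t,x,y)\big)u_0(\kappa_n(y))\,dy\Big|^2\le C\tau^{\alpha-\frac12}\Big(\Big[\frac t\tau\Big]\tau\Big)^{-\alpha}+Cn^{1-2\alpha}t^{-\alpha}$$ for all $x\in[0,1]$ and $t\ge\tau>0$.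
   Context: $n\ge3$ is an integer, $\tau\in(0,\frac12)$, $[\cdot]$ is the greatest integer function, $\kappa_n(y)=\frac{[ny]}n$, and $u_0:[0,1]\to\mathbb R$ is bounded, non-negative and measurable. The Green function of the heat equation on $[0,1]$ with periodic boundary condition is $$G(t,x,y)=\frac1{\sqrt{4\pi t}}\sum_{m\in\mathbb Z}e^{-\frac{(x-y-m)^2}{4t}}=\sum_{m\in\mathbb Z}e^{-4\pi^2m^2t}e^{2\pi\mathbf im(x-y)},\quad t>0.$$ With $e_l(x)=e^{2\pi\mathbf ilx}$, $\lambda^n_l=-4n^2\sin^2(\frac{l\pi}n)$, $R_{1,l}=(1-\theta\tau\lambda^n_l)^{-1}$, $R_{2,l}=1+(1-\theta)\tau\lambda^n_l$, the fully discrete Green functions are $$G^{n,\tau}_1(t,x,y)=\sum_{l=0}^{n-1}(R_{1,l}R_{2,l})^{[\frac t\tau]}e_l(\kappa_n(x))\bar e_l(\kappa_n(y))\mathbf 1_{\{t\ge0\}},\quad G^{n,\tau}_2(t,x,y)=\sum_{l=0}^{n-1}(R_{1,l}R_{2,l})^{[\frac t\tau]}R_{1,l}e_l(\kappa_n(x))\bar e_l(\kappa_n(y))\mathbf 1_{\{t\ge0\}}.$$ Step-size condition (S). (i) If $0\le\theta<\frac12$: $n^2\tau\le\rho<\frac1{2-4\theta}$ for some fixed constant $\rho>0$. (ii) If $\theta=\frac12$: $n^2\tau\le\frac1\epsilon-\frac12$ for a fixed $\epsilon\in(0,\frac12)$. (iii) If $\frac12<\theta\le1$: no coupling requirement on $n,\tau$.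 Constants may depend on $\theta,\rho,\epsilon$ and (in part (ii) of the lemma) $u_0$. $H^1$ is the periodic Sobolev space on $[0,1]$ with norm $\|v\|_{H^1}=\big(\sum_{k\in\mathbb Z}(1+4\pi^2k^2)|c_k(v)|^2\big)^{1/2}$, $c_k(v)=\int_0^1v(y)e^{-2\pi\mathbf iky}dy$. *)

theory Defs
  imports "HOL-Probability.Probability"
begin

definition heat_green :: "real \<Rightarrow> real \<Rightarrow> real \<Rightarrow> real" where
  "heat_green t x y =
     1 / sqrt (4 * pi * t) * (\<Sum>\<^sub>\<infinity>m\<in>(UNIV :: int set). exp (- ((x - y - of_int m)\<^sup>2) / (4 * t)))"

definition grid_floor :: "nat \<Rightarrow> real \<Rightarrow> real" where
  "grid_floor n y = of_int \<lfloor>real n * y\<rfloor> / real n"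

definition fourier_mode :: "int \<Rightarrow> real \<Rightarrow> complex" where
  "fourier_mode l x = exp (2 * of_real pi * \<i> * of_int l * of_real x)"

definition eigval :: "nat \<Rightarrow> nat \<Rightarrow> real" where
  "eigval n l = - 4 * (real n)\<^sup>2 * (sin (real l * pi / real n))\<^sup>2"

definition R1 :: "real \<Rightarrow> nat \<Rightarrow> real \<Rightarrow> nat \<Rightarrow> real" where
  "R1 \<theta> n \<tau> l = inverse (1 - \<theta> * \<tau> * eigval n l)"

definition R2 :: "real \<Rightarrow> nat \<Rightarrow> real \<Rightarrow> nat \<Rightarrow> real" where
  "R2 \<theta> n \<tau> l = 1 + (1 - \<theta>) * \<tau> * eigval n l"

definition discrete_green1 :: "real \<Rightarrow> nat \<Rightarrow> real \<Rightarrow> real \<Rightarrow> real \<Rightarrow> real \<Rightarrow> complex" where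
  "discrete_green1 \<theta> n \<tau> t x y =
     (if t \<ge> 0 then
        \<Sum>l<n. of_real ((R1 \<theta> n \<tau> l * R2 \<theta> n \<tau> l) ^ nat \<lfloor>t / \<tau>\<rfloor>)
              * fourier_mode (int l) (grid_floor n x) * cnj (fourier_mode (int l) (grid_floor n y))
      else 0)"

definition discrete_green2 :: "real \<Rightarrow> nat \<Rightarrow> real \<Rightarrow> real \<Rightarrow> real \<Rightarrow> real \<Rightarrow> complex" where
  "discrete_green2 \<theta> n \<tau> t x y =
     (if t \<ge> 0 then
        \<Sum>l<n. of_real ((R1 \<theta> n \<tau> l * R2 \<theta> n \<tau> l) ^ nat \<lfloor>t / \<tau>\<rfloor> * R1 \<theta> n \<tau> l)
              * fourier_mode (int l) (grid_floor n x) * cnj (fourier_mode (int l) (grid_floor n y))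
      else 0)"

definition step_condition :: "real \<Rightarrow> real \<Rightarrow> real \<Rightarrow> nat \<Rightarrow> real \<Rightarrow> bool" where
  "step_condition \<theta> \<rho> \<epsilon> n \<tau> \<longleftrightarrow>
     (0 \<le> \<theta> \<and> \<theta> < 1/2 \<longrightarrow> (real n)\<^sup>2 * \<tau> \<le> \<rho> \<and> \<rho> < 1 / (2 - 4 * \<theta>)) \<and>
     (\<theta> = 1/2 \<longrightarrow> (real n)\<^sup>2 * \<tau> \<le> 1 / \<epsilon> - 1/2)"

definition fourier_coeff :: "(real \<Rightarrow> real) \<Rightarrow> int \<Rightarrow> complex" where
  "fourier_coeff v k = (LINT y:{0..1}|lebesgue. of_real (v y) * fourier_mode (- k) y)"

text \<open>The lemma samples \<open>u\<^sub>0\<close> at grid points, so membership in \<open>H\<^sup>1\<close> has to refer to the continuous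
  periodic representative of the class and not merely to an almost-everywhere class.\<close>

definition periodic_H1 :: "(real \<Rightarrow> real) \<Rightarrow> bool" where
  "periodic_H1 v \<longleftrightarrow> continuous_on {0..1} v \<and> v 0 = v 1 \<and>
     (\<lambda>k::int. (1 + 4 * pi\<^sup>2 * (of_int k)\<^sup>2) * (cmod (fourier_coeff v k))\<^sup>2) summable_on UNIV"


section \<open>Fourier representation of the heat Green function\<close>

text \<open>Poisson summation for the Gaussian: the second expression for the Green function,
  \<open>heat_green_fourier\<close> below, is derived from the defining series of heat kernels.\<close>

lemma fourier_mode_cis: "fourier_mode k x = cis (2 * pi * of_int k * x)"
  by (simp add: fourier_mode_def cis_conv_exp algebra_simps)

lemma fourier_mode_add: "fourier_mode (j + k) x = fourier_mode j x * fourier_mode k x"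
  by (simp add: fourier_mode_cis cis_mult algebra_simps)

lemma norm_fourier_mode [simp]: "cmod (fourier_mode k x) = 1"
  by (simp add: fourier_mode_cis)

lemma cnj_fourier_mode: "cnj (fourier_mode k x) = fourier_mode (- k) x"
  by (simp add: fourier_mode_cis cis_cnj)

lemma fourier_mode_diff: "fourier_mode k (x - y) = fourier_mode k x * cnj (fourier_mode k y)"
  by (simp add: fourier_mode_cis cis_cnj cis_mult algebra_simps)

lemma fourier_mode_of_int [simp]: "fourier_mode k (of_int m) = 1"
  using cis_multiple_2pi[of "of_int (k * m)"] by (simp add: fourier_mode_cis mult.assoc)

lemma fourier_mode_shift: "fourier_mode k (x - of_int m) = fourier_mode k x"
  by (simp add: fourier_mode_diff)

lemma continuous_fourier_mode [continuous_intros]: "continuous_on A (fourier_mode k)"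
  unfolding fourier_mode_def by (intro continuous_intros)

definition fourier_orth :: "(real \<Rightarrow> complex) \<Rightarrow> bool" where
  "fourier_orth \<phi> \<longleftrightarrow> continuous_on {0..1} \<phi> \<and> (\<forall>k. integral {0..1} (\<lambda>x. \<phi> x * fourier_mode k x) = 0)"

lemma fourier_orth_polynomial:
  assumes "real_polynomial_function p" "fourier_orth \<phi>"
  shows "fourier_orth (\<lambda>x. \<phi> x * of_real (p (fourier_mode 1 x)))"
  using assms
proof (induction p arbitrary: \<phi> rule: real_polynomial_function.induct)
  case (linear f)
  then interpret bounded_linear f by simp
  have c: "continuous_on {0..1} \<phi>" and z: "\<And>k. integral {0..1} (\<lambda>x. \<phi> x * fourier_mode k x) = 0"
    using linear.prems by (auto simp: fourier_orth_def)
  define a b where "a = complex_of_real (f 1)" and "b = complex_of_real (f \<i>)"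
  have fe: "of_real (f (fourier_mode 1 x)) =
      (a - \<i> * b) / 2 * fourier_mode 1 x + (a + \<i> * b) / 2 * fourier_mode (-1) x" for x
  proof -
    define w where "w = fourier_mode 1 x"
    have "f w = f (Re w *\<^sub>R 1 + Im w *\<^sub>R \<i>)"
      by (rule arg_cong[of _ _ f]) (simp add: complex_eq_iff)
    also have "\<dots> = Re w * f 1 + Im w * f \<i>" by (simp add: add scaleR)
    finally have "of_real (f w) = of_real (Re w) * a + of_real (Im w) * b" by (simp add: a_def b_def)
    also have "\<dots> = (a - \<i> * b) / 2 * w + (a + \<i> * b) / 2 * cnj w"
      by (simp add: complex_eq_iff field_simps a_def b_def)
    finally show ?thesis by (simp add: w_def cnj_fourier_mode)
  qed
  have int: "(\<lambda>x. \<phi> x * fourier_mode k x) integrable_on {0..1}" for k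
    by (intro integrable_continuous_real continuous_intros c)
  have hi: "((\<lambda>x. \<phi> x * fourier_mode k x) has_integral 0) {0..1}" for k
    using integrable_integral[OF int[of k]] by (simp add: z)
  have "integral {0..1} (\<lambda>x. \<phi> x * of_real (f (fourier_mode 1 x)) * fourier_mode k x) = 0" for k
  proof -
    have *: "\<phi> x * of_real (f (fourier_mode 1 x)) * fourier_mode k x =
       (a - \<i> * b) / 2 * (\<phi> x * fourier_mode (1 + k) x) + (a + \<i> * b) / 2 * (\<phi> x * fourier_mode (-1 + k) x)" for x
      unfolding fe fourier_mode_add by (simp only: algebra_simps)
    have "((\<lambda>x. \<phi> x * of_real (f (fourier_mode 1 x)) * fourier_mode k x) has_integral
        ((a - \<i> * b) / 2 * 0 + (a + \<i> * b) / 2 * 0)) {0..1}"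
      unfolding * by (intro has_integral_add has_integral_mult_right hi)
    then show ?thesis by (simp add: integral_unique)
  qed
  moreover have "continuous_on {0..1} (\<lambda>x. \<phi> x * of_real (f (fourier_mode 1 x)))"
    unfolding fe by (intro continuous_intros c)
  ultimately show ?case by (simp add: fourier_orth_def)
next
  case (const c)
  have "\<phi> x * of_real c * fourier_mode k x = of_real c * (\<phi> x * fourier_mode k x)" for k x by simp
  then show ?case
    using const unfolding fourier_orth_def by (auto intro!: continuous_intros simp only: integral_mult_right mult_zero_right)
next
  case (add f g)
  have 1: "fourier_orth (\<lambda>x. \<phi> x * of_real (f (fourier_mode 1 x)))"
       "fourier_orth (\<lambda>x. \<phi> x * of_real (g (fourier_mode 1 x)))"
    using add by auto
  have eq: "(\<lambda>x. \<phi> x * of_real (f (fourier_mode 1 x) + g (fourier_mode 1 x))) =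
      (\<lambda>x. \<phi> x * of_real (f (fourier_mode 1 x)) + \<phi> x * of_real (g (fourier_mode 1 x)))"
    by (simp add: algebra_simps)
  have "integral {0..1} (\<lambda>x. (\<phi> x * of_real (f (fourier_mode 1 x)) + \<phi> x * of_real (g (fourier_mode 1 x))) * fourier_mode k x) = 0" for k
    using 1 unfolding distrib_right fourier_orth_def
    by (subst Henstock_Kurzweil_Integration.integral_add)
       (auto intro!: integrable_continuous_real continuous_intros)
  then show ?case using 1 unfolding eq fourier_orth_def by (auto intro: continuous_intros)
next
  case (mult f g)
  then have "fourier_orth (\<lambda>x. \<phi> x * of_real (f (fourier_mode 1 x)) * of_real (g (fourier_mode 1 x)))"
    by blast
  then show ?case by (simp add: mult.assoc)
qed

lemma fourier_orth_zero:
  assumes orth: "fourier_orth \<phi>" and per: "\<phi> 0 = \<phi> 1" and x: "x \<in> {0..1}"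
  shows "\<phi> x = 0"
proof -
  have c: "continuous_on {0..1} \<phi>" using orth by (simp add: fourier_orth_def)
  define F where "F = \<phi> \<circ> (\<lambda>z. Arg2pi z / (2 * pi))"
  have "homotopic_loops UNIV \<phi> \<phi>"
    using c per by (simp add: homotopic_loops_refl path_def pathstart_def pathfinish_def)
  from homotopic_loops_imp_homotopic_circlemaps[OF this]
  have cF: "continuous_on (sphere 0 1) F"
    unfolding F_def by (auto dest: homotopic_with_imp_continuous)
  have FE: "F (fourier_mode 1 y) = \<phi> y" if y: "y \<in> {0..1}" for y
  proof (cases "y = 1")
    case True
    then have "fourier_mode 1 y = 1" using fourier_mode_of_int[of 1 1] by simp
    then show ?thesis using True per Arg2pi_of_real[of 1] by (simp add: F_def)
  next
    case False
    have "Arg2pi (fourier_mode 1 y) = 2 * pi * y"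
      by (rule Arg2pi_unique[of 1]) (use y False in \<open>auto simp: fourier_mode_def algebra_simps\<close>)
    then show ?thesis by (simp add: F_def)
  qed
  define M where "M = integral {0..1} (\<lambda>y. cmod (\<phi> y))"
  have M0: "0 \<le> M" unfolding M_def by (intro integral_nonneg integrable_continuous_real continuous_intros c) auto
  have small: "integral {0..1} (\<lambda>y. (cmod (\<phi> y))\<^sup>2) \<le> e * M" if e: "e > 0" for e
  proof -
    from Stone_Weierstrass_polynomial_function[OF compact_sphere cF e]
    obtain g where g: "polynomial_function g" "\<And>z. z \<in> sphere 0 1 \<Longrightarrow> cmod (F z - g z) < e" by blast
    define h where "h = (\<lambda>y. g (fourier_mode 1 y))"
    have close: "cmod (\<phi> y - h y) \<le> e" if "y \<in> {0..1}" for y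
      using g(2)[of "fourier_mode 1 y"] FE[OF that] by (simp add: h_def)
    have gR: "real_polynomial_function (\<lambda>z. Re (g z))" "real_polynomial_function (\<lambda>z. Im (g z))"
      using g(1) bounded_linear_Re bounded_linear_Im unfolding polynomial_function_def o_def by blast+
    have o1: "fourier_orth (\<lambda>y. \<phi> y * of_real (Re (h y)))" "fourier_orth (\<lambda>y. \<phi> y * of_real (Im (h y)))"
      using fourier_orth_polynomial[OF gR(1) orth] fourier_orth_polynomial[OF gR(2) orth]
      by (simp_all add: h_def)
    have ch: "continuous_on {0..1} h"
      unfolding h_def
      by (rule continuous_on_compose2[OF continuous_on_polymonial_function[OF g(1), of UNIV]])
         (auto intro: continuous_intros)
    have m0: "fourier_mode 0 y = 1" for y by (simp add: fourier_mode_def)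
    have i0: "((\<lambda>y. \<phi> y * of_real (Re (h y))) has_integral 0) {0..1}"
             "((\<lambda>y. \<phi> y * of_real (Im (h y))) has_integral 0) {0..1}"
      using o1 unfolding fourier_orth_def
      by (metis (no_types, lifting) integrable_continuous_real has_integral_integral m0 mult.right_neutral integral_cong)+
    have "((\<lambda>y. \<phi> y * of_real (Re (h y)) - \<i> * (\<phi> y * of_real (Im (h y)))) has_integral (0 - \<i> * 0)) {0..1}"
      by (intro has_integral_diff has_integral_mult_right i0)
    moreover have "\<phi> y * of_real (Re (h y)) - \<i> * (\<phi> y * of_real (Im (h y))) = \<phi> y * cnj (h y)" for y
      by (simp add: complex_eq_iff)
    ultimately have hc: "((\<lambda>y. \<phi> y * cnj (h y)) has_integral 0) {0..1}" by simp
    have I1: "((\<lambda>y. \<phi> y * cnj (\<phi> y - h y)) has_integral integral {0..1} (\<lambda>y. \<phi> y * cnj (\<phi> y - h y))) {0..1}"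
      by (intro integrable_integral integrable_continuous_real continuous_intros c ch)
    have "((\<lambda>y. \<phi> y * cnj (\<phi> y - h y) + \<phi> y * cnj (h y)) has_integral
            integral {0..1} (\<lambda>y. \<phi> y * cnj (\<phi> y - h y)) + 0) {0..1}"
      by (intro has_integral_add I1 hc)
    then have I2: "((\<lambda>y. complex_of_real ((cmod (\<phi> y))\<^sup>2)) has_integral
            integral {0..1} (\<lambda>y. \<phi> y * cnj (\<phi> y - h y))) {0..1}"
      by (simp add: algebra_simps flip: complex_norm_square)
    have "((\<lambda>y. (cmod (\<phi> y))\<^sup>2) has_integral integral {0..1} (\<lambda>y. (cmod (\<phi> y))\<^sup>2)) {0..1}"
      by (intro integrable_integral integrable_continuous_real continuous_intros c)
    from has_integral_linear[OF this bounded_linear_of_real] 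
    have "((\<lambda>y. complex_of_real ((cmod (\<phi> y))\<^sup>2)) has_integral
            of_real (integral {0..1} (\<lambda>y. (cmod (\<phi> y))\<^sup>2))) {0..1}"
      by (simp only: o_def)
    from this I2 have "of_real (integral {0..1} (\<lambda>y. (cmod (\<phi> y))\<^sup>2)) = integral {0..1} (\<lambda>y. \<phi> y * cnj (\<phi> y - h y))"
      by (rule has_integral_unique)
    then have "integral {0..1} (\<lambda>y. (cmod (\<phi> y))\<^sup>2) \<le> cmod (integral {0..1} (\<lambda>y. \<phi> y * cnj (\<phi> y - h y)))"
      by (metis abs_ge_self norm_of_real)
    also have "\<dots> \<le> integral {0..1} (\<lambda>y. e * cmod (\<phi> y))"
    proof (rule integral_norm_bound_integral)
      fix y :: real assume "y \<in> {0..1}"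
      then show "cmod (\<phi> y * cnj (\<phi> y - h y)) \<le> e * cmod (\<phi> y)"
        using mult_right_mono[OF close[of y], of "cmod (\<phi> y)"]
        by (simp add: norm_mult mult.commute del: complex_cnj_diff)
    qed (intro integrable_continuous_real continuous_intros c ch)+
    also have "\<dots> = e * M" by (simp add: M_def)
    finally show ?thesis .
  qed
  have "integral {0..1} (\<lambda>y. (cmod (\<phi> y))\<^sup>2) \<le> 0"
  proof (rule field_le_epsilon)
    fix e :: real assume "e > 0"
    then have "integral {0..1} (\<lambda>y. (cmod (\<phi> y))\<^sup>2) \<le> e / (M + 1) * M" using M0 by (intro small) auto
    also have "\<dots> \<le> e" using M0 \<open>e > 0\<close> by (simp add: field_simps)
    finally show "integral {0..1} (\<lambda>y. (cmod (\<phi> y))\<^sup>2) \<le> 0 + e" by simp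
  qed
  moreover have "0 \<le> integral {0..1} (\<lambda>y. (cmod (\<phi> y))\<^sup>2)"
    by (intro integral_nonneg integrable_continuous_real continuous_intros c) auto
  ultimately have "integral {0..1} (\<lambda>y. (cmod (\<phi> y))\<^sup>2) = 0" by simp
  moreover have "continuous_on {0..1} (\<lambda>y. (cmod (\<phi> y))\<^sup>2)"
    by (intro continuous_intros c)
  ultimately have "\<forall>y\<in>{0..1}. (cmod (\<phi> y))\<^sup>2 = 0"
    using integral_eq_0_iff[of 0 1 "\<lambda>y. (cmod (\<phi> y))\<^sup>2"] by simp
  then have "(cmod (\<phi> x))\<^sup>2 = 0"
    using x by blast
  then show ?thesis by simp
qed

lemma exp_neg_square_summable:
  fixes c :: real assumes c: "c > 0"
  shows "(\<lambda>m::int. exp (- c * (of_int m)\<^sup>2)) summable_on UNIV"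
proof -
  have s: "(\<lambda>n::nat. exp (- c * (real n)\<^sup>2)) summable_on UNIV"
  proof (rule norm_summable_imp_summable_on, rule summable_comparison_test)
    show "\<exists>N. \<forall>n\<ge>N. norm (norm (exp (- c * (real n)\<^sup>2))) \<le> exp (- c) ^ n"
    proof (intro exI[of _ 0] allI impI)
      fix n :: nat
      have "real n \<le> (real n)\<^sup>2" by (cases n) (auto simp: power2_eq_square)
      then have "- c * (real n)\<^sup>2 \<le> real n * (- c)" using c by (simp add: mult.commute)
      then show "norm (norm (exp (- c * (real n)\<^sup>2))) \<le> exp (- c) ^ n"
        by (simp flip: exp_of_nat_mult)
    qed
    show "summable (\<lambda>n. exp (- c) ^ n)" using c by (intro summable_geometric) auto
  qed
  have "(\<lambda>m::int. exp (- c * (of_int m)\<^sup>2)) summable_on (range int \<union> range (\<lambda>n. - int n))"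
  proof (rule summable_on_union)
    show "(\<lambda>m::int. exp (- c * (of_int m)\<^sup>2)) summable_on range int"
      by (subst summable_on_reindex) (use s in \<open>auto simp: o_def\<close>)
    show "(\<lambda>m::int. exp (- c * (of_int m)\<^sup>2)) summable_on range (\<lambda>n. - int n)"
      by (subst summable_on_reindex) (use s in \<open>auto simp: o_def inj_on_def\<close>)
  qed
  moreover have "range int \<union> range (\<lambda>n. - int n) = UNIV"
    by (auto, metis int_cases rangeI)
  ultimately show ?thesis by simp
qed

lemma normal_density_heat:
  assumes "t > 0"
  shows "normal_density 0 (sqrt (2 * t)) w = 1 / sqrt (4 * pi * t) * exp (- (w\<^sup>2) / (4 * t))"
  using assms by (simp add: normal_density_def mult_ac)

lemma fourier_transform_gaussian:
  assumes t: "t > 0"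
  shows "(LINT w|lborel. of_real (normal_density 0 (sqrt (2 * t)) w) * fourier_mode k w)
       = of_real (exp (- 4 * pi\<^sup>2 * (of_int k)\<^sup>2 * t))"
proof -
  define c where "c = sqrt (2 * t)"
  have c: "c > 0" "c\<^sup>2 = 2 * t" using t by (simp_all add: c_def)
  define s where "s = 2 * pi * of_int k * c"
  have "(LINT w|lborel. of_real (normal_density 0 c w) * fourier_mode k w)
      = \<bar>c\<bar> *\<^sub>R (LINT x|lborel. of_real (normal_density 0 c (0 + c * x)) * fourier_mode k (0 + c * x))"
    by (rule lborel_integral_real_affine) (use c in simp)
  also have "\<dots> = (LINT x|lborel. c *\<^sub>R (of_real (normal_density 0 c (c * x)) * fourier_mode k (c * x)))"
    using c by simp
  also have "\<dots> = (LINT x|lborel. std_normal_density x *\<^sub>R iexp (s * x))"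
  proof (intro Bochner_Integration.integral_cong refl)
    fix x
    have "c * normal_density 0 c (c * x) = std_normal_density x"
      using c(1) by (simp add: normal_density_def real_sqrt_mult power_mult_distrib)
    moreover have "fourier_mode k (c * x) = iexp (s * x)"
      by (simp add: fourier_mode_def s_def algebra_simps)
    ultimately show "c *\<^sub>R (of_real (normal_density 0 c (c * x)) * fourier_mode k (c * x)) =
        std_normal_density x *\<^sub>R iexp (s * x)"
      by (metis scaleR_conv_of_real mult.assoc of_real_mult)
  qed
  also have "\<dots> = char std_normal_distribution s"
    unfolding char_def by (subst integral_density) auto
  also have "\<dots> = of_real (exp (- (s\<^sup>2) / 2))"
    by (simp add: char_std_normal_distribution)
  also have "- (s\<^sup>2) / 2 = - 4 * pi\<^sup>2 * (of_int k)\<^sup>2 * t"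
    by (simp add: s_def power_mult_distrib c)
  finally show ?thesis by (simp add: c_def)
qed

lemma sum_unit_intervals:
  fixes h :: "real \<Rightarrow> complex"
  assumes h: "continuous_on UNIV h"
  shows "(\<Sum>m\<in>{- int N..int N}. integral {0..1} (\<lambda>z. h (z - of_int m))) = integral {- real N..real N + 1} h"
proof -
  have shift: "integral {0..1} (\<lambda>z. h (z - of_int m)) = integral {- of_int m..1 - of_int m} h" for m :: int
    using integral_shift_Icc_real[of 0 1 h "- of_int m"] by (simp add: o_def add.commute)
  have int: "h integrable_on {a..b}" for a b
    by (intro integrable_continuous_real continuous_on_subset[OF h]) auto
  have "(\<Sum>m\<in>{- int N..int N}. integral {- of_int m..1 - of_int m} h) = integral {- real N..real N + 1} h"
  proof (induction N)
    case 0
    then show ?case by simp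
  next
    case (Suc N)
    have "{- int (Suc N)..int (Suc N)} = insert (int (Suc N)) (insert (- int (Suc N)) {- int N..int N})"
      by auto
    then have "(\<Sum>m\<in>{- int (Suc N)..int (Suc N)}. integral {- of_int m..1 - of_int m} h)
       = integral {- real (Suc N)..1 - real (Suc N)} h + (integral {real (Suc N)..1 + real (Suc N)} h
          + integral {- real N..real N + 1} h)"
      using Suc.IH by (simp add: add.commute[of 1 "real N"])
    also have "\<dots> = integral {- real (Suc N)..- real N} h + (integral {- real N..real N + 1} h
          + integral {real N + 1..real (Suc N) + 1} h)"
      by (simp add: algebra_simps)
    also have "integral {- real N..real N + 1} h + integral {real N + 1..real (Suc N) + 1} h
        = integral {- real N..real (Suc N) + 1} h"
      by (rule Henstock_Kurzweil_Integration.integral_combine) (auto intro: int)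
    also have "integral {- real (Suc N)..- real N} h + integral {- real N..real (Suc N) + 1} h
        = integral {- real (Suc N)..real (Suc N) + 1} h"
      by (rule Henstock_Kurzweil_Integration.integral_combine) (auto intro: int)
    finally show ?case .
  qed
  then show ?thesis by (simp add: shift)
qed

lemma integral_growing_intervals:
  fixes h :: "real \<Rightarrow> complex"
  assumes h: "continuous_on UNIV h" "integrable lborel h"
  shows "(\<lambda>N. integral {- real N..real N + 1} h) \<longlonglongrightarrow> (LINT w|lborel. h w)"
proof -
  have [measurable]: "h \<in> borel_measurable borel" using h by (intro borel_measurable_continuous_onI)
  have "(\<lambda>N. LINT w|lborel. indicator {- real N..real N + 1} w *\<^sub>R h w) \<longlonglongrightarrow> (LINT w|lborel. h w)"
  proof (rule integral_dominated_convergence[where w = "\<lambda>w. norm (h w)"])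
    show "AE w in lborel. (\<lambda>N. indicator {- real N..real N + 1} w *\<^sub>R h w) \<longlonglongrightarrow> h w"
    proof (intro AE_I2 tendsto_eventually)
      fix w :: real
      obtain N0 :: nat where N0: "\<bar>w\<bar> \<le> real N0" using real_arch_simple by blast
      show "\<forall>\<^sub>F N in sequentially. indicator {- real N..real N + 1} w *\<^sub>R h w = h w"
        using eventually_ge_at_top[of N0]
        by eventually_elim (use N0 in \<open>auto simp: indicator_def\<close>)
    qed
  qed (use h in \<open>auto simp: indicator_def\<close>)
  moreover have "(LINT w|lborel. indicator {- real N..real N + 1} w *\<^sub>R h w) = integral {- real N..real N + 1} h" for N
  proof -
    have "set_integrable lborel {- real N..real N + 1} h"
      by (intro borel_integrable_atLeastAtMost' continuous_on_subset[OF h(1)]) auto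
    from set_borel_integral_eq_integral(2)[OF this] show ?thesis by (simp add: set_lebesgue_integral_def)
  qed
  ultimately show ?thesis by simp
qed

lemma integral_fourier_mode: "integral {0..1} (fourier_mode k) = (if k = 0 then 1 else 0)"
proof (cases "k = 0")
  case True
  then have "fourier_mode k = (\<lambda>_. 1)" by (auto simp: fourier_mode_def)
  then show ?thesis using True by simp
next
  case False
  define a where "a = 2 * of_real pi * \<i> * of_int k"
  have a: "a \<noteq> 0" using False by (simp add: a_def)
  have "(fourier_mode k has_integral fourier_mode k 1 / a - fourier_mode k 0 / a) {0..1}"
  proof (rule fundamental_theorem_of_calculus)
    fix x :: real
    have "((\<lambda>z. exp (a * z) / a) has_field_derivative exp (a * of_real x)) (at (of_real x))"
      using a by (auto intro!: derivative_eq_intros)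
    then have "((\<lambda>y. exp (a * of_real y) / a) has_vector_derivative exp (a * of_real x)) (at x)"
      by (rule has_vector_derivative_real_field)
    then show "((\<lambda>y. fourier_mode k y / a) has_vector_derivative fourier_mode k x) (at x within {0..1})"
      by (simp add: fourier_mode_def a_def has_vector_derivative_at_within)
  qed simp
  moreover have "fourier_mode k 1 = 1" "fourier_mode k 0 = 1"
    using fourier_mode_of_int[of k 1] fourier_mode_of_int[of k 0] by simp_all
  ultimately show ?thesis using False by (simp add: integral_unique)
qed

lemma filterlim_symmetric_int_intervals:
  "filterlim (\<lambda>N. {- int N..int N}) (finite_subsets_at_top UNIV) sequentially"
  unfolding filterlim_finite_subsets_at_top
proof (intro allI impI)
  fix X :: "int set" assume "finite X \<and> X \<subseteq> UNIV"
  then have B: "\<bar>m\<bar> \<le> Max (abs ` X)" if "m \<in> X" for m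
    using that by auto
  show "\<forall>\<^sub>F N in sequentially. finite {- int N..int N} \<and> X \<subseteq> {- int N..int N} \<and> {- int N..int N} \<subseteq> UNIV"
    using eventually_ge_at_top[of "nat (Max (abs ` X))"]
  proof eventually_elim
    case (elim N)
    then show ?case using B by fastforce
  qed
qed

text \<open>A uniformly convergent series may be integrated termwise.\<close>
lemma termwise_integral:
  fixes f :: "int \<Rightarrow> real \<Rightarrow> complex"
  assumes c: "\<And>m. continuous_on {0..1} (f m)"
    and b: "\<And>m x. x \<in> {0..1} \<Longrightarrow> cmod (f m x) \<le> M m" and s: "M summable_on UNIV"
  shows "continuous_on {0..1} (\<lambda>x. \<Sum>\<^sub>\<infinity>m. f m x)"
    and "((\<lambda>m. integral {0..1} (f m)) has_sum integral {0..1} (\<lambda>x. \<Sum>\<^sub>\<infinity>m. f m x)) UNIV"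
proof -
  have u: "uniform_limit {0..1} (\<lambda>X x. \<Sum>m\<in>X. f m x) (\<lambda>x. \<Sum>\<^sub>\<infinity>m. f m x) (finite_subsets_at_top UNIV)"
    by (rule Weierstrass_m_test_general[OF _ s]) (use b in auto)
  have cs: "continuous_on {0..1} (\<lambda>x. \<Sum>m\<in>X. f m x)" for X
    by (intro continuous_intros c)
  show "continuous_on {0..1} (\<lambda>x. \<Sum>\<^sub>\<infinity>m. f m x)"
    by (rule uniform_limit_theorem[OF _ u]) (use cs in auto)
  obtain I J where IJ: "\<And>X. ((\<lambda>x. \<Sum>m\<in>X. f m x) has_integral I X) {0..1}"
     "((\<lambda>x. \<Sum>\<^sub>\<infinity>m. f m x) has_integral J) {0..1}" "(I \<longlongrightarrow> J) (finite_subsets_at_top UNIV)"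
    using uniform_limit_integral[OF u cs] by (metis finite_subsets_at_top_neq_bot)
  have "\<forall>\<^sub>F X in finite_subsets_at_top UNIV. I X = (\<Sum>m\<in>X. integral {0..1} (f m))"
  proof (rule eventually_finite_subsets_at_top_weakI)
    fix X :: "int set" assume "finite X"
    then have "((\<lambda>x. \<Sum>m\<in>X. f m x) has_integral (\<Sum>m\<in>X. integral {0..1} (f m))) {0..1}"
      by (intro has_integral_sum integrable_integral integrable_continuous_real c)
    then show "I X = (\<Sum>m\<in>X. integral {0..1} (f m))" using IJ(1) has_integral_unique by blast
  qed
  then have "((\<lambda>X. \<Sum>m\<in>X. integral {0..1} (f m)) \<longlongrightarrow> J) (finite_subsets_at_top UNIV)"
    using IJ(3) by (simp add: filterlim_cong)
  then show "((\<lambda>m. integral {0..1} (f m)) has_sum integral {0..1} (\<lambda>x. \<Sum>\<^sub>\<infinity>m. f m x)) UNIV"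
    using IJ(2) by (simp add: has_sum_def integral_unique)
qed

lemma infsum_of_real_complex: "(\<Sum>\<^sub>\<infinity>m\<in>A. complex_of_real (f m)) = of_real (\<Sum>\<^sub>\<infinity>m\<in>A. f m)"
proof (rule infsum_bounded_linear_strong[OF _ bounded_linear_of_real])
  show "(\<lambda>m. complex_of_real (f m)) summable_on A \<longleftrightarrow> f summable_on A"
    using summable_on_Re[of "\<lambda>m. complex_of_real (f m)" A] summable_on_of_real[of f A, where 'a = complex]
    by auto
qed

context
  fixes t :: real assumes t: "t > 0"
begin

private definition "g w = normal_density 0 (sqrt (2 * t)) w"
private definition "b k = exp (- 4 * pi\<^sup>2 * (of_int k)\<^sup>2 * t)" for k :: int
private definition "P z = (\<Sum>\<^sub>\<infinity>m::int. complex_of_real (g (z - of_int m)))"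
private definition "H z = (\<Sum>\<^sub>\<infinity>k::int. of_real (b k) * fourier_mode k z)"
private definition "B m = 1 / sqrt (4 * pi * t) * exp (1 / (4 * t)) * exp (- (1 / (8 * t)) * (of_int m)\<^sup>2)" for m :: int

private lemma continuous_g: "continuous_on A (\<lambda>z. g (h z))" if "continuous_on A h"
  using that t unfolding g_def normal_density_def by (intro continuous_intros) auto

private lemma g_bound: "cmod (of_real (g (z - of_int m))) \<le> B m" if "z \<in> {0..1}"
proof -
  have "z\<^sup>2 \<le> 1" using that by (simp add: power_le_one)
  moreover have "(of_int m)\<^sup>2 \<le> 2 * (z - of_int m)\<^sup>2 + 2 * z\<^sup>2"
    using zero_le_power2[of "2 * z - of_int m"] by (simp add: power2_eq_square algebra_simps)
  ultimately have "(of_int m)\<^sup>2 / 2 - 1 \<le> (z - of_int m)\<^sup>2" by simp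
  then have "- ((z - of_int m)\<^sup>2) / (4 * t) \<le> - ((of_int m)\<^sup>2 / 2 - 1) / (4 * t)"
    using t by (intro divide_right_mono) auto
  also have "\<dots> = 1 / (4 * t) + - (1 / (8 * t)) * (of_int m)\<^sup>2"
    using t by (simp add: field_simps)
  finally have "exp (- ((z - of_int m)\<^sup>2) / (4 * t)) \<le> exp (1 / (4 * t)) * exp (- (1 / (8 * t)) * (of_int m)\<^sup>2)"
    by (simp flip: exp_add)
  then have "1 / sqrt (4 * pi * t) * exp (- ((z - of_int m)\<^sup>2) / (4 * t)) \<le> B m"
    unfolding B_def mult.assoc using t by (intro mult_left_mono) auto
  then show ?thesis
    unfolding g_def normal_density_heat[OF t, symmetric] norm_of_real by simp
qed

private lemma B_summable: "B summable_on UNIV"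
  unfolding B_def by (intro summable_on_cmult_right exp_neg_square_summable) (use t in simp)

private lemma b_summable: "b summable_on UNIV"
  using exp_neg_square_summable[of "4 * pi\<^sup>2 * t"] t by (simp add: b_def[abs_def] mult_ac)

private lemma P_cont: "continuous_on {0..1} P"
  unfolding P_def
  by (rule termwise_integral(1)[OF _ g_bound B_summable])
     (intro continuous_intros continuous_g)

private lemma H_cont: "continuous_on {0..1} H"
  unfolding H_def
  by (rule termwise_integral(1)[OF _ _ b_summable])
     (auto intro!: continuous_intros simp: norm_mult b_def)

private lemma P_coeff: "integral {0..1} (\<lambda>z. P z * fourier_mode j z) = of_real (b j)"
proof -
  define h where "h w = of_real (g w) * fourier_mode j w" for w
  have hc: "continuous_on UNIV h"
    unfolding h_def by (intro continuous_intros continuous_g)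
  have hi: "integrable lborel h"
  proof (rule Bochner_Integration.integrable_bound)
    show "integrable lborel g" unfolding g_def[abs_def] using t by simp
    show "h \<in> borel_measurable lborel" using hc borel_measurable_continuous_onI by auto
  qed (auto simp: h_def norm_mult)
  have eq: "of_real (g (z - of_int m)) * fourier_mode j z = h (z - of_int m)" for z m
    by (simp add: h_def fourier_mode_shift)
  have PF: "(\<Sum>\<^sub>\<infinity>m. h (z - of_int m)) = P z * fourier_mode j z" for z
    unfolding P_def eq[symmetric] by (rule infsum_cmult_left')
  have "((\<lambda>m. integral {0..1} (\<lambda>z. h (z - of_int m))) has_sum integral {0..1} (\<lambda>z. P z * fourier_mode j z)) UNIV"
    unfolding PF[symmetric]
  proof (rule termwise_integral(2)[OF _ _ B_summable])
    show "continuous_on {0..1} (\<lambda>z. h (z - of_int m))" for m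
      by (intro continuous_on_compose2[OF hc] continuous_intros) auto
    show "cmod (h (z - of_int m)) \<le> B m" if "z \<in> {0..1}" for z m
      using g_bound[OF that] by (simp add: norm_mult flip: eq)
  qed
  then have "(\<lambda>N. \<Sum>m\<in>{- int N..int N}. integral {0..1} (\<lambda>z. h (z - of_int m)))
      \<longlonglongrightarrow> integral {0..1} (\<lambda>z. P z * fourier_mode j z)"
    unfolding has_sum_def by (rule filterlim_compose[OF _ filterlim_symmetric_int_intervals])
  then have "(\<lambda>N. integral {- real N..real N + 1} h) \<longlonglongrightarrow> integral {0..1} (\<lambda>z. P z * fourier_mode j z)"
    by (simp add: sum_unit_intervals[OF hc])
  with integral_growing_intervals[OF hc hi] have "integral {0..1} (\<lambda>z. P z * fourier_mode j z) = (LINT w|lborel. h w)"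
    using LIMSEQ_unique by blast
  also have "\<dots> = of_real (b j)"
    unfolding h_def g_def b_def by (rule fourier_transform_gaussian[OF t])
  finally show ?thesis .
qed

private lemma H_coeff: "integral {0..1} (\<lambda>z. H z * fourier_mode j z) = of_real (b j)"
proof -
  define f where "f k z = of_real (b k) * fourier_mode (k + j) z" for k z
  have eq: "(\<Sum>\<^sub>\<infinity>k. f k z) = H z * fourier_mode j z" for z
    unfolding H_def f_def fourier_mode_add mult.assoc[symmetric] by (rule infsum_cmult_left')
  have "((\<lambda>k. integral {0..1} (f k)) has_sum integral {0..1} (\<lambda>z. H z * fourier_mode j z)) UNIV"
    unfolding eq[symmetric]
    by (rule termwise_integral(2)[OF _ _ b_summable])
       (auto simp: f_def[abs_def] norm_mult b_def intro!: continuous_intros)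
  moreover have "(\<lambda>k. integral {0..1} (f k)) = (\<lambda>k. if k = - j then of_real (b j) else 0)"
    by (auto simp: f_def[abs_def] integral_fourier_mode b_def)
  moreover have "((\<lambda>k. if k = - j then complex_of_real (b j) else 0) has_sum of_real (b j)) UNIV"
    by (rule has_sum_finite_neutralI[of "{- j}"]) auto
  ultimately show ?thesis using has_sum_unique by fastforce
qed

private lemma P_shift: "P (z + of_int i) = P z"
proof -
  have "P z = (\<Sum>\<^sub>\<infinity>m. complex_of_real (g (z + of_int i - of_int (m + i))))" by (simp add: P_def)
  also have "\<dots> = P (z + of_int i)"
    unfolding P_def
    by (rule infsum_reindex_bij_betw[where g = "\<lambda>m. m + i" and f = "\<lambda>m. complex_of_real (g (z + of_int i - of_int m))"])
       (rule bij_betwI[of _ _ _ "\<lambda>m. m - i"], auto)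
  finally show ?thesis ..
qed

private lemma H_shift: "H (z + of_int i) = H z"
  using fourier_mode_shift[of _ "z + of_int i" i] by (simp add: H_def)

private lemma P_eq_H: "P z = H z"
proof -
  have base: "P x - H x = 0" if "x \<in> {0..1}" for x
  proof (rule fourier_orth_zero[OF _ _ that])
    show "P 0 - H 0 = P 1 - H 1" using P_shift[of 0 1] H_shift[of 0 1] by simp
    have int: "(\<lambda>z. P z * fourier_mode k z) integrable_on {0..1}" "(\<lambda>z. H z * fourier_mode k z) integrable_on {0..1}" for k
      by (intro integrable_continuous_real continuous_intros P_cont H_cont)+
    show "fourier_orth (\<lambda>z. P z - H z)"
      unfolding fourier_orth_def left_diff_distrib
      by (auto intro!: continuous_intros P_cont H_cont
          simp: Henstock_Kurzweil_Integration.integral_diff[OF int] P_coeff H_coeff)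
  qed
  have "P z = P (frac z)" "H z = H (frac z)"
    using P_shift[of "frac z" "\<lfloor>z\<rfloor>"] H_shift[of "frac z" "\<lfloor>z\<rfloor>"] by (simp_all add: frac_def)
  then show ?thesis using base[of "frac z"] by (simp add: frac_ge_0 frac_lt_1 less_imp_le)
qed

lemma heat_green_fourier:
  "complex_of_real (heat_green t x y) =
     (\<Sum>\<^sub>\<infinity>m::int. of_real (exp (- 4 * pi\<^sup>2 * (of_int m)\<^sup>2 * t)) * fourier_mode m (x - y))"
proof -
  have "heat_green t x y = (\<Sum>\<^sub>\<infinity>m::int. g (x - y - of_int m))"
    unfolding heat_green_def g_def normal_density_heat[OF t] by (rule infsum_cmult_right'[symmetric])
  then have "complex_of_real (heat_green t x y) = P (x - y)"
    unfolding P_def by (simp add: infsum_of_real_complex)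
  then show ?thesis by (simp add: P_eq_H H_def b_def)
qed

end

end

theory Submission
  imports Defs
begin

text \<open>On each translate of the grid the truncated kernel error is a discrete Fourier sum, so the
  discrete Parseval identity turns its \<open>L\<^sup>2\<close> norm into a sum of mode errors
  \<open>(exp (- 4 \<pi>\<^sup>2 j\<^sup>2 t) - c\<^sub>j)\<^sup>2\<close>, up to terms of relative size \<open>min 1 (j\<^sup>2 / n\<^sup>2)\<close> that account for the
  truncation and for replacing \<open>x\<close> and \<open>y\<close> by grid points. With \<open>z\<close> the product of \<open>\<tau>\<close> and the \<open>j\<close>-th
  discrete eigenvalue, stability has the uniform form \<open>\<bar>R\<^sub>1 R\<^sub>2\<bar> \<le> 1 - c z / (1 + z)\<close>. Resolved modes
  (\<open>z \<le> 1\<close>) then have squared error at most a constant times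
  \<open>(j\<^sup>2 / n\<^sup>2 + \<tau> j\<^sup>2) exp (- 8 c j\<^sup>2 t)\<close>, and unresolved modes (\<open>z > 1\<close>) are estimated crudely, using
  that \<open>\<tau> j\<^sup>2\<close> is bounded below. Both parts of the theorem follow from
  \<open>\<Sum>j. min 1 (\<eta> j\<^sup>2) j powr (- 2 \<alpha>) = O(\<eta> powr (\<alpha> - 1/2))\<close> with \<open>\<eta> = \<tau>\<close> and \<open>\<eta> = 1 / n\<^sup>2\<close>: part (i) is the
  case \<open>\<alpha> = 1\<close> after integration in time, and part (ii) uses \<open>exp (- s) \<le> s powr (- \<alpha>)\<close>.
  For \<open>1/2 < \<theta> < 1\<close> the unresolved modes decay only geometrically in the number of steps; they are
  applied to the absolutely convergent Fourier series of the \<open>H\<^sup>1\<close> datum.\<close>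

section \<open>The symbol of the scheme\<close>

text \<open>In \<open>L2\<close> of the unit interval the discrete kernel is not diagonal in the
  Fourier modes, because \<open>grid_floor\<close> turns each mode into a step function. Diagonality
  is restored by fixing the offset s of y inside its cell: on the points s + k/n the discrete mode
  is sampled exactly, and modes are orthogonal there as long as their frequencies are distinct
  modulo n. This is why the sums over 0, ..., n-1 are rewritten over residues of least absolute
  value, which also pairs each discrete mode with the heat mode that it approximates. The two Green
  functions differ at high frequency. The extra resolvent \<open>R1\<close> of the second one is of
  order 1/z, which supplies the missing decay of unresolved modes for every \<theta> > 1/2. The
  first one has no such factor, so the powers of the symbol alone must decay, or the datum must
  help. The estimates therefore leave the multiplier free on unresolved modes, so that these can be
  split off. Numerical constants come from repeated use of (a+b)^2 \<le> 2a^2 + 2b^2 and from pi^2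
  \<le> 10.\<close>

definition symb :: "real \<Rightarrow> real \<Rightarrow> real" where
  "symb \<theta> z = (1 - (1 - \<theta>) * z) / (1 + \<theta> * z)"

definition mu :: "nat \<Rightarrow> nat \<Rightarrow> real" where
  "mu n j = - eigval n j"

lemma R1_mult_R2: "R1 \<theta> n \<tau> l * R2 \<theta> n \<tau> l = symb \<theta> (\<tau> * mu n l)"
  by (simp add: R1_def R2_def symb_def mu_def divide_inverse mult_ac)

lemma R1_eq: "R1 \<theta> n \<tau> l = 1 / (1 + \<theta> * (\<tau> * mu n l))"
  by (simp add: R1_def mu_def divide_inverse mult_ac)

lemma mu_0 [simp]: "mu n 0 = 0"
  by (simp add: mu_def eigval_def)

section \<open>Bounds for the discrete eigenvalues\<close>

lemma mu_nonneg: "mu n j \<ge> 0"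
  by (simp add: mu_def eigval_def)

lemma mu_le_4: "mu n j \<le> 4 * (real n)\<^sup>2"
proof -
  have "(sin (real j * pi / real n))\<^sup>2 \<le> 1"
    by (simp add: abs_sin_le_one abs_square_le_1)
  then have "4 * (real n)\<^sup>2 * (sin (real j * pi / real n))\<^sup>2 \<le> 4 * (real n)\<^sup>2 * 1"
    by (intro mult_left_mono) auto
  then show ?thesis by (simp add: mu_def eigval_def)
qed

lemma mu_le: "mu n j \<le> 4 * pi\<^sup>2 * (real j)\<^sup>2"
proof (cases "n = 0")
  case False
  have "\<bar>sin (real j * pi / real n)\<bar> \<le> \<bar>real j * pi / real n\<bar>" by (rule abs_sin_x_le_abs_x)
  then have "(sin (real j * pi / real n))\<^sup>2 \<le> (real j * pi / real n)\<^sup>2"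
    by (simp only: abs_le_square_iff)
  then have "4 * (real n)\<^sup>2 * (sin (real j * pi / real n))\<^sup>2 \<le> 4 * (real n)\<^sup>2 * (real j * pi / real n)\<^sup>2"
    by (intro mult_left_mono) auto
  then show ?thesis using False by (simp add: mu_def eigval_def power_divide power_mult_distrib mult_ac)
qed (simp add: mu_def eigval_def)

text \<open>Jordan's inequality: the sine is concave on [0, pi] and so lies above its chord between
  0 and pi/2.\<close>

lemma sin_ge_two_div_pi:
  assumes "0 \<le> x" "x \<le> pi / 2"
  shows "2 / pi * x \<le> sin x"
proof -
  have "concave_on {0..pi} sin"
  proof (rule f''_le0_imp_concave)
    show "(sin has_real_derivative cos x) (at x)" "(cos has_real_derivative - sin x) (at x)" for x
      by (auto intro!: derivative_eq_intros)
    show "- sin x \<le> 0" if "x \<in> {0..pi}" for x using that sin_ge_zero by auto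
  qed auto
  from concave_onD[OF this, of "2 * x / pi" 0 "pi / 2"] assms
  show ?thesis by (simp add: field_simps)
qed

text \<open>Jordan's inequality applies because 2j \<le> n puts j pi/n into [0, pi/2]. Beyond that
  range the eigenvalues decrease again, which is one reason for working with frequencies of absolute
  value at most n/2.\<close>

lemma mu_ge:
  assumes "2 * j \<le> n" "n > 0"
  shows "16 * (real j)\<^sup>2 \<le> mu n j"
proof -
  have j: "2 * real j \<le> real n" using assms by linarith
  have "2 / pi * (real j * pi / real n) \<le> sin (real j * pi / real n)"
    using assms j by (intro sin_ge_two_div_pi) (auto simp: field_simps)
  then have "2 * real j / real n \<le> sin (real j * pi / real n)" by simp
  then have "(2 * real j / real n)\<^sup>2 \<le> (sin (real j * pi / real n))\<^sup>2"
    by (intro power_mono) auto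
  then have "4 * (real n)\<^sup>2 * (2 * real j / real n)\<^sup>2 \<le> 4 * (real n)\<^sup>2 * (sin (real j * pi / real n))\<^sup>2"
    by (intro mult_left_mono) auto
  then show ?thesis using assms by (simp add: mu_def eigval_def power_divide power_mult_distrib)
qed

text \<open>With x = j pi/n, the Taylor bound x - x^3/6 \<le> sin x gives x^2 - (sin x)^2 \<le> x^4.
  Multiplied by 4n^2 this is an error of relative order j^2/n^2.\<close>

lemma mu_diff:
  assumes "2 * j \<le> n" "n > 0"
  shows "4 * pi\<^sup>2 * (real j)\<^sup>2 - mu n j \<le> 4 * pi ^ 4 * (real j) ^ 4 / (real n)\<^sup>2"
proof -
  define x where "x = real j * pi / real n"
  have j: "2 * real j \<le> real n" using assms by linarith
  have x: "0 \<le> x" "x \<le> pi" using assms j by (auto simp: x_def field_simps)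
  have s: "sin x \<le> x" "0 \<le> sin x" using x sin_x_le_x sin_ge_zero by auto
  have l: "x - x ^ 3 / 6 \<le> sin x"
  proof -
    have "\<bar>sin x - (\<Sum>k<3. sin_coeff k * x ^ k)\<bar> \<le> inverse (fact 3) * \<bar>x\<bar> ^ 3"
      using Maclaurin_sin_bound[of x 3] by simp
    then show ?thesis using x by (simp add: eval_nat_numeral sin_coeff_def abs_if split: if_splits)
  qed
  have "x\<^sup>2 - (sin x)\<^sup>2 = (x - sin x) * (x + sin x)" by (simp add: power2_eq_square algebra_simps)
  also have "\<dots> \<le> x ^ 3 / 6 * (2 * x)" using s l x by (intro mult_mono) auto
  also have "\<dots> \<le> x ^ 4" using x by (simp add: eval_nat_numeral)
  finally have "4 * (real n)\<^sup>2 * (x\<^sup>2 - (sin x)\<^sup>2) \<le> 4 * (real n)\<^sup>2 * x ^ 4" by (intro mult_left_mono) auto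
  moreover have "4 * (real n)\<^sup>2 * x\<^sup>2 = 4 * pi\<^sup>2 * (real j)\<^sup>2"
    using assms by (simp add: x_def power_divide power_mult_distrib)
  moreover have "4 * (real n)\<^sup>2 * x ^ 4 = 4 * pi ^ 4 * (real j) ^ 4 / (real n)\<^sup>2"
    using assms by (simp add: x_def power_divide power_mult_distrib field_simps eval_nat_numeral)
  ultimately show ?thesis
    by (simp add: mu_def eigval_def right_diff_distrib flip: x_def)
qed

section \<open>Consistency and stability of the time stepping\<close>

lemma pi_sq_le: "pi\<^sup>2 \<le> 10"
proof -
  have "pi \<le> 3.15" using pi_approx by simp
  then have "pi * pi \<le> 3.15 * 3.15" by (intro mult_mono) auto
  then show ?thesis by (simp add: power2_eq_square)
qed

lemma sum_squares_bound_add: "(a + b)\<^sup>2 \<le> 2 * a\<^sup>2 + 2 * b\<^sup>2" for a b :: real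
  using zero_le_power2[of "a - b"] by (simp add: power2_eq_square algebra_simps)

text \<open>The k factors are exchanged one at a time: each exchange costs the one-step error and
  leaves k - 1 factors bounded by p. Keeping these factors preserves the decay in time.\<close>

lemma abs_power_diff_le:
  fixes x y p :: real
  assumes "\<bar>x\<bar> \<le> p" "\<bar>y\<bar> \<le> p"
  shows "\<bar>x ^ k - y ^ k\<bar> \<le> real k * \<bar>x - y\<bar> * p ^ (k - 1)"
proof (induction k)
  case (Suc k)
  have p: "p \<ge> 0" using assms by linarith
  have "x ^ Suc k - y ^ Suc k = x * (x ^ k - y ^ k) + (x - y) * y ^ k" by (simp add: algebra_simps)
  then have "\<bar>x ^ Suc k - y ^ Suc k\<bar> \<le> \<bar>x\<bar> * \<bar>x ^ k - y ^ k\<bar> + \<bar>x - y\<bar> * \<bar>y\<bar> ^ k"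
    by (metis abs_mult abs_triangle_ineq power_abs)
  also have "\<dots> \<le> p * (real k * \<bar>x - y\<bar> * p ^ (k - 1)) + \<bar>x - y\<bar> * p ^ k"
    using assms p Suc by (intro add_mono mult_mono power_mono) auto
  also have "\<dots> = real (Suc k) * \<bar>x - y\<bar> * p ^ (Suc k - 1)"
    by (cases k) (auto simp: algebra_simps)
  finally show ?case .
qed simp

text \<open>Both numbers lie between \<open>1 - z\<close> and \<open>1 - z + z\<^sup>2\<close>.\<close>
lemma exp_symb_diff:
  assumes "0 \<le> \<theta>" "\<theta> \<le> 1" "0 \<le> z" "z \<le> 1"
  shows "\<bar>exp (- z) - symb \<theta> z\<bar> \<le> z\<^sup>2"
proof -
  have d: "1 + \<theta> * z > 0" using assms by (simp add: add_pos_nonneg)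
  have s: "symb \<theta> z = 1 - z + \<theta> * z\<^sup>2 / (1 + \<theta> * z)"
    using d by (simp add: symb_def field_simps power2_eq_square)
  have "\<theta> * z\<^sup>2 / (1 + \<theta> * z) \<le> z\<^sup>2"
  proof -
    have "\<theta> * z\<^sup>2 \<le> 1 * z\<^sup>2" using assms by (intro mult_right_mono) auto
    also have "\<dots> \<le> z\<^sup>2 * (1 + \<theta> * z)" using assms by (simp add: algebra_simps)
    finally show ?thesis using d by (simp add: field_simps)
  qed
  moreover have "0 \<le> \<theta> * z\<^sup>2 / (1 + \<theta> * z)" using assms d by simp
  moreover have "1 - z \<le> exp (- z)" using exp_ge_add_one_self[of "- z"] by simp
  moreover have "exp (- z) \<le> 1 - z + z\<^sup>2"
  proof -
    have "exp (- z) \<le> 1 / (1 + z)" using assms exp_ge_add_one_self[of z]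
      by (simp add: exp_minus field_simps)
    also have "\<dots> \<le> 1 - z + z\<^sup>2" using assms by (simp add: field_simps power2_eq_square)
    finally show ?thesis .
  qed
  ultimately show ?thesis unfolding s by linarith
qed

text \<open>The bound on the absolute value is a pair of one-sided bounds. On one side 1 - symb =
  z/(1 + \<theta>z) is at least z/(1 + z). On the other side 1 + symb = (2 - (1 - 2\<theta>)z)/(1 +
  \<theta>z) has to stay above c, and here the step-size condition enters by keeping z below Z when
  \<theta> \<le> 1/2.\<close>

lemma stability_constant:
  assumes "0 \<le> \<theta>" "\<theta> \<le> 1" "0 < \<epsilon>" "\<epsilon> < 1/2" "\<rho> > 0"
  obtains c Z where "0 < c" "c \<le> 1" "Z > 0"
    "\<And>n \<tau> j. \<tau> > 0 \<Longrightarrow> step_condition \<theta> \<rho> \<epsilon> n \<tau> \<Longrightarrow>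
       \<bar>symb \<theta> (\<tau> * mu n j)\<bar> \<le> 1 - c * (\<tau> * mu n j / (1 + \<tau> * mu n j))"
    "\<And>n \<tau> j. \<theta> \<le> 1/2 \<Longrightarrow> \<tau> > 0 \<Longrightarrow> step_condition \<theta> \<rho> \<epsilon> n \<tau> \<Longrightarrow> \<tau> * mu n j \<le> Z"
proof -
  define Z where "Z = (if \<theta> < 1/2 then 4 * \<rho> else 4 / \<epsilon>)"
  have Z: "Z > 0" using assms by (simp add: Z_def)
  have bd: "\<tau> * mu n j \<le> Z \<and> (\<theta> < 1/2 \<longrightarrow> \<rho> < 1 / (2 - 4 * \<theta>))"
    if "\<theta> \<le> 1/2" "\<tau> > 0" "step_condition \<theta> \<rho> \<epsilon> n \<tau>" for n \<tau> j
  proof -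
    have "\<tau> * mu n j \<le> \<tau> * (4 * (real n)\<^sup>2)" using that by (intro mult_left_mono mu_le_4) auto
    then have le: "\<tau> * mu n j \<le> 4 * ((real n)\<^sup>2 * \<tau>)" by (simp only: mult_ac)
    show ?thesis
    proof (cases "\<theta> = 1/2")
      case True
      then have "(real n)\<^sup>2 * \<tau> \<le> 1 / \<epsilon>" using that by (simp add: step_condition_def)
      then have "\<tau> * mu n j \<le> 4 * (1 / \<epsilon>)" using le by linarith
      then show ?thesis using True by (simp add: Z_def)
    next
      case False
      then have "(real n)\<^sup>2 * \<tau> \<le> \<rho>" "\<rho> < 1 / (2 - 4 * \<theta>)" using that assms by (auto simp: step_condition_def)
      moreover from this have "\<tau> * mu n j \<le> 4 * \<rho>" using le by linarith
      ultimately show ?thesis using False that unfolding Z_def by auto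
    qed
  qed
  \<comment> \<open>Each branch is a lower bound for 1 + symb. For \<theta> < 1/2 the numerator
    decreases in z and is taken at Z, over a denominator of at most 1 + Z; for \<theta> = 1/2 the
    expression is 2/(1 + z/2); for \<theta> > 1/2 it exceeds 2\<theta> - 1 for all z \<ge>
    0.\<close>
  define c where "c = (if \<theta> < 1/2 then min 1 ((2 - (1 - 2 * \<theta>) * Z) / (1 + Z))
      else if \<theta> = 1/2 then 2 / (2 + Z) else (2 * \<theta> - 1))"
  show ?thesis
  proof (cases "\<theta> < 1/2 \<and> \<rho> \<ge> 1 / (2 - 4 * \<theta>)")
    case True
    \<comment> \<open>The inequality for \<rho> is a conjunct of \<open>step_condition\<close>, so
      in this case no step size is admissible and the claims are vacuous.\<close>
    then have "\<not> step_condition \<theta> \<rho> \<epsilon> n \<tau>" for n \<tau> using assms by (auto simp: step_condition_def)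
    then show ?thesis using that[of 1 1] by auto
  next
    case F: False
    have num: "2 - (1 - 2 * \<theta>) * Z > 0" if "\<theta> < 1/2"
      using F that by (auto simp: Z_def field_simps)
    have c: "0 < c" "c \<le> 1" using assms Z num by (auto simp: c_def field_simps)
    have "\<bar>symb \<theta> z\<bar> \<le> 1 - c * (z / (1 + z))" if z: "0 \<le> z" "\<theta> \<le> 1/2 \<Longrightarrow> z \<le> Z" for z
    proof -
      have d: "1 + \<theta> * z > 0" using assms z by (simp add: add_pos_nonneg)
      have q: "z / (1 + z) \<le> 1" "0 \<le> z / (1 + z)" using z by auto
      have tz: "\<theta> * z \<le> z" using assms z mult_right_mono[of \<theta> 1 z] by simp
      have "c * (z / (1 + z)) \<le> z / (1 + z)" using c q mult_right_mono[of c 1 "z / (1 + z)"] by simp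
      also have "\<dots> \<le> z / (1 + \<theta> * z)" using z d tz by (intro divide_left_mono) auto
      also have "\<dots> = 1 - symb \<theta> z" using d by (simp add: symb_def field_simps)
      finally have 1: "symb \<theta> z \<le> 1 - c * (z / (1 + z))" by simp
      have "c * (z / (1 + z)) \<le> c" using c q mult_left_mono[of "z / (1 + z)" 1 c] by simp
      also have "c \<le> (2 - (1 - 2 * \<theta>) * z) / (1 + \<theta> * z)"
      proof (cases "\<theta> < 1/2")
        case True
        then have zZ: "z \<le> Z" using z by auto
        have "c \<le> (2 - (1 - 2 * \<theta>) * Z) / (1 + Z)" using True by (simp add: c_def)
        also have "\<dots> \<le> (2 - (1 - 2 * \<theta>) * z) / (1 + \<theta> * z)"
        proof (intro frac_le)
          have "(1 - 2 * \<theta>) * z \<le> (1 - 2 * \<theta>) * Z" using zZ True by (intro mult_left_mono) auto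
          then show "0 \<le> 2 - (1 - 2 * \<theta>) * z" "2 - (1 - 2 * \<theta>) * Z \<le> 2 - (1 - 2 * \<theta>) * z"
            using num[OF True] by linarith+
        qed (use d tz zZ in auto)
        finally show ?thesis .
      next
        case nl: False
        show ?thesis
        proof (cases "\<theta> = 1/2")
          case True
          have zZ: "z \<le> Z" using z True by auto
          have "2 / (2 + Z) \<le> 2 / (1 + z / 2)" using zZ z Z by (intro divide_left_mono) auto
          also have "2 / (1 + z / 2) = (2 - (1 - 2 * \<theta>) * z) / (1 + \<theta> * z)" unfolding True by simp
          also have "2 / (2 + Z) = c" using True by (simp add: c_def)
          finally show ?thesis .
        next
          case False
          with nl have t: "\<theta> > 1/2" by simp
          have "(2 * \<theta> - 1) * (1 + \<theta> * z) = (2 * \<theta> - 1) + (2 * \<theta> - 1) * (\<theta> * z)" by (simp add: algebra_simps)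
          also have "\<dots> \<le> 2 + (2 * \<theta> - 1) * z" using tz t assms by (intro add_mono mult_left_mono) auto
          finally have "(2 * \<theta> - 1) * (1 + \<theta> * z) \<le> 2 - (1 - 2 * \<theta>) * z" by (simp add: algebra_simps)
          then show ?thesis using t d by (simp add: c_def pos_le_divide_eq)
        qed
      qed
      also have "\<dots> = 1 + symb \<theta> z" using d by (simp add: symb_def field_simps)
      finally show ?thesis using 1 by linarith
    qed
    then show ?thesis using that[OF c Z] bd mu_nonneg by (metis mult_nonneg_nonneg less_imp_le)
  qed
qed

lemma times_exp_neg_le: "0 \<le> x \<Longrightarrow> x * exp (- x) \<le> (1 :: real)"
proof -
  assume "0 \<le> x"
  moreover have "x \<le> exp x" using exp_ge_add_one_self[of x] by linarith
  ultimately show ?thesis unfolding exp_minus by (simp add: divide_simps)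
qed

text \<open>Here s stands for eigenvalue times t and k for the number of completed steps, so s - zk
  is the part of t lost by rounding. The comparison runs through exp(-zk) and r^k: rounding of t,
  accumulated one-step errors, and the factor R each cost O(z).\<close>

lemma time_error:
  fixes r R z s c :: real
  assumes z: "0 \<le> z" "z \<le> 1" and c: "0 < c" "c \<le> 1"
    and r: "\<bar>r\<bar> \<le> 1 - c * (z / (1 + z))" "\<bar>exp (- z) - r\<bar> \<le> z\<^sup>2"
    and R: "1 - z \<le> R" "R \<le> 1" and s: "z * real k \<le> s" "s \<le> z * real k + z"
  shows "\<bar>exp (- s) - r ^ k * R\<bar> \<le> 48 / c * z * exp (- (c * s / 4))"
proof -
  define d where "d = c / 4"
  have d: "0 < d" "d \<le> 1/4" using c by (simp_all add: d_def)
  \<comment> \<open>Since z \<le> 1, z/(1+z) \<ge> z/2, so p dominates both exp(-z) and |r|.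
    Moreover p^k = e^2 for the \<open>e\<close> defined next: one factor e absorbs the growing
    product zk, the other one remains as decay.\<close>
  define p where "p = exp (- (c * z / 2))"
  define e where "e = exp (- (d * z * real k))"
  have e0: "e > 0" by (simp add: e_def)
  have "z / 2 \<le> z / (1 + z)" using z by (intro divide_left_mono) auto
  then have "c * (z / 2) \<le> c * (z / (1 + z))" using c by (intro mult_left_mono) auto
  then have "\<bar>r\<bar> \<le> 1 - c * z / 2" using r by simp
  also have "\<dots> \<le> p" using exp_ge_add_one_self[of "- (c * z / 2)"] by (simp add: p_def)
  finally have rp: "\<bar>r\<bar> \<le> p" .
  have cz: "c * z \<le> z" using c z mult_right_mono[of c 1 z] by simp
  have ep: "\<bar>exp (- z)\<bar> \<le> p" using cz z by (simp add: p_def)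
  have "1 - c * z / 2 \<le> p" using exp_ge_add_one_self[of "- (c * z / 2)"] by (simp add: p_def)
  then have p2: "1 / 2 \<le> p" "p > 0" using cz z by (auto simp: p_def)
  have pk: "p ^ k = e * e"
    by (simp add: p_def e_def d_def mult_ac flip: exp_of_nat_mult exp_add)
  have e1: "e \<le> 1" using d z by (simp add: e_def)
  have eze: "exp (- z) ^ k = exp (- (z * real k))" by (simp add: mult.commute flip: exp_of_nat_mult)
  have 1: "\<bar>exp (- (z * real k)) - r ^ k\<bar> \<le> 2 / d * z * e"
  proof (cases k)
    case 0
    then show ?thesis using d z e0 by simp
  next
    case (Suc k')
    have "\<bar>exp (- z) ^ k - r ^ k\<bar> \<le> real k * \<bar>exp (- z) - r\<bar> * p ^ (k - 1)"
      by (rule abs_power_diff_le[OF ep rp])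
    \<comment> \<open>From p \<ge> 1/2 the missing power is restored at the cost of a factor
      2.\<close>
    also have "\<dots> \<le> real k * z\<^sup>2 * (2 * p ^ k)"
      using r p2 Suc by (intro mult_mono) (auto simp: mult_left_mono)
    also have "\<dots> = 2 / d * z * ((d * z * real k) * e) * e"
      using d by (simp add: pk power2_eq_square)
    also have "\<dots> \<le> 2 / d * z * 1 * e"
      using d z e0 times_exp_neg_le[of "d * z * real k"]
      by (intro mult_right_mono mult_left_mono) (auto simp: e_def)
    finally show ?thesis unfolding eze by simp
  qed
  have "\<bar>r ^ k - r ^ k * R\<bar> = \<bar>r\<bar> ^ k * (1 - R)"
    using R by (simp add: power_abs abs_mult flip: right_diff_distrib[of "r ^ k" 1 R, simplified])
  also have "\<dots> \<le> p ^ k * z" using rp R z p2 by (intro mult_mono power_mono) auto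
  also have "\<dots> \<le> z * e" using e0 e1 z mult_left_mono[of e 1 "e * z"] by (simp add: pk mult_ac)
  finally have 2: "\<bar>r ^ k - r ^ k * R\<bar> \<le> z * e" .
  have "exp (- s) = exp (- (z * real k)) * exp (- (s - z * real k))" by (simp flip: exp_add)
  then have "\<bar>exp (- s) - exp (- (z * real k))\<bar> = exp (- (z * real k)) * \<bar>exp (- (s - z * real k)) - 1\<bar>"
    by (metis abs_exp_cancel abs_mult mult.right_neutral right_diff_distrib)
  also have "\<dots> \<le> e * z"
  proof (intro mult_mono)
    show "exp (- (z * real k)) \<le> e"
      using d z mult_right_mono[of d 1 "z * real k"] by (simp add: e_def mult_ac)
    show "\<bar>exp (- (s - z * real k)) - 1\<bar> \<le> z"
      using exp_ge_add_one_self[of "- (s - z * real k)"] s z exp_le_one_iff[of "- (s - z * real k)"] by linarith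
  qed (use e0 in auto)
  finally have 3: "\<bar>exp (- s) - exp (- (z * real k))\<bar> \<le> e * z" .
  have "\<bar>exp (- s) - r ^ k * R\<bar> \<le> e * z + 2 / d * z * e + z * e" using 1 2 3 by linarith
  also have "\<dots> = (2 / d + 2) * (z * e)" by (simp add: algebra_simps)
  also have "\<dots> \<le> (4 / d) * (z * e)"
    using d z e0 by (intro mult_right_mono) (auto simp: field_simps)
  \<comment> \<open>Returning from zk to s costs exp(dz) \<le> 3, whence 48/c = 3 (4/d) with d =
    c/4.\<close>
  also have "\<dots> \<le> (4 / d) * (z * (3 * exp (- (d * s))))"
  proof (intro mult_left_mono)
    have "d * s \<le> d * (z * real k + z)" using d s by (intro mult_left_mono) auto
    also have "\<dots> \<le> d * z * real k + 1" using d z mult_mono[of d 1 z 1] by (simp add: algebra_simps)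
    finally have "e \<le> exp (1 + - (d * s))" by (simp add: e_def)
    also have "\<dots> \<le> 3 * exp (- (d * s))" unfolding exp_add using exp_le by (intro mult_right_mono) auto
    finally show "e \<le> 3 * exp (- (d * s))" .
  qed (use d z in auto)
  finally show ?thesis using c by (simp add: d_def)
qed

section \<open>Weighted sums of powers\<close>

lemma powr_neg_telescope:
  assumes "\<alpha> > 1/2" "j \<ge> 1"
  shows "real (Suc j) powr (- 2 * \<alpha>) \<le> (real j powr (1 - 2 * \<alpha>) - real (Suc j) powr (1 - 2 * \<alpha>)) / (2 * \<alpha> - 1)"
proof -
  have "\<exists>\<xi>>real j. \<xi> < real (Suc j) \<and> real (Suc j) powr (1 - 2 * \<alpha>) - real j powr (1 - 2 * \<alpha>)
      = (real (Suc j) - real j) * ((1 - 2 * \<alpha>) * \<xi> powr (- 2 * \<alpha>))"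
  proof (rule MVT2)
    show "((\<lambda>x. x powr (1 - 2 * \<alpha>)) has_real_derivative (1 - 2 * \<alpha>) * x powr (- 2 * \<alpha>)) (at x)"
      if "real j \<le> x" for x
      using that assms by (auto intro!: derivative_eq_intros)
  qed simp
  then obtain \<xi> where \<xi>: "real j < \<xi>" "\<xi> < real (Suc j)"
    "real (Suc j) powr (1 - 2 * \<alpha>) - real j powr (1 - 2 * \<alpha>) = (1 - 2 * \<alpha>) * \<xi> powr (- 2 * \<alpha>)" by auto
  have "real (Suc j) powr (- 2 * \<alpha>) \<le> \<xi> powr (- 2 * \<alpha>)"
    using \<xi> assms by (intro powr_mono2') auto
  also have "\<dots> = (real j powr (1 - 2 * \<alpha>) - real (Suc j) powr (1 - 2 * \<alpha>)) / (2 * \<alpha> - 1)"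
    using \<xi>(3) assms by (simp add: field_simps)
  finally show ?thesis .
qed

text \<open>An integral test: the increments supplied by the mean value theorem telescope.\<close>

lemma sum_powr_tail_le:
  assumes "\<alpha> > 1/2" "J \<ge> 1"
  shows "(\<Sum>j=Suc J..N. real j powr (- 2 * \<alpha>)) \<le> real J powr (1 - 2 * \<alpha>) / (2 * \<alpha> - 1)"
proof (cases "J \<le> N")
  case True
  then have "(\<Sum>j=Suc J..N. real j powr (- 2 * \<alpha>)) \<le> (real J powr (1 - 2 * \<alpha>) - real N powr (1 - 2 * \<alpha>)) / (2 * \<alpha> - 1)"
  proof (induction N rule: dec_induct)
    case (step N)
    then show ?case using powr_neg_telescope[of \<alpha> N] assms by (simp add: diff_divide_distrib)
  qed simp
  also have "\<dots> \<le> real J powr (1 - 2 * \<alpha>) / (2 * \<alpha> - 1)"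
    using assms by (intro divide_right_mono) auto
  finally show ?thesis .
qed (use assms in auto)

text \<open>The minimum switches branch at j = \<eta> powr (-1/2). Below, the summand \<eta> j powr
  (2 - 2\<alpha>) is increasing because \<alpha> \<le> 1 and is replaced by its value at J; above,
  the tail estimate applies. Both pieces have the same order. The 4 bounds 2 powr (3 - 2\<alpha>),
  which stems from rounding the threshold up to J \<le> 2s.\<close>

lemma sum_min_powr_le:
  assumes \<alpha>: "1/2 < \<alpha>" "\<alpha> \<le> 1" and \<eta>: "0 < \<eta>" "\<eta> \<le> 1"
  shows "(\<Sum>j=1..N. min 1 (\<eta> * (real j)\<^sup>2) * real j powr (- 2 * \<alpha>)) \<le> (4 + 1 / (2 * \<alpha> - 1)) * \<eta> powr (\<alpha> - 1/2)"
proof -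
  define s where "s = \<eta> powr (- 1/2)"
  define J where "J = nat \<lceil>s\<rceil>"
  have s1: "s \<ge> 1" using powr_mono'[of "- 1/2" 0 \<eta>] \<eta> by (simp add: s_def)
  have J: "s \<le> real J" "real J \<le> 2 * s" using s1 unfolding J_def by linarith+
  have J1: "J \<ge> 1" using J s1 by linarith
  let ?f = "\<lambda>j. min 1 (\<eta> * (real j)\<^sup>2) * real j powr (- 2 * \<alpha>)"
  \<comment> \<open>The union may exceed {1..N} when J > N; the surplus terms are
    nonnegative.\<close>
  have "(\<Sum>j=1..N. ?f j) \<le> (\<Sum>j\<in>{1..J} \<union> {Suc J..N}. ?f j)"
    using \<eta> by (intro sum_mono2) auto
  also have "\<dots> = (\<Sum>j=1..J. ?f j) + (\<Sum>j=Suc J..N. ?f j)"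
    by (intro sum.union_disjoint) auto
  also have "(\<Sum>j=1..J. ?f j) \<le> (\<Sum>j=1..J. \<eta> * real J powr (2 - 2 * \<alpha>))"
  proof (intro sum_mono)
    fix j assume j: "j \<in> {1..J}"
    have "?f j \<le> (\<eta> * (real j)\<^sup>2) * real j powr (- 2 * \<alpha>)" by (intro mult_right_mono) auto
    also have "\<dots> = \<eta> * (real j powr 2 * real j powr (- 2 * \<alpha>))" using j by simp
    also have "\<dots> = \<eta> * real j powr (2 - 2 * \<alpha>)" by (simp only: powr_add[symmetric]) simp
    also have "\<dots> \<le> \<eta> * real J powr (2 - 2 * \<alpha>)"
      using j \<alpha> \<eta> by (intro mult_left_mono powr_mono2) auto
    finally show "?f j \<le> \<eta> * real J powr (2 - 2 * \<alpha>)" .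
  qed
  also have "\<dots> = \<eta> * (real J powr 1 * real J powr (2 - 2 * \<alpha>))" by simp
  also have "\<dots> = \<eta> * real J powr (3 - 2 * \<alpha>)" by (simp only: powr_add[symmetric]) simp
  also have "\<dots> \<le> \<eta> * (2 * s) powr (3 - 2 * \<alpha>)" using J \<alpha> \<eta> by (intro mult_left_mono powr_mono2) auto
  also have "\<dots> = 2 powr (3 - 2 * \<alpha>) * (\<eta> powr 1 * s powr (3 - 2 * \<alpha>))" using s1 \<eta> by (simp add: powr_mult)
  also have "\<eta> powr 1 * s powr (3 - 2 * \<alpha>) = \<eta> powr (\<alpha> - 1/2)"
    by (simp only: s_def powr_powr powr_add[symmetric]) (simp add: field_simps)
  also have "2 powr (3 - 2 * \<alpha>) * \<eta> powr (\<alpha> - 1/2) \<le> 2 powr 2 * \<eta> powr (\<alpha> - 1/2)"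
    using \<alpha> by (intro mult_right_mono powr_mono) auto
  also have "(\<Sum>j=Suc J..N. ?f j) \<le> (\<Sum>j=Suc J..N. real j powr (- 2 * \<alpha>))"
    by (intro sum_mono mult_left_le_one_le) (use \<eta> in auto)
  also have "\<dots> \<le> real J powr (1 - 2 * \<alpha>) / (2 * \<alpha> - 1)" using \<alpha> J1 by (intro sum_powr_tail_le)
  also have "\<dots> \<le> s powr (1 - 2 * \<alpha>) / (2 * \<alpha> - 1)"
    using \<alpha> J s1 by (intro divide_right_mono powr_mono2') auto
  also have "s powr (1 - 2 * \<alpha>) = \<eta> powr (\<alpha> - 1/2)"
  proof -
    have "- 1 / 2 * (1 - 2 * \<alpha>) = \<alpha> - 1 / 2" by (simp add: field_simps)
    then show ?thesis by (simp only: s_def powr_powr)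
  qed
  finally show ?thesis by (simp add: algebra_simps)
qed

text \<open>Consistency error of a resolved mode: the two terms come from the spatial and the temporal
  discretisation of the eigenvalue.\<close>
lemma resolved_mode_error:
  fixes \<theta> \<tau> c t R :: real and j n :: nat
  defines "z \<equiv> \<tau> * mu n j"
  assumes \<theta>: "0 \<le> \<theta>" "\<theta> \<le> 1" and \<tau>: "\<tau> > 0" and t: "t > 0" and c: "0 < c" "c \<le> 1"
    and j: "1 \<le> j" "2 * j \<le> n" and z1: "z \<le> 1"
    and st: "\<bar>symb \<theta> z\<bar> \<le> 1 - c * (z / (1 + z))"
    and R: "1 - z \<le> R" "R \<le> 1"
  shows "(exp (- 4 * pi\<^sup>2 * (real j)\<^sup>2 * t) - symb \<theta> z ^ nat \<lfloor>t / \<tau>\<rfloor> * R)\<^sup>2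
     \<le> 200000 / c\<^sup>2 * ((real j)\<^sup>2 / (real n)\<^sup>2 + \<tau> * (real j)\<^sup>2) * exp (- 8 * c * (real j)\<^sup>2 * t)"
proof -
  define J where "J = (real j)\<^sup>2"
  define a where "a = 4 * pi\<^sup>2 * J"
  define b where "b = mu n j"
  define k where "k = nat \<lfloor>t / \<tau>\<rfloor>"
  define N where "N = (real n)\<^sup>2"
  have J1: "J \<ge> 1" using j by (simp add: J_def)
  have n: "n > 0" "N > 0" using j by (auto simp: N_def)
  have JN: "J \<le> N" using j unfolding J_def N_def by (intro power_mono) auto
  have b: "16 * J \<le> b" "b \<le> a"
    using mu_ge[of j n] mu_le[of n j] j n by (auto simp: b_def a_def J_def)
  then have "b > 0" using J1 by linarith
  note b = b this
  have a40: "a \<le> 40 * J" using pi_sq_le J1 by (simp add: a_def)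
  have "a - b \<le> 4 * (pi\<^sup>2 * pi\<^sup>2) * (J * J) / N"
    using mu_diff[of j n] j n by (simp add: b_def a_def J_def N_def eval_nat_numeral mult_ac)
  also have "\<dots> \<le> 4 * (10 * 10) * (J * J) / N"
    using pi_sq_le n J1 by (intro divide_right_mono mult_right_mono mult_left_mono mult_mono) auto
  finally have ab: "a - b \<le> 400 * (J * J) / N" by simp
  \<comment> \<open>It is the relative eigenvalue error that counts, because (a-b) t exp(-bt) is
    this ratio times bt exp(-bt).\<close>
  have ab': "(a - b) / b \<le> 25 * (J / N)"
  proof -
    have "(a - b) / b \<le> (400 * (J * J) / N) / (16 * J)" using ab b J1 n by (intro frac_le) auto
    also have "\<dots> = 25 * (J / N)" using J1 by simp
    finally show ?thesis .
  qed
  have e1: "\<bar>exp (- a * t) - exp (- b * t)\<bar> \<le> 25 * (J / N) * exp (- 8 * J * t)"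
  proof -
    have "exp (- a * t) = exp (- b * t) * exp (- ((a - b) * t))" by (simp add: algebra_simps flip: exp_add)
    then have "\<bar>exp (- a * t) - exp (- b * t)\<bar> = exp (- b * t) * \<bar>exp (- ((a - b) * t)) - 1\<bar>"
      by (metis abs_exp_cancel abs_mult mult.right_neutral right_diff_distrib)
    also have "\<dots> \<le> exp (- b * t) * ((a - b) * t)"
      using exp_ge_add_one_self[of "- ((a - b) * t)"] b t exp_le_one_iff[of "- ((a - b) * t)"]
      by (intro mult_left_mono) (auto simp del: exp_le_one_iff)
    \<comment> \<open>Half of the exponent is spent on the factor t, through x exp(-x) \<le> 1/2 at
      x = bt/2; the other half becomes exp(-8Jt) since b \<ge> 16 J.\<close>
    also have "\<dots> = (a - b) / b * 2 * ((b * t / 2) * exp (- (b * t / 2))) * exp (- (b * t / 2))"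
      using b by (simp add: field_simps flip: exp_add)
    also have "\<dots> \<le> (a - b) / b * 2 * (1 / 2) * exp (- (b * t / 2))"
    proof (intro mult_right_mono mult_left_mono)
      have "1 + b * t / 2 + b * t / 2 * (b * t / 2) / 2 \<le> exp (b * t / 2)"
        using exp_lower_Taylor_quadratic[of "b * t / 2"] b t by (simp add: power2_eq_square)
      moreover have "2 * (b * t / 2) \<le> 1 + b * t / 2 + b * t / 2 * (b * t / 2) / 2"
        using zero_le_power2[of "b * t / 2 - 1"] by (simp add: power2_eq_square field_simps)
      ultimately have "2 * (b * t / 2) \<le> exp (b * t / 2)" by linarith
      then show "(b * t / 2) * exp (- (b * t / 2)) \<le> 1 / 2" unfolding exp_minus by (simp add: divide_simps)
    qed (use b in auto)
    also have "\<dots> = (a - b) / b * exp (- (b * t / 2))"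
      by (simp only: mult.assoc[of _ 2])
    also have "\<dots> \<le> 25 * (J / N) * exp (- 8 * J * t)"
    proof (rule mult_mono[OF ab'])
      show "exp (- (b * t / 2)) \<le> exp (- 8 * J * t)" using mult_right_mono[OF b(1), of t] t by simp
    qed (use J1 n in auto)
    finally show ?thesis .
  qed
  have zb: "z = \<tau> * b" by (simp add: z_def b_def)
  have z0: "0 \<le> z" using b \<tau> by (simp add: zb)
  have e2: "\<bar>exp (- (b * t)) - symb \<theta> z ^ k * R\<bar> \<le> 48 / c * z * exp (- (c * (b * t) / 4))"
  proof (rule time_error[OF z0 z1 c st exp_symb_diff[OF \<theta> z0 z1] R])
    have "t / \<tau> \<ge> 0" using t \<tau> by simp
    then have "real k \<le> t / \<tau>" "t / \<tau> \<le> real k + 1" unfolding k_def by linarith+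
    then have "real k * \<tau> \<le> t" "t \<le> (real k + 1) * \<tau>" using \<tau> by (auto simp: field_simps)
    then have "b * (real k * \<tau>) \<le> b * t" "b * t \<le> b * ((real k + 1) * \<tau>)" using b by auto
    then show "z * real k \<le> b * t" "b * t \<le> z * real k + z" by (auto simp: zb algebra_simps)
  qed
  have "exp (- (c * (b * t) / 4)) \<le> exp (- 4 * c * J * t)"
    using mult_right_mono[OF b(1), of "c * t"] c t by (simp add: mult_ac)
  then have "48 / c * z * exp (- (c * (b * t) / 4)) \<le> 48 / c * z * exp (- 4 * c * J * t)"
    using c z0 by (intro mult_left_mono) auto
  then have e2': "\<bar>exp (- (b * t)) - symb \<theta> z ^ k * R\<bar> \<le> 48 / c * z * exp (- 4 * c * J * t)"
    using e2 by linarith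
  have "8 * (c * (J * t)) \<le> 16 * (J * t)" using c J1 t mult_mono[of c 1 "J * t" "J * t"] by simp
  then have ee: "exp (- 16 * J * t) \<le> exp (- 8 * c * J * t)" by (simp add: mult_ac)
  \<comment> \<open>Squaring produces (J/N)^2, of which one factor is bounded by 1. The first power
    is the form that later agrees with the capped weight.\<close>
  have q1: "(exp (- a * t) - exp (- b * t))\<^sup>2 \<le> 625 * (J / N) * exp (- 8 * c * J * t)"
  proof -
    have "(exp (- a * t) - exp (- b * t))\<^sup>2 \<le> (25 * (J / N) * exp (- 8 * J * t))\<^sup>2"
      using power_mono[OF e1, of 2] by simp
    also have "\<dots> = 625 * (J / N) * (J / N) * exp (- 16 * J * t)"
      by (simp add: power_mult_distrib power2_eq_square flip: exp_add)
    also have "\<dots> \<le> 625 * (J / N) * 1 * exp (- 8 * c * J * t)"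
      using J1 n JN ee by (intro mult_mono mult_left_mono) auto
    finally show ?thesis by simp
  qed
  \<comment> \<open>Likewise z^2 \<le> z because z \<le> 1, and then z \<le> 40 \<tau>J, which makes
    the bound linear in \<tau>.\<close>
  have q2: "(exp (- b * t) - symb \<theta> z ^ k * R)\<^sup>2 \<le> 92160 / c\<^sup>2 * (\<tau> * J) * exp (- 8 * c * J * t)"
  proof -
    have "(exp (- b * t) - symb \<theta> z ^ k * R)\<^sup>2 \<le> (48 / c * z * exp (- 4 * c * J * t))\<^sup>2"
      using power_mono[OF e2', of 2] by simp
    also have "\<dots> = 2304 / c\<^sup>2 * (z * z) * exp (- 8 * c * J * t)"
      by (simp add: power_mult_distrib power2_eq_square flip: exp_add)
    also have "\<dots> \<le> 2304 / c\<^sup>2 * (\<tau> * (40 * J) * 1) * exp (- 8 * c * J * t)"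
      using z0 z1 b a40 \<tau> c J1 by (intro mult_right_mono mult_left_mono mult_mono) (auto simp: zb)
    finally show ?thesis by simp
  qed
  have "(exp (- a * t) - symb \<theta> z ^ k * R)\<^sup>2
     \<le> 2 * (exp (- a * t) - exp (- b * t))\<^sup>2 + 2 * (exp (- b * t) - symb \<theta> z ^ k * R)\<^sup>2"
    using zero_le_power2[of "exp (- a * t) - exp (- b * t) - (exp (- b * t) - symb \<theta> z ^ k * R)"]
    by (simp only: power2_eq_square algebra_simps)
  also have "\<dots> \<le> (1250 * (J / N) + 184320 / c\<^sup>2 * (\<tau> * J)) * exp (- 8 * c * J * t)"
    using q1 q2 by (simp add: distrib_right)
  also have "\<dots> \<le> (200000 / c\<^sup>2 * (J / N) + 200000 / c\<^sup>2 * (\<tau> * J)) * exp (- 8 * c * J * t)"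
  proof (intro mult_right_mono add_mono)
    have "c\<^sup>2 \<le> 1" using c by (simp add: power_le_one)
    then show "1250 \<le> 200000 / c\<^sup>2" using c by (simp add: field_simps)
    show "184320 / c\<^sup>2 \<le> 200000 / c\<^sup>2" by (simp add: divide_right_mono)
  qed (use J1 n \<tau> in auto)
  finally show ?thesis by (simp add: a_def J_def N_def k_def distrib_left)
qed

section \<open>Fourier analysis on the grid\<close>

text \<open>The residues modulo n of least absolute value, with n/2 rather than -n/2 when n is even.
  A discrete mode l > n/2 approximates the heat mode of frequency l - n, not that of frequency
  l.\<close>

definition modes :: "nat \<Rightarrow> int set" where
  "modes n = {m. - int n < 2 * m \<and> 2 * m \<le> int n}"

lemma finite_modes [simp]: "finite (modes n)"
proof (rule finite_subset)
  show "modes n \<subseteq> {- int n..int n}" by (auto simp: modes_def)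
qed simp

lemma sum_modes:
  fixes f :: "int \<Rightarrow> 'a :: comm_monoid_add"
  assumes n: "n > 0" and per: "\<And>m. f (m + int n) = f m"
  shows "(\<Sum>l<n. f (int l)) = (\<Sum>m\<in>modes n. f m)"
proof -
  let ?i = "\<lambda>m. nat (if m < 0 then m + int n else m)"
  let ?j = "\<lambda>l. if 2 * l \<le> n then int l else int l - int n"
  show ?thesis
  proof (rule sum.reindex_bij_witness[where i = ?i and j = ?j])
  show "?i (?j l) = l" if "l \<in> {..<n}" for l using that by auto
  show "?j l \<in> modes n" if "l \<in> {..<n}" for l using that by (auto simp: modes_def)
  show "?j (?i m) = m" if "m \<in> modes n" for m using that by (auto simp: modes_def)
  show "?i m \<in> {..<n}" if "m \<in> modes n" for m using that n by (auto simp: modes_def)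
  show "f (?j l) = f (int l)" if "l \<in> {..<n}" for l using per[of "int l - int n"] by auto
  qed
qed

lemma fourier_mode_grid_shift:
  assumes "n > 0"
  shows "fourier_mode (m + int n) (of_int k / real n) = fourier_mode m (of_int k / real n)"
proof -
  have "2 * pi * of_int (int n) * (of_int k / real n) = 2 * pi * of_int k" using assms by simp
  then have "fourier_mode (int n) (of_int k / real n) = cis (2 * pi * of_int k)"
    by (simp only: fourier_mode_cis)
  also have "\<dots> = 1" by (rule cis_multiple_2pi) simp
  finally have "fourier_mode (int n) (of_int k / real n) = 1" .
  then show ?thesis by (simp add: fourier_mode_add)
qed

lemma mu_nat_abs: "mu n (nat \<bar>m\<bar>) = 4 * (real n)\<^sup>2 * (sin (of_int m * pi / real n))\<^sup>2"
  by (cases "m \<ge> 0") (auto simp: mu_def eigval_def)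

text \<open>A shift of l by n changes neither the sampled modes nor the eigenvalue, whose squared
  sine has period pi. With \<open>C\<close> arbitrary the statement serves both discrete Green
  functions.\<close>

lemma sum_modes_symbol:
  fixes C :: "real \<Rightarrow> real"
  assumes n: "n > 0"
  shows "(\<Sum>l<n. of_real (C (mu n l)) * fourier_mode (int l) (grid_floor n x) * cnj (fourier_mode (int l) (grid_floor n y)))
       = (\<Sum>m\<in>modes n. of_real (C (mu n (nat \<bar>m\<bar>))) * fourier_mode m (grid_floor n x) * cnj (fourier_mode m (grid_floor n y)))"
proof -
  define f where "f m = of_real (C (mu n (nat \<bar>m\<bar>))) * fourier_mode m (grid_floor n x) * cnj (fourier_mode m (grid_floor n y))" for m
  have "f (m + int n) = f m" for m
  proof -
    have "of_int (m + int n) * pi / real n = of_int m * pi / real n + pi" using n by (simp add: field_simps)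
    then have "(sin (of_int (m + int n) * pi / real n))\<^sup>2 = (sin (of_int m * pi / real n))\<^sup>2"
      by (simp only: sin_periodic_pi power2_minus)
    then have "mu n (nat \<bar>m + int n\<bar>) = mu n (nat \<bar>m\<bar>)" unfolding mu_nat_abs by simp
    then show ?thesis unfolding f_def grid_floor_def fourier_mode_grid_shift[OF n] by simp
  qed
  from sum_modes[of n f, OF n this] show ?thesis by (simp add: f_def)
qed

text \<open>A geometric sum over powers of an n-th root of unity, which equals 1 exactly when n
  divides j.\<close>

lemma sum_fourier_mode_grid:
  assumes n: "n > 0"
  shows "(\<Sum>k<n. fourier_mode j (real k / real n)) = (if int n dvd j then of_nat n else 0)"
proof -
  define w where "w = fourier_mode j (1 / real n)"
  have wk: "fourier_mode j (real k / real n) = w ^ k" for k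
  proof -
    have "real k * (2 * pi * of_int j * (1 / real n)) = 2 * pi * of_int j * (real k / real n)" by simp
    then show ?thesis by (simp only: w_def fourier_mode_cis Complex.DeMoivre)
  qed
  have wn: "w ^ n = 1"
    using n wk[of n] fourier_mode_of_int[of j 1] by simp
  show ?thesis
  proof (cases "int n dvd j")
    case True
    then obtain q where "j = int n * q" by (elim dvdE)
    then have "2 * pi * of_int j * (1 / real n) = 2 * pi * of_int q" using n by simp
    then have "w = cis (2 * pi * of_int q)" by (simp only: w_def fourier_mode_cis)
    then have "w = 1" by (simp add: cis_multiple_2pi)
    then show ?thesis using True by (simp add: wk)
  next
    case False
    have "w \<noteq> 1"
    proof
      assume "w = 1"
      then have "cos (2 * pi * of_int j / real n) = 1" by (simp add: w_def fourier_mode_cis complex_eq_iff)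
      then obtain q :: int where "2 * pi * of_int j / real n = of_int q * 2 * pi" using cos_one_2pi_int by auto
      then have "real_of_int j = of_int q * real n" using n by (simp add: field_simps)
      then have "j = q * int n" by (metis of_int_eq_iff of_int_mult of_int_of_nat_eq)
      then show False using False by simp
    qed
    then show ?thesis using False wn by (simp add: wk sum_gp_strict)
  qed
qed

lemma norm_sum_modes_sq:
  assumes "finite F"
  shows "complex_of_real ((cmod (\<Sum>m\<in>F. d m * cnj (fourier_mode m y)))\<^sup>2)
    = (\<Sum>m\<in>F. \<Sum>l\<in>F. d m * cnj (d l) * fourier_mode (l - m) y)"
proof -
  have "fourier_mode (l - m) y = fourier_mode l y * cnj (fourier_mode m y)" for l m
    using fourier_mode_add[of l "- m" y] by (simp add: cnj_fourier_mode)
  then show ?thesis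
    unfolding complex_norm_square
    by (simp add: sum_product mult_ac)
qed

text \<open>Two elements of \<open>modes n\<close> differ by less than n, so they are congruent
  modulo n only if equal; hence all cross terms vanish.\<close>

lemma discrete_parseval:
  assumes n: "n > 0"
  shows "(\<Sum>k<n. (cmod (\<Sum>m\<in>modes n. d m * cnj (fourier_mode m (real k / real n))))\<^sup>2)
     = real n * (\<Sum>m\<in>modes n. (cmod (d m))\<^sup>2)"
proof -
  have dv: "int n dvd l - m \<longleftrightarrow> l = m" if "m \<in> modes n" "l \<in> modes n" for l m
  proof
    assume "int n dvd l - m"
    moreover have "\<bar>l - m\<bar> < int n" using that by (auto simp: modes_def)
    ultimately show "l = m" using dvd_imp_le_int[of "l - m" "int n"] by fastforce
  qed simp
  have "complex_of_real (\<Sum>k<n. (cmod (\<Sum>m\<in>modes n. d m * cnj (fourier_mode m (real k / real n))))\<^sup>2)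
     = (\<Sum>k<n. \<Sum>m\<in>modes n. \<Sum>l\<in>modes n. d m * cnj (d l) * fourier_mode (l - m) (real k / real n))"
    unfolding of_real_sum by (simp only: norm_sum_modes_sq[OF finite_modes])
  also have "\<dots> = (\<Sum>m\<in>modes n. \<Sum>l\<in>modes n. \<Sum>k<n. d m * cnj (d l) * fourier_mode (l - m) (real k / real n))"
    by (subst sum.swap) (intro sum.cong refl sum.swap)
  also have "\<dots> = (\<Sum>m\<in>modes n. \<Sum>l\<in>modes n. if l = m then d m * cnj (d l) * of_nat n else 0)"
    unfolding sum_distrib_left[symmetric] sum_fourier_mode_grid[OF n]
    by (intro sum.cong refl) (auto simp: dv)
  also have "\<dots> = (\<Sum>m\<in>modes n. of_real (real n * (cmod (d m))\<^sup>2))"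
    by (simp add: mult_ac flip: complex_norm_square)
  also have "\<dots> = complex_of_real (real n * (\<Sum>m\<in>modes n. (cmod (d m))\<^sup>2))"
    by (simp add: sum_distrib_left)
  finally show ?thesis by (simp only: of_real_eq_iff)
qed

lemma borel_measurable_fourier_mode [measurable]: "fourier_mode k \<in> borel_measurable borel"
  by (intro borel_measurable_continuous_onI continuous_fourier_mode)

lemma borel_measurable_grid_floor [measurable]: "grid_floor n \<in> borel_measurable borel"
  unfolding grid_floor_def by measurable

lemma parseval_trig_polynomial:
  assumes F: "finite F"
  shows "(\<integral>\<^sup>+y\<in>{0..1}. ennreal ((cmod (\<Sum>m\<in>F. d m * cnj (fourier_mode m y)))\<^sup>2) \<partial>lborel)
    = ennreal (\<Sum>m\<in>F. (cmod (d m))\<^sup>2)"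
proof -
  let ?f = "\<lambda>y. (cmod (\<Sum>m\<in>F. d m * cnj (fourier_mode m y)))\<^sup>2"
  have "((\<lambda>y. d m * cnj (d l) * fourier_mode (l - m) y) has_integral
        (d m * cnj (d l) * (if l = m then 1 else 0))) {0..1}" for m l
  proof -
    have "(fourier_mode (l - m) has_integral integral {0..1} (fourier_mode (l - m))) {0..1}"
      by (intro integrable_integral integrable_continuous_real continuous_fourier_mode)
    then have "(fourier_mode (l - m) has_integral (if l = m then 1 else 0)) {0..1}"
      by (simp add: integral_fourier_mode)
    then show ?thesis by (intro has_integral_mult_right)
  qed
  then have "((\<lambda>y. \<Sum>m\<in>F. \<Sum>l\<in>F. d m * cnj (d l) * fourier_mode (l - m) y) has_integral
      (\<Sum>m\<in>F. \<Sum>l\<in>F. d m * cnj (d l) * (if l = m then 1 else 0))) {0..1}"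
    using F by (intro has_integral_sum)
  then have "((\<lambda>y. complex_of_real (?f y)) has_integral (\<Sum>m\<in>F. \<Sum>l\<in>F. d m * cnj (d l) * (if l = m then 1 else 0))) {0..1}"
    by (simp only: norm_sum_modes_sq[OF F])
  moreover have "(\<Sum>m\<in>F. \<Sum>l\<in>F. d m * cnj (d l) * (if l = m then 1 else 0)) = of_real (\<Sum>m\<in>F. (cmod (d m))\<^sup>2)"
  proof -
    have "(\<Sum>l\<in>F. d m * cnj (d l) * (if l = m then 1 else 0)) = of_real ((cmod (d m))\<^sup>2)" if "m \<in> F" for m
      using that F by (simp add: if_distrib[of "\<lambda>u. _ * u"] cong: if_cong flip: complex_norm_square)
    then show ?thesis by simp
  qed
  ultimately have "((\<lambda>y. complex_of_real (?f y)) has_integral complex_of_real (\<Sum>m\<in>F. (cmod (d m))\<^sup>2)) {0..1}"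
    by simp
  from has_integral_linear[OF this bounded_linear_Re]
  have h: "(?f has_integral (\<Sum>m\<in>F. (cmod (d m))\<^sup>2)) {0..1}" by (simp only: o_def Re_complex_of_real)
  show ?thesis
    by (subst nn_integral_has_integral_lebesgue'[OF _ h, symmetric])
       (auto simp: nn_integral_completion mult.commute intro!: nn_integral_cong)
qed

text \<open>The n cells of [0,1) are translated onto the first one. For fixed s the inner points
  form one translate of the grid, and there \<open>grid_floor\<close> has the exact values
  k/n.\<close>

lemma nn_integral_unit_interval_grid:
  fixes f :: "real \<Rightarrow> ennreal"
  assumes f [measurable]: "f \<in> borel_measurable borel" and n: "n > 0"
  shows "(\<integral>\<^sup>+y\<in>{0..1}. f y \<partial>lborel) = (\<integral>\<^sup>+s\<in>{0..<1 / real n}. (\<Sum>k<n. f (real k / real n + s)) \<partial>lborel)"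
proof -
  let ?I = "\<lambda>k::nat. {real k / real n..<real k / real n + 1 / real n}"
  have "(\<integral>\<^sup>+y\<in>{0..1}. f y \<partial>lborel) = (\<integral>\<^sup>+y\<in>{0..<1}. f y \<partial>lborel)"
  proof (rule nn_integral_cong_AE)
    show "AE y in lborel. f y * indicator {0..1} y = f y * indicator {0..<1} y"
      using AE_lborel_singleton[of 1] by eventually_elim (auto simp: indicator_def)
  qed
  also have "\<dots> = (\<integral>\<^sup>+y. (\<Sum>k<n. f y * indicator (?I k) y) \<partial>lborel)"
  proof (rule nn_integral_cong)
    fix y :: real
    have mem: "y \<in> ?I k \<longleftrightarrow> \<lfloor>real n * y\<rfloor> = int k" for k
    proof -
      have "y \<in> ?I k \<longleftrightarrow> real k \<le> real n * y \<and> real n * y < real k + 1"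
        using n by (simp add: field_simps add_divide_distrib[symmetric])
      then show ?thesis by (simp add: floor_eq_iff)
    qed
    have "(\<Sum>k<n. f y * indicator (?I k) y) = (\<Sum>k<n. if k = nat \<lfloor>real n * y\<rfloor> \<and> y \<ge> 0 then f y else 0)"
    proof (intro sum.cong refl)
      fix k
      have "y \<in> ?I k \<longleftrightarrow> k = nat \<lfloor>real n * y\<rfloor> \<and> y \<ge> 0"
      proof (cases "y \<ge> 0")
        case True
        then have "\<lfloor>real n * y\<rfloor> \<ge> 0" by simp
        then show ?thesis unfolding mem using True by linarith
      next
        case False
        then have "\<lfloor>real n * y\<rfloor> < 0" using n by (simp add: mult_pos_neg)
        then show ?thesis unfolding mem using False by linarith
      qed
      then show "f y * indicator (?I k) y = (if k = nat \<lfloor>real n * y\<rfloor> \<and> y \<ge> 0 then f y else 0)"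
        by (simp add: indicator_def)
    qed
    also have "\<dots> = f y * indicator {0..<1} y"
    proof -
      have "nat \<lfloor>real n * y\<rfloor> < n \<longleftrightarrow> y < 1" if "y \<ge> 0"
      proof -
        have "nat \<lfloor>real n * y\<rfloor> < n \<longleftrightarrow> \<lfloor>real n * y\<rfloor> < int n" using n by linarith
        also have "\<dots> \<longleftrightarrow> y < 1" using n by (simp add: floor_less_iff)
        finally show ?thesis .
      qed
      then show ?thesis by (cases "y \<ge> 0") (auto simp: indicator_def)
    qed
    finally show "f y * indicator {0..<1} y = (\<Sum>k<n. f y * indicator (?I k) y)" ..
  qed
  also have "\<dots> = (\<Sum>k<n. \<integral>\<^sup>+y. f y * indicator (?I k) y \<partial>lborel)"
    by (intro nn_integral_sum) measurable
  also have "\<dots> = (\<Sum>k<n. \<integral>\<^sup>+s. f (real k / real n + s) * indicator {0..<1 / real n} s \<partial>lborel)"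
  proof (intro sum.cong refl)
    fix k
    show "(\<integral>\<^sup>+y. f y * indicator (?I k) y \<partial>lborel) = (\<integral>\<^sup>+s. f (real k / real n + s) * indicator {0..<1 / real n} s \<partial>lborel)"
      by (subst nn_integral_real_affine[of _ 1 "real k / real n"]) (auto simp: indicator_def intro!: nn_integral_cong)
  qed
  also have "\<dots> = (\<integral>\<^sup>+s. (\<Sum>k<n. f (real k / real n + s) * indicator {0..<1 / real n} s) \<partial>lborel)"
    by (intro nn_integral_sum[symmetric]) measurable
  also have "\<dots> = (\<integral>\<^sup>+s\<in>{0..<1 / real n}. (\<Sum>k<n. f (real k / real n + s)) \<partial>lborel)"
    by (simp add: sum_distrib_right)
  finally show ?thesis .
qed

section \<open>Squared kernel error at a fixed time\<close>

lemma norm_fourier_mode_diff_le: "cmod (fourier_mode m x - 1) \<le> 2 * pi * \<bar>of_int m\<bar> * \<bar>x\<bar>"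
proof -
  have "cmod (fourier_mode m x - 1) = 2 * \<bar>sin (2 * pi * of_int m * x / 2)\<bar>"
    unfolding fourier_mode_cis cis_conv_exp by (rule dist_exp_i_1)
  also have "\<dots> \<le> 2 * \<bar>2 * pi * of_int m * x / 2\<bar>" using abs_sin_x_le_abs_x[of "2 * pi * of_int m * x / 2"] by simp
  finally show ?thesis by (simp add: abs_mult)
qed

text \<open>The first summand pays for truncating the heat series near n/2 and for rounding x and y
  to the grid; the second compares the multipliers. The factor 8 collects three doublings: the split
  of each coefficient, the split into resolved and truncated frequencies, and the pair of
  frequencies j and -j. The 320 is 8 times 40, as 4 pi^2 \<le> 40.\<close>

definition kernel_bound :: "nat \<Rightarrow> (nat \<Rightarrow> real) \<Rightarrow> real \<Rightarrow> nat \<Rightarrow> real" where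
  "kernel_bound n c t j = 320 * min 1 ((real j)\<^sup>2 / (real n)\<^sup>2) * exp (- 8 * pi\<^sup>2 * (real j)\<^sup>2 * t)
     + (if 2 * j \<le> n then 8 * (exp (- 4 * pi\<^sup>2 * (real j)\<^sup>2 * t) - c j)\<^sup>2 else 0)"

lemma kernel_bound_nonneg: "kernel_bound n c t j \<ge> 0"
  by (simp add: kernel_bound_def)

text \<open>Unconditional summation is replaced by a sequence of symmetric partial sums, the form in
  which measurability of limits and Fatou's lemma can be used.\<close>

lemma heat_green_partial_sums:
  assumes t: "t > 0"
  shows "(\<lambda>N. \<Sum>m\<in>{- int N..int N}. of_real (exp (- 4 * pi\<^sup>2 * (of_int m)\<^sup>2 * t)) * fourier_mode m (x - y))
     \<longlonglongrightarrow> complex_of_real (heat_green t x y)"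
proof -
  let ?f = "\<lambda>m::int. of_real (exp (- 4 * pi\<^sup>2 * (of_int m)\<^sup>2 * t)) * fourier_mode m (x - y)"
  have "(\<lambda>m. norm (?f m)) summable_on UNIV"
    using exp_neg_square_summable[of "4 * pi\<^sup>2 * t"] t by (simp add: norm_mult mult_ac)
  then have "?f summable_on UNIV" by (rule abs_summable_summable)
  then have "(?f has_sum complex_of_real (heat_green t x y)) UNIV"
    unfolding heat_green_fourier[OF t] by (rule has_sum_infsum)
  then show ?thesis
    unfolding has_sum_def by (rule filterlim_compose[OF _ filterlim_symmetric_int_intervals])
qed

lemma borel_measurable_heat_green [measurable]:
  assumes t: "t > 0"
  shows "heat_green t x \<in> borel_measurable borel"
proof -
  have "(\<lambda>y. complex_of_real (heat_green t x y)) \<in> borel_measurable borel"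
    by (rule borel_measurable_LIMSEQ_metric[OF _ heat_green_partial_sums[OF t]]) measurable
  then have "(\<lambda>y. Re (complex_of_real (heat_green t x y))) \<in> borel_measurable borel" by measurable
  then show ?thesis by simp
qed

lemma sum_symmetric_interval_le:
  fixes h :: "nat \<Rightarrow> real"
  assumes "\<And>j. h j \<ge> 0"
  shows "(\<Sum>m\<in>{- int N..int N}. h (nat \<bar>m\<bar>)) \<le> 2 * (\<Sum>j\<le>N. h j)"
proof -
  have "{- int N..int N} \<subseteq> int ` {..N} \<union> (\<lambda>j. - int j) ` {..N}"
  proof
    fix m assume "m \<in> {- int N..int N}"
    then have "nat \<bar>m\<bar> \<in> {..N}" "m = int (nat \<bar>m\<bar>) \<or> m = - int (nat \<bar>m\<bar>)" by auto
    then show "m \<in> int ` {..N} \<union> (\<lambda>j. - int j) ` {..N}" by blast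
  qed
  then have "(\<Sum>m\<in>{- int N..int N}. h (nat \<bar>m\<bar>)) \<le> (\<Sum>m\<in>int ` {..N} \<union> (\<lambda>j. - int j) ` {..N}. h (nat \<bar>m\<bar>))"
    using assms by (intro sum_mono2) auto
  also have "\<dots> \<le> (\<Sum>m\<in>int ` {..N}. h (nat \<bar>m\<bar>)) + (\<Sum>m\<in>(\<lambda>j. - int j) ` {..N}. h (nat \<bar>m\<bar>))"
    by (subst sum_Un) (auto intro!: sum_nonneg assms)
  also have "\<dots> = 2 * (\<Sum>j\<le>N. h j)"
    by (subst (1 2) sum.reindex) (auto simp: inj_on_def)
  finally show ?thesis .
qed

context
  fixes n :: nat and t x :: real and c :: "nat \<Rightarrow> real"
  assumes n: "n > 0" and t: "t > 0" and x: "0 \<le> x" and c0: "c 0 = 1"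
begin

private definition "Eh m = exp (- 4 * pi\<^sup>2 * (of_int m)\<^sup>2 * t)" for m :: int
private definition "D y = (\<Sum>m\<in>modes n. of_real (c (nat \<bar>m\<bar>)) * fourier_mode m (grid_floor n x) * cnj (fourier_mode m (grid_floor n y)))"
private definition "w m = (if m \<in> modes n then 160 * ((of_int m)\<^sup>2 / (real n)\<^sup>2) * (Eh m)\<^sup>2 + 4 * (Eh m - c (nat \<bar>m\<bar>))\<^sup>2
    else 2 * (Eh m)\<^sup>2)" for m :: int

private lemma Eh_sq: "(Eh m)\<^sup>2 = exp (- 8 * pi\<^sup>2 * (of_int m)\<^sup>2 * t)"
  by (simp add: Eh_def power2_eq_square flip: exp_add)

private lemma D_measurable [measurable]: "D \<in> borel_measurable borel"
  unfolding D_def cnj_fourier_mode by measurable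

private lemma w_le: "2 * w m \<le> kernel_bound n c t (nat \<bar>m\<bar>)"
proof -
  define j where "j = nat \<bar>m\<bar>"
  have mj: "(real_of_int m)\<^sup>2 = (real j)\<^sup>2" by (simp add: j_def)
  have E: "(Eh m)\<^sup>2 = exp (- 8 * pi\<^sup>2 * (real j)\<^sup>2 * t)" "Eh m = exp (- 4 * pi\<^sup>2 * (real j)\<^sup>2 * t)"
    by (simp only: Eh_sq mj, simp only: Eh_def mj)
  have kb: "kernel_bound n c t j = 320 * min 1 ((real j)\<^sup>2 / (real n)\<^sup>2) * (Eh m)\<^sup>2
      + (if 2 * j \<le> n then 8 * (Eh m - c j)\<^sup>2 else 0)"
    by (simp only: kernel_bound_def E(1)[symmetric] E(2)[symmetric])
  show ?thesis
  proof (cases "m \<in> modes n")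
    case True
    then have jn: "2 * j \<le> n" by (auto simp: modes_def j_def)
    then have "(real j)\<^sup>2 \<le> (real n)\<^sup>2" by (intro power_mono) auto
    then have "(real j)\<^sup>2 / (real n)\<^sup>2 \<le> 1" using n by simp
    then show ?thesis using True jn unfolding w_def j_def[symmetric] kb mj
      by (simp add: min_absorb2)
  next
    case False
    \<comment> \<open>Equality occurs for m = -n/2, which lies outside \<open>modes n\<close>
      although 2j \<le> n. The second summand of \<open>kernel_bound\<close> may then be present and
      is dropped as nonnegative.\<close>
    then have jn: "n \<le> 2 * j" by (auto simp: modes_def j_def)
    then have "(real n)\<^sup>2 \<le> (2 * real j)\<^sup>2" by (intro power_mono) linarith+
    then have "1 / 4 \<le> min 1 ((real j)\<^sup>2 / (real n)\<^sup>2)" using n by (simp add: field_simps)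
    then have "4 * (Eh m)\<^sup>2 \<le> 320 * min 1 ((real j)\<^sup>2 / (real n)\<^sup>2) * (Eh m)\<^sup>2" by (intro mult_right_mono) auto
    then have "4 * (Eh m)\<^sup>2 \<le> kernel_bound n c t j" unfolding kb
      by (rule order_trans) auto
    then show ?thesis using False by (simp add: w_def j_def)
  qed
qed

text \<open>On one translate of the grid the roundings of x and y merge into a single phase shift
  \<delta> = x - s - \<open>grid_floor n x\<close> with |\<delta>| \<le> 1/n, so each coefficient is
  off by at most 2 pi |m|/n besides the multiplier error. The factor n of the discrete Parseval
  identity cancels against the length 1/n of the range of s.\<close>

private lemma resolved_part:
  "(\<integral>\<^sup>+y\<in>{0..1}. ennreal ((cmod ((\<Sum>m\<in>modes n. of_real (Eh m) * fourier_mode m (x - y)) - D y))\<^sup>2) \<partial>lborel)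
     \<le> ennreal (\<Sum>m\<in>modes n. 80 * ((of_int m)\<^sup>2 / (real n)\<^sup>2) * (Eh m)\<^sup>2 + 2 * (Eh m - c (nat \<bar>m\<bar>))\<^sup>2)"
    (is "?L \<le> ennreal ?S")
proof -
  define d where "d s m = of_real (Eh m) * fourier_mode m (x - s) - of_real (c (nat \<bar>m\<bar>)) * fourier_mode m (grid_floor n x)" for s m
  have S0: "?S \<ge> 0" by (intro sum_nonneg) auto
  have "?L = (\<integral>\<^sup>+s\<in>{0..<1 / real n}. (\<Sum>k<n. ennreal ((cmod ((\<Sum>m\<in>modes n. of_real (Eh m) * fourier_mode m (x - (real k / real n + s)))
      - D (real k / real n + s)))\<^sup>2)) \<partial>lborel)"
    by (rule nn_integral_unit_interval_grid[OF _ n]) measurable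
  also have "\<dots> \<le> (\<integral>\<^sup>+s\<in>{0..<1 / real n}. ennreal (real n * ?S) \<partial>lborel)"
  proof (intro nn_integral_mono)
    fix s :: real
    show "(\<Sum>k<n. ennreal ((cmod ((\<Sum>m\<in>modes n. of_real (Eh m) * fourier_mode m (x - (real k / real n + s)))
      - D (real k / real n + s)))\<^sup>2)) * indicator {0..<1 / real n} s \<le> ennreal (real n * ?S) * indicator {0..<1 / real n} s"
    proof (cases "s \<in> {0..<1 / real n}")
      case True
      have "grid_floor n (real k / real n + s) = real k / real n" for k
      proof -
        have "\<lfloor>real n * (real k / real n + s)\<rfloor> = int k"
          using True n by (simp add: floor_eq_iff field_simps)
        then show ?thesis by (simp add: grid_floor_def)
      qed
      then have D: "(\<Sum>m\<in>modes n. of_real (Eh m) * fourier_mode m (x - (real k / real n + s))) - D (real k / real n + s)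
         = (\<Sum>m\<in>modes n. d s m * cnj (fourier_mode m (real k / real n)))" for k
        unfolding D_def d_def left_diff_distrib sum_subtractf
        by (simp add: fourier_mode_diff[of _ "x - s"] diff_diff_eq[symmetric] mult.assoc diff_right_commute
              add.commute[of _ s])
      have "cmod (d s m) ^ 2 \<le> 80 * ((of_int m)\<^sup>2 / (real n)\<^sup>2) * (Eh m)\<^sup>2 + 2 * (Eh m - c (nat \<bar>m\<bar>))\<^sup>2" for m
      proof -
        define g where "g = grid_floor n x"
        define \<delta> where "\<delta> = x - s - g"
        have "g \<le> x" "x \<le> g + 1 / real n" unfolding g_def grid_floor_def using n
          by (simp_all add: field_simps) linarith
        then have \<delta>: "\<bar>\<delta>\<bar> \<le> 1 / real n" using True unfolding \<delta>_def by (auto simp: abs_if)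
        have f: "fourier_mode m (x - s) = fourier_mode m \<delta> * fourier_mode m g"
          by (simp add: \<delta>_def fourier_mode_cis cis_mult algebra_simps)
        have "d s m = (of_real (Eh m) * (fourier_mode m \<delta> - 1) + of_real (Eh m - c (nat \<bar>m\<bar>))) * fourier_mode m g"
          unfolding d_def f g_def[symmetric] by (simp add: algebra_simps)
        then have "cmod (d s m) = cmod (of_real (Eh m) * (fourier_mode m \<delta> - 1) + of_real (Eh m - c (nat \<bar>m\<bar>)))"
          by (simp only: norm_mult norm_fourier_mode mult_1_right)
        also have "\<dots> \<le> cmod (of_real (Eh m) * (fourier_mode m \<delta> - 1)) + cmod (of_real (Eh m - c (nat \<bar>m\<bar>)))"
          by (rule norm_triangle_ineq)
        also have "\<dots> = Eh m * cmod (fourier_mode m \<delta> - 1) + \<bar>Eh m - c (nat \<bar>m\<bar>)\<bar>"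
          by (simp only: norm_mult norm_of_real) (simp add: Eh_def)
        also have "\<dots> \<le> Eh m * (2 * pi * \<bar>of_int m\<bar> / real n) + \<bar>Eh m - c (nat \<bar>m\<bar>)\<bar>"
        proof (intro add_mono mult_left_mono order_refl)
          have "cmod (fourier_mode m \<delta> - 1) \<le> 2 * pi * \<bar>of_int m\<bar> * \<bar>\<delta>\<bar>" by (rule norm_fourier_mode_diff_le)
          also have "\<dots> \<le> 2 * pi * \<bar>of_int m\<bar> * (1 / real n)" using \<delta> by (intro mult_left_mono) auto
          finally show "cmod (fourier_mode m \<delta> - 1) \<le> 2 * pi * \<bar>of_int m\<bar> / real n" by simp
        qed (simp add: Eh_def)
        finally have le: "cmod (d s m) \<le> Eh m * (2 * pi * \<bar>of_int m\<bar> / real n) + \<bar>Eh m - c (nat \<bar>m\<bar>)\<bar>" .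
        have "cmod (d s m) ^ 2 \<le> 2 * (Eh m * (2 * pi * \<bar>of_int m\<bar> / real n))\<^sup>2 + 2 * \<bar>Eh m - c (nat \<bar>m\<bar>)\<bar>\<^sup>2"
          using power_mono[OF le, of 2] sum_squares_bound_add by (rule order_trans) simp
        also have "\<dots> = (8 * pi\<^sup>2) * ((of_int m)\<^sup>2 / (real n)\<^sup>2) * (Eh m)\<^sup>2 + 2 * (Eh m - c (nat \<bar>m\<bar>))\<^sup>2"
          by (simp add: power_mult_distrib power_divide)
        also have "\<dots> \<le> 80 * ((of_int m)\<^sup>2 / (real n)\<^sup>2) * (Eh m)\<^sup>2 + 2 * (Eh m - c (nat \<bar>m\<bar>))\<^sup>2"
          using pi_sq_le by (intro add_mono mult_right_mono) auto
        finally show ?thesis .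
      qed
      then have "real n * (\<Sum>m\<in>modes n. cmod (d s m) ^ 2) \<le> real n * ?S"
        by (intro mult_left_mono sum_mono) auto
      then show ?thesis using True unfolding D
        by (simp add: sum_ennreal discrete_parseval[OF n] ennreal_leI)
    qed simp
  qed
  also have "\<dots> = ennreal (real n * ?S) * ennreal (1 / real n)"
    by (simp add: nn_integral_cmult_indicator)
  also have "\<dots> = ennreal ?S" using n S0 by (simp flip: ennreal_mult'')
  finally show ?thesis .
qed

text \<open>Frequencies outside \<open>modes n\<close> occur in the heat kernel alone, where
  ordinary Parseval on the unit interval applies. The right-hand side is free of N and thus survives
  the limit.\<close>

private lemma partial_sum_bound:
  assumes N: "n \<le> N"
  shows "(\<integral>\<^sup>+y\<in>{0..1}. ennreal ((cmod ((\<Sum>m\<in>{- int N..int N}. of_real (Eh m) * fourier_mode m (x - y)) - D y))\<^sup>2) \<partial>lborel)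
     \<le> (\<Sum>j. ennreal (kernel_bound n c t j))"
proof -
  let ?T = "{- int N..int N} - modes n"
  define A where "A y = (\<Sum>m\<in>modes n. of_real (Eh m) * fourier_mode m (x - y)) - D y" for y
  define B where "B y = (\<Sum>m\<in>?T. (of_real (Eh m) * fourier_mode m x) * cnj (fourier_mode m y))" for y
  have [measurable]: "A \<in> borel_measurable borel" "B \<in> borel_measurable borel"
    unfolding A_def B_def cnj_fourier_mode by measurable
  have sub: "modes n \<subseteq> {- int N..int N}" using N by (auto simp: modes_def)
  have split: "(\<Sum>m\<in>{- int N..int N}. of_real (Eh m) * fourier_mode m (x - y)) - D y = A y + B y" for y
  proof -
    have "(\<Sum>m\<in>{- int N..int N}. of_real (Eh m) * fourier_mode m (x - y))
       = (\<Sum>m\<in>?T. of_real (Eh m) * fourier_mode m (x - y)) + (\<Sum>m\<in>modes n. of_real (Eh m) * fourier_mode m (x - y))"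
      using sub by (intro sum.subset_diff) auto
    then show ?thesis by (simp add: A_def B_def fourier_mode_diff mult.assoc)
  qed
  have "(\<integral>\<^sup>+y\<in>{0..1}. ennreal ((cmod ((\<Sum>m\<in>{- int N..int N}. of_real (Eh m) * fourier_mode m (x - y)) - D y))\<^sup>2) \<partial>lborel)
     \<le> (\<integral>\<^sup>+y. 2 * (ennreal ((cmod (A y))\<^sup>2) * indicator {0..1} y) + 2 * (ennreal ((cmod (B y))\<^sup>2) * indicator {0..1} y) \<partial>lborel)"
  proof (intro nn_integral_mono)
    fix y :: real
    have "(cmod (A y + B y))\<^sup>2 \<le> (cmod (A y) + cmod (B y))\<^sup>2" by (intro power_mono norm_triangle_ineq) auto
    also have "\<dots> \<le> 2 * (cmod (A y))\<^sup>2 + 2 * (cmod (B y))\<^sup>2"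
      by (rule sum_squares_bound_add)
    finally have "ennreal ((cmod (A y + B y))\<^sup>2) \<le> 2 * ennreal ((cmod (A y))\<^sup>2) + 2 * ennreal ((cmod (B y))\<^sup>2)"
      using ennreal_leI[of "(cmod (A y + B y))\<^sup>2" "2 * (cmod (A y))\<^sup>2 + 2 * (cmod (B y))\<^sup>2"]
      by (simp add: ennreal_mult)
    then show "ennreal ((cmod ((\<Sum>m\<in>{- int N..int N}. of_real (Eh m) * fourier_mode m (x - y)) - D y))\<^sup>2) * indicator {0..1} y
      \<le> 2 * (ennreal ((cmod (A y))\<^sup>2) * indicator {0..1} y) + 2 * (ennreal ((cmod (B y))\<^sup>2) * indicator {0..1} y)"
      unfolding split by (auto simp: indicator_def)
  qed
  also have "\<dots> = 2 * (\<integral>\<^sup>+y\<in>{0..1}. ennreal ((cmod (A y))\<^sup>2) \<partial>lborel) + 2 * (\<integral>\<^sup>+y\<in>{0..1}. ennreal ((cmod (B y))\<^sup>2) \<partial>lborel)"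
    by (subst nn_integral_add) (auto simp: nn_integral_cmult)
  also have "\<dots> \<le> 2 * ennreal (\<Sum>m\<in>modes n. 80 * ((of_int m)\<^sup>2 / (real n)\<^sup>2) * (Eh m)\<^sup>2 + 2 * (Eh m - c (nat \<bar>m\<bar>))\<^sup>2)
      + 2 * ennreal (\<Sum>m\<in>?T. (cmod (of_real (Eh m) * fourier_mode m x))\<^sup>2)"
    unfolding A_def B_def
    by (intro add_mono mult_left_mono resolved_part) (auto simp: parseval_trig_polynomial)
  also have "\<dots> = ennreal ((\<Sum>m\<in>modes n. w m) + (\<Sum>m\<in>?T. w m))"
  proof -
    have m: "(\<Sum>m\<in>modes n. w m) = 2 * (\<Sum>m\<in>modes n. 80 * ((of_int m)\<^sup>2 / (real n)\<^sup>2) * (Eh m)\<^sup>2 + 2 * (Eh m - c (nat \<bar>m\<bar>))\<^sup>2)"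
      unfolding sum_distrib_left by (intro sum.cong) (auto simp: w_def)
    have r: "(\<Sum>m\<in>?T. w m) = 2 * (\<Sum>m\<in>?T. (cmod (of_real (Eh m) * fourier_mode m x))\<^sup>2)"
      unfolding sum_distrib_left by (intro sum.cong) (auto simp: w_def norm_mult)
    show ?thesis unfolding m r
      by (subst ennreal_plus) (auto intro!: sum_nonneg simp: ennreal_mult')
  qed
  also have "(\<Sum>m\<in>modes n. w m) + (\<Sum>m\<in>?T. w m) = (\<Sum>m\<in>{- int N..int N}. w m)"
    using sum.subset_diff[OF sub, of w] by simp
  also have "\<dots> \<le> (\<Sum>m\<in>{- int N..int N}. kernel_bound n c t (nat \<bar>m\<bar>) / 2)"
    using w_le by (intro sum_mono) (simp add: field_simps)
  also have "\<dots> \<le> (\<Sum>j\<le>N. kernel_bound n c t j)"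
    using sum_symmetric_interval_le[of "\<lambda>j. kernel_bound n c t j / 2" N] kernel_bound_nonneg
    by (simp flip: sum_divide_distrib)
  also have "ennreal (\<Sum>j\<le>N. kernel_bound n c t j) = (\<Sum>j\<le>N. ennreal (kernel_bound n c t j))"
    by (simp add: kernel_bound_nonneg)
  also have "\<dots> \<le> (\<Sum>j. ennreal (kernel_bound n c t j))"
    by (intro sum_le_suminf) auto
  finally show ?thesis using ennreal_leI by blast
qed

text \<open>The truncated part is an isometry on each fibre of the grid by the discrete Parseval identity;
  Fatou's lemma removes the truncation.\<close>
lemma kernel_error_bound:
  "(\<integral>\<^sup>+y\<in>{0..1}. ennreal ((cmod (of_real (heat_green t x y)
      - (\<Sum>m\<in>modes n. of_real (c (nat \<bar>m\<bar>)) * fourier_mode m (grid_floor n x) * cnj (fourier_mode m (grid_floor n y)))))\<^sup>2) \<partial>lborel)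
    \<le> (\<Sum>j. ennreal (kernel_bound n c t j))"
proof -
  define u where "u N y = ennreal ((cmod ((\<Sum>m\<in>{- int N..int N}. of_real (Eh m) * fourier_mode m (x - y)) - D y))\<^sup>2) * indicator {0..1} y" for N y
  have lim: "(\<lambda>N. u N y) \<longlonglongrightarrow> ennreal ((cmod (of_real (heat_green t x y) - D y))\<^sup>2) * indicator {0..1} y" for y
  proof -
    have "(\<lambda>N. (cmod ((\<Sum>m\<in>{- int N..int N}. of_real (Eh m) * fourier_mode m (x - y)) - D y))\<^sup>2)
       \<longlonglongrightarrow> (cmod (of_real (heat_green t x y) - D y))\<^sup>2"
      unfolding Eh_def by (intro tendsto_intros heat_green_partial_sums t)
    then show ?thesis unfolding u_def
      by (cases "y \<in> {0..1}") (auto intro: tendsto_ennrealI)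
  qed
  have "(\<integral>\<^sup>+y\<in>{0..1}. ennreal ((cmod (of_real (heat_green t x y) - D y))\<^sup>2) \<partial>lborel)
      = (\<integral>\<^sup>+y. liminf (\<lambda>N. u N y) \<partial>lborel)"
    using lim_imp_Liminf[OF sequentially_bot lim] by simp
  also have "\<dots> \<le> liminf (\<lambda>N. \<integral>\<^sup>+y. u N y \<partial>lborel)"
    by (rule nn_integral_liminf) (simp add: u_def)
  also have "\<dots> \<le> (\<Sum>j. ennreal (kernel_bound n c t j))"
  proof (rule Liminf_le)
    show "\<forall>\<^sub>F N in sequentially. (\<integral>\<^sup>+y. u N y \<partial>lborel) \<le> (\<Sum>j. ennreal (kernel_bound n c t j))"
      using eventually_ge_at_top[of n] unfolding u_def by eventually_elim (rule partial_sum_bound)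
  qed simp
  finally show ?thesis by (simp add: D_def)
qed

end

section \<open>Space-time error and error for sampled data\<close>

text \<open>Size of the squared error of mode j relative to its exponential decay, one term for each
  discretisation. The caps make it meaningful for frequencies that are not resolved.\<close>

definition weight :: "nat \<Rightarrow> real \<Rightarrow> nat \<Rightarrow> real" where
  "weight n \<tau> j = min 1 ((real j)\<^sup>2 / (real n)\<^sup>2) + min 1 (\<tau> * (real j)\<^sup>2)"

lemma weight_nonneg: "\<tau> \<ge> 0 \<Longrightarrow> weight n \<tau> j \<ge> 0"
  by (simp add: weight_def)

text \<open>Because z \<le> 4 pi^2 \<tau> j^2 \<le> 40 \<tau> j^2, an unresolved mode has weight at
  least 1/40. Any crude bound for it may therefore be multiplied by 40 times the weight.\<close>

lemma weight_unresolved: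
  assumes "\<tau> > 0" "\<tau> * mu n j > 1"
  shows "1 \<le> 40 * weight n \<tau> j"
proof -
  have "mu n j \<le> 4 * pi\<^sup>2 * (real j)\<^sup>2" by (rule mu_le)
  also have "\<dots> \<le> 4 * 10 * (real j)\<^sup>2" using pi_sq_le by (intro mult_right_mono mult_left_mono) auto
  finally have "mu n j \<le> 40 * (real j)\<^sup>2" by simp
  then have "\<tau> * mu n j \<le> \<tau> * (40 * (real j)\<^sup>2)" using assms by (intro mult_left_mono) auto
  also have "\<dots> = 40 * (\<tau> * (real j)\<^sup>2)" by simp
  finally have "1 < 40 * (\<tau> * (real j)\<^sup>2)" using assms by linarith
  then have "1 \<le> 40 * min 1 (\<tau> * (real j)\<^sup>2)" by (auto simp: min_def)
  then show ?thesis by (simp add: weight_def distrib_left add_increasing)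
qed

lemma sum_weight_powr_le:
  assumes \<alpha>: "1/2 < \<alpha>" "\<alpha> \<le> 1" and \<tau>: "0 < \<tau>" "\<tau> \<le> 1" and n: "n > 0"
  shows "(\<Sum>j=1..N. weight n \<tau> j * real j powr (- 2 * \<alpha>))
    \<le> (4 + 1 / (2 * \<alpha> - 1)) * (real n powr (1 - 2 * \<alpha>) + \<tau> powr (\<alpha> - 1/2))"
proof -
  have "(1 / (real n)\<^sup>2) powr (\<alpha> - 1/2) = (real n powr (- 2)) powr (\<alpha> - 1/2)"
    using n by (simp add: powr_minus_divide)
  also have "\<dots> = real n powr (1 - 2 * \<alpha>)" by (simp add: powr_powr algebra_simps)
  finally have e: "(1 / (real n)\<^sup>2) powr (\<alpha> - 1/2) = real n powr (1 - 2 * \<alpha>)" .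
  have "1 \<le> (real n)\<^sup>2" using n by simp
  then have "(\<Sum>j=1..N. min 1 (1 / (real n)\<^sup>2 * (real j)\<^sup>2) * real j powr (- 2 * \<alpha>))
      \<le> (4 + 1 / (2 * \<alpha> - 1)) * (1 / (real n)\<^sup>2) powr (\<alpha> - 1/2)"
    using n by (intro sum_min_powr_le \<alpha>) auto
  moreover have "(\<Sum>j=1..N. min 1 (\<tau> * (real j)\<^sup>2) * real j powr (- 2 * \<alpha>)) \<le> (4 + 1 / (2 * \<alpha> - 1)) * \<tau> powr (\<alpha> - 1/2)"
    by (intro sum_min_powr_le \<alpha> \<tau>)
  ultimately show ?thesis
    unfolding e by (simp add: weight_def distrib_right sum.distrib distrib_left)
qed

lemma suminf_ennreal_weight_le:
  assumes \<alpha>: "1/2 < \<alpha>" "\<alpha> \<le> 1" and \<tau>: "0 < \<tau>" "\<tau> \<le> 1" and n: "n > 0" and K: "K \<ge> 0"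
    and h: "h 0 = 0" "\<And>j. j \<ge> 1 \<Longrightarrow> h j \<le> ennreal (K * (weight n \<tau> j * real j powr (- 2 * \<alpha>)))"
  shows "(\<Sum>j. h j) \<le> ennreal (K * ((4 + 1 / (2 * \<alpha> - 1)) * (real n powr (1 - 2 * \<alpha>) + \<tau> powr (\<alpha> - 1/2))))"
proof (rule suminf_le_const)
  fix N
  have "(\<Sum>j<N. h j) \<le> (\<Sum>j\<in>insert 0 {1..N}. h j)"
    by (intro sum_mono2) auto
  also have "\<dots> = (\<Sum>j=1..N. h j)" by (simp add: h)
  also have "\<dots> \<le> (\<Sum>j=1..N. ennreal (K * (weight n \<tau> j * real j powr (- 2 * \<alpha>))))"
    by (intro sum_mono h) auto
  also have "\<dots> = ennreal (K * (\<Sum>j=1..N. weight n \<tau> j * real j powr (- 2 * \<alpha>)))"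
    using K \<tau> by (simp add: sum_ennreal weight_nonneg sum_distrib_left)
  also have "\<dots> \<le> ennreal (K * ((4 + 1 / (2 * \<alpha> - 1)) * (real n powr (1 - 2 * \<alpha>) + \<tau> powr (\<alpha> - 1/2))))"
    by (intro ennreal_leI mult_left_mono sum_weight_powr_le \<alpha> \<tau> n K)
  finally show "(\<Sum>j<N. h j) \<le> ennreal (K * ((4 + 1 / (2 * \<alpha> - 1)) * (real n powr (1 - 2 * \<alpha>) + \<tau> powr (\<alpha> - 1/2))))" .
qed simp

text \<open>The constant mode is propagated exactly, so negative powers of j are needed only for j
  \<ge> 1.\<close>

lemma kernel_bound_0: "g 0 = 1 \<Longrightarrow> kernel_bound n g t 0 = 0"
  by (simp add: kernel_bound_def)

text \<open>The range allowed for \<open>R\<close> covers the value 1 for the first Green function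
  and \<open>R1\<close> for the second. The multiplier \<open>g\<close> is prescribed only where z
  \<le> 1, which leaves the freedom to delete unresolved modes.\<close>

lemma kernel_bound_le:
  fixes \<theta> \<tau> c t :: real and j n :: nat
  defines "z \<equiv> \<tau> * mu n j"
  assumes \<theta>: "0 \<le> \<theta>" "\<theta> \<le> 1" and \<tau>: "\<tau> > 0" and t: "t > 0" and c: "0 < c" "c \<le> 1"
    and n: "n > 0" and j: "j \<ge> 1"
    and st: "\<bar>symb \<theta> z\<bar> \<le> 1 - c * (z / (1 + z))"
    and g: "z \<le> 1 \<Longrightarrow> g j = symb \<theta> z ^ nat \<lfloor>t / \<tau>\<rfloor> * R" and R: "1 - z \<le> R" "R \<le> 1"
  shows "kernel_bound n g t j \<le> 2000000 / c\<^sup>2 * weight n \<tau> j * exp (- 8 * c * (real j)\<^sup>2 * t)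
      + (if 2 * j \<le> n \<and> z > 1 then 16 * (g j)\<^sup>2 else 0)"
proof -
  define e where "e = exp (- 8 * c * (real j)\<^sup>2 * t)"
  define E where "E = exp (- 4 * pi\<^sup>2 * (real j)\<^sup>2 * t)"
  have c2: "1 \<le> 1 / c\<^sup>2" using c by (simp add: power_le_one)
  have w0: "weight n \<tau> j \<ge> 0" using \<tau> by (simp add: weight_nonneg)
  have E2: "E\<^sup>2 = exp (- 8 * pi\<^sup>2 * (real j)\<^sup>2 * t)"
    by (simp add: E_def power2_eq_square flip: exp_add)
  have "c * ((real j)\<^sup>2 * t) \<le> pi\<^sup>2 * ((real j)\<^sup>2 * t)"
    using c t pi_ge_two by (intro mult_right_mono order_trans[of c 1 "pi\<^sup>2"]) (auto simp: one_le_power)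
  then have Ee: "E\<^sup>2 \<le> e" unfolding E2 e_def by simp
  have 1: "320 * min 1 ((real j)\<^sup>2 / (real n)\<^sup>2) * E\<^sup>2 \<le> 320 * (1 / c\<^sup>2) * weight n \<tau> j * e"
  proof (intro mult_mono Ee)
    show "320 \<le> 320 * (1 / c\<^sup>2)" using c2 by simp
    show "min 1 ((real j)\<^sup>2 / (real n)\<^sup>2) \<le> weight n \<tau> j" using \<tau> by (simp add: weight_def)
  qed (use w0 c in auto)
  have kb: "kernel_bound n g t j = 320 * min 1 ((real j)\<^sup>2 / (real n)\<^sup>2) * E\<^sup>2 + (if 2 * j \<le> n then 8 * (E - g j)\<^sup>2 else 0)"
    by (simp only: kernel_bound_def E2 E_def[symmetric])
  have we: "0 \<le> 1 / c\<^sup>2 * weight n \<tau> j * e" using w0 by (simp add: e_def)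
  \<comment> \<open>Truncated, resolved and unresolved modes. The constant 2000000 exceeds 320 + 8
    times 200000, and 16 is 8 times the 2 from (E - g)^2 \<le> 2E^2 + 2g^2.\<close>
  consider "2 * j > n" | "2 * j \<le> n" "z \<le> 1" | "2 * j \<le> n" "z > 1" by linarith
  then have "kernel_bound n g t j \<le> 2000000 * (1 / c\<^sup>2 * weight n \<tau> j * e) + (if 2 * j \<le> n \<and> z > 1 then 16 * (g j)\<^sup>2 else 0)"
  proof cases
    case 1
    then show ?thesis using \<open>320 * min 1 _ * _ \<le> _\<close> we unfolding kb by simp
  next
    case 2
    have "(E - g j)\<^sup>2 \<le> 200000 / c\<^sup>2 * ((real j)\<^sup>2 / (real n)\<^sup>2 + \<tau> * (real j)\<^sup>2) * e"
      unfolding E_def e_def g[OF 2(2)] z_def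
      by (rule resolved_mode_error) (use \<theta> \<tau> t c j 2 st R in \<open>auto simp: z_def\<close>)
    also have "(real j)\<^sup>2 / (real n)\<^sup>2 + \<tau> * (real j)\<^sup>2 = weight n \<tau> j"
    proof -
      have "(real j)\<^sup>2 \<le> (real n)\<^sup>2" using 2 by (intro power_mono) auto
      moreover have "\<tau> * (16 * (real j)\<^sup>2) \<le> z" unfolding z_def using mu_ge[OF 2(1) n] \<tau> by (intro mult_left_mono) auto
      then have "\<tau> * (real j)\<^sup>2 \<le> 1" using 2 \<tau> by (auto simp: intro: order_trans[of _ "\<tau> * (16 * (real j)\<^sup>2)"])
      ultimately show ?thesis using n by (simp add: weight_def min_absorb2)
    qed
    finally have "(E - g j)\<^sup>2 \<le> 200000 * (1 / c\<^sup>2 * weight n \<tau> j * e)" by simp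
    then show ?thesis using \<open>320 * min 1 _ * _ \<le> _\<close> we 2 unfolding kb by simp
  next
    case 3
    have "1 \<le> 40 * weight n \<tau> j" using 3 \<tau> by (intro weight_unresolved) (auto simp: z_def)
    then have "1 * E\<^sup>2 \<le> 40 * weight n \<tau> j * e" using Ee by (intro mult_mono) auto
    also have "\<dots> \<le> 1 / c\<^sup>2 * (40 * weight n \<tau> j * e)"
      using c2 w0 mult_right_mono[of 1 "1 / c\<^sup>2" "40 * weight n \<tau> j * e"] by (simp add: e_def)
    finally have "E\<^sup>2 \<le> 40 * (1 / c\<^sup>2 * weight n \<tau> j * e)" by simp
    moreover have "(E - g j)\<^sup>2 \<le> 2 * E\<^sup>2 + 2 * (g j)\<^sup>2"
      using zero_le_power2[of "E + g j"] by (simp add: power2_eq_square algebra_simps)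
    ultimately show ?thesis using \<open>320 * min 1 _ * _ \<le> _\<close> we 3 unfolding kb by simp
  qed
  then show ?thesis by (simp add: e_def)
qed

section \<open>Integration in time\<close>

lemma nn_integral_exp_neg_le:
  assumes "a > 0"
  shows "(\<integral>\<^sup>+t\<in>{0<..}. ennreal (exp (- a * t)) \<partial>lborel) \<le> ennreal (1 / a)"
proof -
  have "(\<integral>\<^sup>+t\<in>{0<..}. ennreal (exp (- a * t)) \<partial>lborel) \<le> (\<integral>\<^sup>+t. ennreal (exp (- a * t)) * indicator {0..} t \<partial>lborel)"
    by (intro nn_integral_mono) (auto simp: indicator_def)
  also have "\<dots> = ennreal (exp (- a * 0) / a)"
  proof -
    have "((\<lambda>t. exp (- a * t)) has_integral exp (- a * 0) / a) {0..}"
      by (rule has_integral_exp_minus_to_infinity[OF assms])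
    from nn_integral_has_integral_lebesgue'[OF _ this]
    show ?thesis by (simp add: nn_integral_completion mult.commute)
  qed
  finally show ?thesis by simp
qed

lemma symb_power_decay:
  assumes "\<bar>r\<bar> \<le> 1 - c * (z / (1 + z))" "0 < c" "c \<le> 1" "z \<ge> 0"
  shows "(r ^ k)\<^sup>2 \<le> exp (- 2 * c * real k * (z / (1 + z)))"
proof -
  have "\<bar>r\<bar> \<le> exp (- (c * (z / (1 + z))))"
    using assms(1) exp_ge_add_one_self[of "- (c * (z / (1 + z)))"] by linarith
  then have "\<bar>r\<bar> ^ (k * 2) \<le> exp (- (c * (z / (1 + z)))) ^ (k * 2)" by (intro power_mono) auto
  also have "\<dots> = exp (- 2 * c * real k * (z / (1 + z)))"
    by (simp add: mult_ac flip: exp_of_nat_mult)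
  finally show ?thesis by (simp add: power_even_abs flip: power_mult)
qed

lemma discrete_green1_modes:
  assumes "n > 0" "t \<ge> 0"
  shows "discrete_green1 \<theta> n \<tau> t x y = (\<Sum>m\<in>modes n. of_real (symb \<theta> (\<tau> * mu n (nat \<bar>m\<bar>)) ^ nat \<lfloor>t / \<tau>\<rfloor>)
      * fourier_mode m (grid_floor n x) * cnj (fourier_mode m (grid_floor n y)))"
  using assms(2) sum_modes_symbol[OF assms(1), of "\<lambda>u. symb \<theta> (\<tau> * u) ^ nat \<lfloor>t / \<tau>\<rfloor>"]
  by (simp add: discrete_green1_def R1_mult_R2)

lemma discrete_green2_modes:
  assumes "n > 0" "t \<ge> 0"
  shows "discrete_green2 \<theta> n \<tau> t x y = (\<Sum>m\<in>modes n. of_real (symb \<theta> (\<tau> * mu n (nat \<bar>m\<bar>)) ^ nat \<lfloor>t / \<tau>\<rfloor> * R1 \<theta> n \<tau> (nat \<bar>m\<bar>))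
      * fourier_mode m (grid_floor n x) * cnj (fourier_mode m (grid_floor n y)))"
  using assms(2) sum_modes_symbol[OF assms(1), of "\<lambda>u. symb \<theta> (\<tau> * u) ^ nat \<lfloor>t / \<tau>\<rfloor> * (1 / (1 + \<theta> * (\<tau> * u)))"]
  unfolding discrete_green2_def R1_mult_R2 unfolding R1_eq by simp

lemma resolvent_bounds:
  fixes \<theta> z :: real
  assumes "0 \<le> \<theta>" "\<theta> \<le> 1" "z \<ge> 0"
  shows "1 - z \<le> 1 / (1 + \<theta> * z)" "1 / (1 + \<theta> * z) \<le> 1" "0 \<le> 1 / (1 + \<theta> * z)"
proof -
  have "\<theta> * z \<ge> 0" using assms by simp
  then have d: "1 + \<theta> * z > 0" "\<theta> * z \<ge> 0" by linarith+
  show "1 / (1 + \<theta> * z) \<le> 1" "0 \<le> 1 / (1 + \<theta> * z)" using d by auto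
  have "1 - z \<le> 1 - \<theta> * z" using assms mult_right_mono[of \<theta> 1 z] by simp
  also have "\<dots> \<le> 1 / (1 + \<theta> * z)"
    unfolding pos_le_divide_eq[OF d(1)] using zero_le_power2[of "\<theta> * z"] by (simp add: power2_eq_square algebra_simps)
  finally show "1 - z \<le> 1 / (1 + \<theta> * z)" .
qed

text \<open>Integration turns the exponential of a resolved mode into a multiple of 1/j^2, the case
  \<alpha> = 1 of the weighted sum. An unresolved mode shrinks by a fixed factor in every step and
  contributes a multiple of \<tau> times the squared resolvent, which must also be shown to be
  O(1/j^2).\<close>

lemma space_time_error:
  assumes \<theta>: "0 \<le> \<theta>" "\<theta> \<le> 1" and \<tau>: "\<tau> > 0" "\<tau> < 1" and c: "0 < c" "c \<le> 1" and Z: "Z > 0"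
    and n: "n > 0" and x: "0 \<le> x"
    and st: "\<And>j. \<bar>symb \<theta> (\<tau> * mu n j)\<bar> \<le> 1 - c * (\<tau> * mu n j / (1 + \<tau> * mu n j))"
    and zZ: "\<And>j. \<theta> \<le> 1/2 \<Longrightarrow> \<tau> * mu n j \<le> Z"
  shows "(\<integral>\<^sup>+t\<in>{0<..}. (\<integral>\<^sup>+y\<in>{0..1}.
            ennreal ((cmod (of_real (heat_green t x y) - discrete_green2 \<theta> n \<tau> t x y))\<^sup>2) \<partial>lborel) \<partial>lborel)
     \<le> ennreal ((250000 / c ^ 3 + 1920 * (1 + Z) / c) * (5 * (1 / real n + sqrt \<tau>)))"
proof -
  define z where "z j = \<tau> * mu n j" for j
  define R where "R j = R1 \<theta> n \<tau> j" for j
  define g where "g t j = symb \<theta> (z j) ^ nat \<lfloor>t / \<tau>\<rfloor> * R j" for t j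
  \<comment> \<open>The 48 is 16 from \<open>kernel_bound_le\<close> times 3, a bound for the loss
    exp 1 when k is replaced by t/\<tau> - 1.\<close>
  define B where "B j = (if 2 * j \<le> n \<and> z j > 1 then 48 * (R j)\<^sup>2 else 0)" for j
  define \<Psi> where "\<Psi> j t = (if j = 0 then 0 else ennreal (2000000 / c\<^sup>2 * weight n \<tau> j) * ennreal (exp (- (8 * c * (real j)\<^sup>2) * t))
      + ennreal (B j) * ennreal (exp (- (c / \<tau>) * t)))" for j t
  have z0: "z j \<ge> 0" for j using \<tau> mu_nonneg by (simp add: z_def)
  have R: "1 - z j \<le> R j" "R j \<le> 1" "0 \<le> R j" for j
    using resolvent_bounds[OF \<theta> z0] unfolding R_def R1_eq z_def by auto
  have B0: "B j \<ge> 0" for j by (simp add: B_def)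
  have w0: "weight n \<tau> j \<ge> 0" for j using \<tau> by (simp add: weight_nonneg)
  have g0: "g t 0 = 1" for t by (simp add: g_def z_def R_def symb_def R1_eq)
  have pt: "ennreal (kernel_bound n (g t) t j) \<le> \<Psi> j t" if t: "t > 0" for t j
  proof (cases "j = 0")
    case True
    then show ?thesis by (simp add: kernel_bound_0 g0 \<Psi>_def)
  next
    case False
    have "kernel_bound n (g t) t j \<le> 2000000 / c\<^sup>2 * weight n \<tau> j * exp (- 8 * c * (real j)\<^sup>2 * t)
      + (if 2 * j \<le> n \<and> z j > 1 then 16 * (g t j)\<^sup>2 else 0)"
      unfolding z_def
      by (rule kernel_bound_le[OF \<theta> \<tau>(1) t c n _ st, where R = "R j"]) (use False R z_def in \<open>auto simp: g_def\<close>)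
    also have "(if 2 * j \<le> n \<and> z j > 1 then 16 * (g t j)\<^sup>2 else 0) \<le> B j * exp (- (c / \<tau>) * t)"
    proof (cases "2 * j \<le> n \<and> z j > 1")
      case True
      define k where "k = nat \<lfloor>t / \<tau>\<rfloor>"
      have "t / \<tau> \<ge> 0" using t \<tau> by simp
      then have k: "t / \<tau> \<le> real k + 1" unfolding k_def by linarith
      have "(symb \<theta> (z j) ^ k)\<^sup>2 \<le> exp (- 2 * c * real k * (z j / (1 + z j)))"
        using st[of j] c z0 unfolding z_def[symmetric] by (intro symb_power_decay)
      also have "\<dots> \<le> exp (1 + - (c / \<tau>) * t)"
      proof -
        have "1 / 2 \<le> z j / (1 + z j)" using True by (simp add: field_simps)
        then have "c * real k \<le> 2 * c * real k * (z j / (1 + z j))"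
          using c mult_left_mono[of "1 / 2" "z j / (1 + z j)" "2 * c * real k"] by simp
        moreover have "c * (t / \<tau>) \<le> c * (real k + 1)" using c k by (intro mult_left_mono) auto
        ultimately show ?thesis using c by (simp add: algebra_simps)
      qed
      also have "\<dots> \<le> 3 * exp (- (c / \<tau>) * t)"
        unfolding exp_add using exp_le by (intro mult_right_mono) auto
      finally have "(symb \<theta> (z j) ^ k)\<^sup>2 * (R j)\<^sup>2 \<le> 3 * exp (- (c / \<tau>) * t) * (R j)\<^sup>2"
        by (intro mult_right_mono) auto
      then show ?thesis using True by (simp add: B_def g_def k_def power_mult_distrib mult_ac)
    next
      case False
      then show ?thesis unfolding B_def if_not_P[OF False] by simp
    qed
    finally have "kernel_bound n (g t) t j \<le> 2000000 / c\<^sup>2 * weight n \<tau> j * exp (- 8 * c * (real j)\<^sup>2 * t) + B j * exp (- (c / \<tau>) * t)"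
      by simp
    then show ?thesis using False w0 B0 unfolding \<Psi>_def
      by (simp add: ennreal_mult[symmetric] ennreal_leI flip: ennreal_plus)
  qed
  have "(\<integral>\<^sup>+t\<in>{0<..}. (\<integral>\<^sup>+y\<in>{0..1}.
            ennreal ((cmod (of_real (heat_green t x y) - discrete_green2 \<theta> n \<tau> t x y))\<^sup>2) \<partial>lborel) \<partial>lborel)
      \<le> (\<integral>\<^sup>+t. (\<Sum>j. \<Psi> j t * indicator {0<..} t) \<partial>lborel)"
  proof (intro nn_integral_mono)
    fix t :: real
    show "(\<integral>\<^sup>+y\<in>{0..1}. ennreal ((cmod (of_real (heat_green t x y) - discrete_green2 \<theta> n \<tau> t x y))\<^sup>2) \<partial>lborel) * indicator {0<..} t
       \<le> (\<Sum>j. \<Psi> j t * indicator {0<..} t)"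
    proof (cases "t > 0")
      case True
      have "(\<integral>\<^sup>+y\<in>{0..1}. ennreal ((cmod (of_real (heat_green t x y) - discrete_green2 \<theta> n \<tau> t x y))\<^sup>2) \<partial>lborel)
          \<le> (\<Sum>j. ennreal (kernel_bound n (g t) t j))"
        using kernel_error_bound[OF n True x, of "g t"] g0 True
        by (simp add: discrete_green2_modes[OF n] g_def z_def R_def)
      also have "\<dots> \<le> (\<Sum>j. \<Psi> j t)" by (intro suminf_le pt True) auto
      finally show ?thesis using True by simp
    qed simp
  qed
  also have "\<dots> = (\<Sum>j. \<integral>\<^sup>+t\<in>{0<..}. \<Psi> j t \<partial>lborel)"
    by (rule nn_integral_suminf) (simp add: \<Psi>_def)
  also have "\<dots> \<le> ennreal ((250000 / c ^ 3 + 1920 * (1 + Z) / c) * ((4 + 1 / (2 * 1 - 1)) * (real n powr (1 - 2 * 1) + \<tau> powr (1 - 1/2))))"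
  proof (rule suminf_ennreal_weight_le)
    fix j :: nat assume j: "j \<ge> 1"
    have J: "(real j)\<^sup>2 > 0" using j by simp
    have "(\<integral>\<^sup>+t\<in>{0<..}. \<Psi> j t \<partial>lborel) = (\<integral>\<^sup>+t. ennreal (2000000 / c\<^sup>2 * weight n \<tau> j) * (ennreal (exp (- (8 * c * (real j)\<^sup>2) * t)) * indicator {0<..} t)
      + ennreal (B j) * (ennreal (exp (- (c / \<tau>) * t)) * indicator {0<..} t) \<partial>lborel)"
      using j by (intro nn_integral_cong) (auto simp: \<Psi>_def indicator_def)
    also have "\<dots> = ennreal (2000000 / c\<^sup>2 * weight n \<tau> j) * (\<integral>\<^sup>+t\<in>{0<..}. ennreal (exp (- (8 * c * (real j)\<^sup>2) * t)) \<partial>lborel)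
      + ennreal (B j) * (\<integral>\<^sup>+t\<in>{0<..}. ennreal (exp (- (c / \<tau>) * t)) \<partial>lborel)"
      by (subst nn_integral_add) (auto simp: nn_integral_cmult)
    also have "\<dots> \<le> ennreal (2000000 / c\<^sup>2 * weight n \<tau> j) * ennreal (1 / (8 * c * (real j)\<^sup>2)) + ennreal (B j) * ennreal (1 / (c / \<tau>))"
      using c J \<tau> by (intro add_mono mult_left_mono nn_integral_exp_neg_le) auto
    also have "\<dots> = ennreal (2000000 / c\<^sup>2 * weight n \<tau> j * (1 / (8 * c * (real j)\<^sup>2)) + B j * (1 / (c / \<tau>)))"
    proof -
      have p: "0 \<le> 2000000 / c\<^sup>2 * weight n \<tau> j" "0 \<le> 1 / (8 * c * (real j)\<^sup>2)" "0 \<le> 1 / (c / \<tau>)"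
        using c \<tau> w0 by auto
      show ?thesis
        by (simp only: ennreal_mult[OF p(1,2)] ennreal_mult[OF B0 p(3)]
            ennreal_plus[OF mult_nonneg_nonneg[OF p(1,2)] mult_nonneg_nonneg[OF B0 p(3)]])
    qed
    also have "\<dots> \<le> ennreal ((250000 / c ^ 3 + 1920 * (1 + Z) / c) * (weight n \<tau> j * real j powr (- 2 * 1)))"
    proof (rule ennreal_leI)
      have pj: "real j powr (- 2 * 1) = 1 / (real j)\<^sup>2" using j by (simp add: powr_minus_divide)
      have "B j * (1 / (c / \<tau>)) \<le> 1920 * (1 + Z) / c * (weight n \<tau> j * (1 / (real j)\<^sup>2))"
      proof (cases "2 * j \<le> n \<and> z j > 1")
        case True
        have mu16: "16 * (real j)\<^sup>2 \<le> mu n j" using True n by (intro mu_ge) auto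
        have mupos: "mu n j > 0" using mu16 J by linarith
        \<comment> \<open>One factor \<open>R j\<close> \<le> 1 is given up. What remains is O(1/mu)
          in both regimes: for \<theta> \<le> 1/2 since \<tau> mu \<le> Z, and for \<theta> > 1/2
          since the resolvent is at most 2/z.\<close>
        have "(R j)\<^sup>2 * \<tau> \<le> R j * \<tau>"
          using R[of j] \<tau> by (intro mult_right_mono) (auto simp: power2_eq_square mult_left_le)
        also have "\<dots> \<le> (2 + Z) / mu n j"
        proof (cases "\<theta> \<le> 1/2")
          case True
          then have "\<tau> * mu n j \<le> Z" by (rule zZ)
          then have "\<tau> \<le> Z / mu n j" using mupos by (simp add: field_simps)
          also have "\<dots> \<le> (2 + Z) / mu n j" using mupos by (intro divide_right_mono) auto
          finally have "1 * \<tau> \<le> (2 + Z) / mu n j" by simp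
          then show ?thesis by (rule order_trans[rotated]) (use R[of j] \<tau> in \<open>auto intro: mult_right_mono\<close>)
        next
          case False
          have "R j = 1 / (1 + \<theta> * z j)" by (simp add: R_def R1_eq z_def)
          also have "\<dots> \<le> 1 / (1 / 2 * z j)"
            using False True z0[of j] by (intro divide_left_mono add_increasing mult_right_mono mult_pos_pos) (auto intro: add_pos_nonneg)
          finally have "R j * \<tau> \<le> 1 / (1 / 2 * z j) * \<tau>" using \<tau> by (intro mult_right_mono) auto
          also have "\<dots> = 2 / mu n j" using \<tau> by (simp add: z_def)
          also have "\<dots> \<le> (2 + Z) / mu n j" using mupos Z by (intro divide_right_mono) auto
          finally show ?thesis .
        qed
        also have "\<dots> \<le> (2 + Z) / (16 * (real j)\<^sup>2)" using mu16 J Z mupos by (intro divide_left_mono) auto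
        also have "\<dots> \<le> (1 + Z) * (1 / (real j)\<^sup>2)" using J Z by (simp add: field_simps)
        finally have "(R j)\<^sup>2 * \<tau> \<le> (1 + Z) * (1 / (real j)\<^sup>2)" .
        also have "1 \<le> 40 * weight n \<tau> j" using True \<tau> by (intro weight_unresolved) (auto simp: z_def)
        then have "(1 + Z) * (1 / (real j)\<^sup>2) \<le> (1 + Z) * (1 / (real j)\<^sup>2) * (40 * weight n \<tau> j)"
          using Z J by (intro mult_left_mono[of 1 _ "(1 + Z) * (1 / (real j)\<^sup>2)", simplified mult_1_right]) auto
        finally have "48 / c * ((R j)\<^sup>2 * \<tau>) \<le> 48 / c * ((1 + Z) * (1 / (real j)\<^sup>2) * (40 * weight n \<tau> j))"
          using c by (intro mult_left_mono) auto
        moreover have "48 / c * (A * q * (40 * w)) = 1920 * A / c * (w * q)" for A q w :: real by simp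
        moreover have "B j * (1 / (c / \<tau>)) = 48 / c * ((R j)\<^sup>2 * \<tau>)" using True by (simp add: B_def)
        ultimately show ?thesis by metis
      next
        case False
        then have "B j = 0" by (auto simp: B_def)
        then show ?thesis using w0 Z c by simp
      qed
      then show "2000000 / c\<^sup>2 * weight n \<tau> j * (1 / (8 * c * (real j)\<^sup>2)) + B j * (1 / (c / \<tau>))
        \<le> (250000 / c ^ 3 + 1920 * (1 + Z) / c) * (weight n \<tau> j * real j powr (- 2 * 1))"
        unfolding pj distrib_right by (simp add: power2_eq_square power3_eq_cube)
    qed
    finally show "(\<integral>\<^sup>+t\<in>{0<..}. \<Psi> j t \<partial>lborel) \<le> ennreal ((250000 / c ^ 3 + 1920 * (1 + Z) / c) * (weight n \<tau> j * real j powr (- 2 * 1)))" .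
  qed (use c Z \<tau> n in \<open>auto simp: \<Psi>_def\<close>)
  also have "(4 + 1 / (2 * 1 - 1)) * (real n powr (1 - 2 * 1) + \<tau> powr (1 - 1/2)) = 5 * (1 / real n + sqrt \<tau>)"
    using \<tau> n by (simp add: powr_half_sqrt powr_minus_divide)
  finally show ?thesis .
qed

section \<open>Bounds at a fixed time\<close>

lemma exp_neg_le_powr:
  fixes s u \<alpha> :: real
  assumes "0 < s" "s \<le> 1" "u > 0" "0 < \<alpha>" "\<alpha> \<le> 1"
  shows "exp (- (s * u)) \<le> 1 / s * u powr (- \<alpha>)"
proof -
  have x: "s * u > 0" using assms by simp
  have "(s * u) powr \<alpha> \<le> exp (s * u)"
  proof (cases "s * u \<le> 1")
    case True
    then have "(s * u) powr \<alpha> \<le> 1" using x assms by (intro powr_le1) auto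
    also have "\<dots> \<le> exp (s * u)" using x by simp
    finally show ?thesis .
  next
    case False
    then have "(s * u) powr \<alpha> \<le> (s * u) powr 1" using assms by (intro powr_mono) auto
    also have "\<dots> = s * u" using x by simp
    also have "\<dots> \<le> exp (s * u)" using exp_ge_add_one_self[of "s * u"] by linarith
    finally show ?thesis .
  qed
  then have "exp (- (s * u)) \<le> (s * u) powr (- \<alpha>)"
    using x assms(1,3) by (simp add: exp_minus powr_minus divide_simps)
  also have "\<dots> = s powr (- \<alpha>) * u powr (- \<alpha>)" using assms by (simp add: powr_mult)
  also have "\<dots> \<le> s powr (- 1) * u powr (- \<alpha>)" using assms by (intro mult_right_mono powr_mono') auto
  also have "s powr (- 1) = 1 / s" using assms by (simp add: powr_minus_divide)
  finally show ?thesis .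
qed

text \<open>The multiplier has to agree with the scheme only on resolved modes; on the others decay
  is enough. Both the full symbol and the symbol cut off at z > 1 are instances.\<close>

lemma fixed_time_error:
  assumes \<theta>: "0 \<le> \<theta>" "\<theta> \<le> 1" and \<tau>: "\<tau> > 0" "\<tau> < 1" and c: "0 < c" "c \<le> 1"
    and \<alpha>: "1/2 < \<alpha>" "\<alpha> \<le> 1" and K: "K \<ge> 0"
    and n: "n > 0" and x: "0 \<le> x" and t: "t > 0"
    and st: "\<And>j. \<bar>symb \<theta> (\<tau> * mu n j)\<bar> \<le> 1 - c * (\<tau> * mu n j / (1 + \<tau> * mu n j))"
    and g: "\<And>j. \<tau> * mu n j \<le> 1 \<Longrightarrow> g j = symb \<theta> (\<tau> * mu n j) ^ nat \<lfloor>t / \<tau>\<rfloor>"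
    and g': "\<And>j. \<tau> * mu n j > 1 \<Longrightarrow> 2 * j \<le> n \<Longrightarrow> (g j)\<^sup>2 \<le> K * ((real j)\<^sup>2 * t) powr (- \<alpha>)"
  shows "(\<integral>\<^sup>+y\<in>{0..1}. ennreal ((cmod (of_real (heat_green t x y)
      - (\<Sum>m\<in>modes n. of_real (g (nat \<bar>m\<bar>)) * fourier_mode m (grid_floor n x) * cnj (fourier_mode m (grid_floor n y)))))\<^sup>2) \<partial>lborel)
    \<le> ennreal ((2000000 / c ^ 3 + 640 * K) * (4 + 1 / (2 * \<alpha> - 1)) * ((real n powr (1 - 2 * \<alpha>) + \<tau> powr (\<alpha> - 1/2)) * t powr (- \<alpha>)))"
    (is "?L \<le> _")
proof -
  have g0: "g 0 = 1" using g[of 0] by (simp add: symb_def)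
  have "?L \<le> (\<Sum>j. ennreal (kernel_bound n g t j))"
    by (rule kernel_error_bound[where c = g]) (use n t x g0 in auto)
  also have "\<dots> \<le> ennreal ((2000000 / c ^ 3 + 640 * K) * t powr (- \<alpha>) * ((4 + 1 / (2 * \<alpha> - 1)) * (real n powr (1 - 2 * \<alpha>) + \<tau> powr (\<alpha> - 1/2))))"
  proof (rule suminf_ennreal_weight_le[OF \<alpha> \<tau>(1) _ n])
    fix j :: nat assume j: "j \<ge> 1"
    define P where "P = ((real j)\<^sup>2 * t) powr (- \<alpha>)"
    have J: "(real j)\<^sup>2 > 0" using j by simp
    have P: "P = t powr (- \<alpha>) * real j powr (- 2 * \<alpha>)"
    proof -
      have "(real j)\<^sup>2 powr (- \<alpha>) = (real j powr 2) powr (- \<alpha>)" using j by simp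
      also have "\<dots> = real j powr (- 2 * \<alpha>)" by (simp only: powr_powr) simp
      finally show ?thesis using t by (simp add: P_def powr_mult)
    qed
    have w0: "weight n \<tau> j \<ge> 0" using \<tau> by (simp add: weight_nonneg)
    have P0: "P \<ge> 0" by (simp add: P_def)
    have "kernel_bound n g t j \<le> 2000000 / c\<^sup>2 * weight n \<tau> j * exp (- 8 * c * (real j)\<^sup>2 * t)
      + (if 2 * j \<le> n \<and> \<tau> * mu n j > 1 then 16 * (g j)\<^sup>2 else 0)"
      using \<tau> mu_nonneg[of n j] by (intro kernel_bound_le[OF \<theta> \<tau>(1) t c n j st, where R = 1]) (simp_all add: g)
    moreover have "2000000 / c\<^sup>2 * weight n \<tau> j * exp (- 8 * c * (real j)\<^sup>2 * t) \<le> 2000000 / c\<^sup>2 * weight n \<tau> j * (1 / c * P)"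
    proof (rule mult_left_mono)
      have "exp (- 8 * c * (real j)\<^sup>2 * t) \<le> exp (- (c * ((real j)\<^sup>2 * t)))"
        using c t J by simp
      also have "\<dots> \<le> 1 / c * P" unfolding P_def using c J t \<alpha> by (intro exp_neg_le_powr) auto
      finally show "exp (- 8 * c * (real j)\<^sup>2 * t) \<le> 1 / c * P" .
    qed (use c w0 in auto)
    moreover have "(if 2 * j \<le> n \<and> \<tau> * mu n j > 1 then 16 * (g j)\<^sup>2 else 0) \<le> 640 * K * (weight n \<tau> j * P)"
    proof (cases "2 * j \<le> n \<and> \<tau> * mu n j > 1")
      case True
      then have "1 \<le> 40 * weight n \<tau> j" using \<tau> by (intro weight_unresolved) auto
      then have "K * P * 1 \<le> K * P * (40 * weight n \<tau> j)" using K P0 by (intro mult_left_mono) auto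
      moreover have "(g j)\<^sup>2 \<le> K * P" using g' True by (simp add: P_def)
      ultimately show ?thesis using True by simp
    next
      case False
      then show ?thesis unfolding if_not_P[OF False] using K w0 P0 by simp
    qed
    ultimately have "kernel_bound n g t j \<le> 2000000 / c\<^sup>2 * weight n \<tau> j * (1 / c * P) + 640 * K * (weight n \<tau> j * P)"
      by linarith
    also have "\<dots> = (2000000 / c ^ 3 + 640 * K) * t powr (- \<alpha>) * (weight n \<tau> j * real j powr (- 2 * \<alpha>))"
      unfolding P by (simp add: power2_eq_square power3_eq_cube algebra_simps)
    finally show "ennreal (kernel_bound n g t j) \<le> ennreal ((2000000 / c ^ 3 + 640 * K) * t powr (- \<alpha>) * (weight n \<tau> j * real j powr (- 2 * \<alpha>)))"
      by (rule ennreal_leI)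
  qed (use \<tau> c K g0 in \<open>auto simp: kernel_bound_0\<close>)
  finally show ?thesis by (simp only: mult_ac)
qed

text \<open>Cauchy-Schwarz against the constant 1 on the unit interval, carried out with extended
  nonnegative integrals so that finiteness comes out of the estimate itself.\<close>

lemma integral_square_bound:
  fixes H :: "real \<Rightarrow> complex" and f :: "real \<Rightarrow> real"
  assumes H [measurable]: "H \<in> borel_measurable borel"
    and f: "\<And>y. y \<in> {0..1} \<Longrightarrow> \<bar>f y\<bar> \<le> B" and B: "B \<ge> 0" and v: "v \<ge> 0"
    and le: "(\<integral>\<^sup>+y\<in>{0..1}. ennreal ((cmod (H y))\<^sup>2) \<partial>lborel) \<le> ennreal v"
  shows "(cmod (LINT y:{0..1}|lborel. H y * of_real (f y)))\<^sup>2 \<le> B\<^sup>2 * v"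
proof -
  let ?I = "LINT y:{0..1}|lborel. H y * of_real (f y)"
  let ?h = "\<lambda>y. ennreal (cmod (H y)) * indicator {0..1} y"
  have "ennreal (cmod ?I) \<le> ennreal B * (\<integral>\<^sup>+y. ?h y \<partial>lborel)"
  proof (cases "set_integrable lborel {0..1} (\<lambda>y. H y * of_real (f y))")
    case True
    have "ennreal (cmod ?I) \<le> (\<integral>\<^sup>+y. norm (indicat_real {0..1} y *\<^sub>R (H y * of_real (f y))) \<partial>lborel)"
      using True unfolding set_lebesgue_integral_def set_integrable_def
      by (rule integral_norm_bound_ennreal)
    also have "\<dots> \<le> (\<integral>\<^sup>+y. ennreal B * ?h y \<partial>lborel)"
    proof (intro nn_integral_mono)
      fix y
      have "cmod (H y) * \<bar>f y\<bar> \<le> cmod (H y) * B" if "y \<in> {0..1}" using f[OF that] by (intro mult_left_mono) auto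
      then show "ennreal (norm (indicat_real {0..1} y *\<^sub>R (H y * of_real (f y)))) \<le> ennreal B * ?h y"
        using B by (auto simp: indicator_def norm_mult mult.commute simp flip: ennreal_mult intro!: ennreal_leI)
    qed
    finally show ?thesis by (simp add: nn_integral_cmult)
  next
    case False
    \<comment> \<open>A Bochner integral of a non-integrable function is 0 by convention, so the
      bound is trivial here.\<close>
    then have "?I = 0" unfolding set_lebesgue_integral_def set_integrable_def by (rule not_integrable_integral_eq)
    then show ?thesis by simp
  qed
  then have "(ennreal (cmod ?I))\<^sup>2 \<le> (ennreal B * (\<integral>\<^sup>+y. ?h y \<partial>lborel))\<^sup>2" by (intro power_mono) auto
  also have "\<dots> = (ennreal B)\<^sup>2 * (\<integral>\<^sup>+y. ?h y * indicator {0..1} y \<partial>lborel)\<^sup>2"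
    by (simp add: power_mult_distrib mult.assoc flip: indicator_inter_arith)
  also have "\<dots> \<le> (ennreal B)\<^sup>2 * ((\<integral>\<^sup>+y. (?h y)\<^sup>2 \<partial>lborel) * (\<integral>\<^sup>+y. (indicator {0..1::real} y)\<^sup>2 \<partial>lborel))"
    using Cauchy_Schwarz_nn_integral[of ?h lborel "indicator {0..1}"] by (intro mult_left_mono) auto
  also have "(\<integral>\<^sup>+y. (indicator {0..1::real} y)\<^sup>2 \<partial>lborel) = (\<integral>\<^sup>+y. indicator {0..1::real} y \<partial>lborel)"
    by (intro nn_integral_cong) (auto simp: indicator_def)
  also have "(\<integral>\<^sup>+y. indicator {0..1::real} y \<partial>lborel) = 1" by simp
  also have "(\<integral>\<^sup>+y. (?h y)\<^sup>2 \<partial>lborel) = (\<integral>\<^sup>+y\<in>{0..1}. ennreal ((cmod (H y))\<^sup>2) \<partial>lborel)"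
    by (intro nn_integral_cong) (auto simp: indicator_def ennreal_power)
  also have "(ennreal B)\<^sup>2 * ((\<integral>\<^sup>+y\<in>{0..1}. ennreal ((cmod (H y))\<^sup>2) \<partial>lborel) * 1) \<le> (ennreal B)\<^sup>2 * (ennreal v * 1)"
    by (intro mult_left_mono mult_right_mono le) auto
  also have "\<dots> = ennreal (B\<^sup>2 * v)" using B v by (simp add: ennreal_power ennreal_mult)
  finally show ?thesis using B v by (simp add: ennreal_power)
qed

section \<open>Periodic Sobolev data and functions on the grid\<close>

lemma inverse_square_summable_int: "(\<lambda>k::int. 1 / (1 + 4 * pi\<^sup>2 * (of_int k)\<^sup>2)) summable_on UNIV"
proof -
  have s: "(\<lambda>n::nat. 1 / (1 + 4 * pi\<^sup>2 * (real n)\<^sup>2)) summable_on UNIV"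
  proof (rule norm_summable_imp_summable_on, rule summable_comparison_test)
    show "\<exists>N. \<forall>n\<ge>N. norm (norm (1 / (1 + 4 * pi\<^sup>2 * (real n)\<^sup>2))) \<le> 1 / (real n)\<^sup>2"
    proof (intro exI[of _ 1] allI impI)
      fix n :: nat assume "n \<ge> 1"
      have "1 * (real n)\<^sup>2 \<le> 4 * pi\<^sup>2 * (real n)\<^sup>2"
      proof (rule mult_right_mono)
        show "1 \<le> 4 * pi\<^sup>2" using pi_ge_two one_le_power[of pi 2] by linarith
      qed simp
      then have "(real n)\<^sup>2 \<le> 1 + 4 * pi\<^sup>2 * (real n)\<^sup>2" by linarith
      moreover have "(real n)\<^sup>2 > 0" using \<open>n \<ge> 1\<close> by simp
      ultimately have "1 / (1 + 4 * pi\<^sup>2 * (real n)\<^sup>2) \<le> 1 / (real n)\<^sup>2"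
        by (intro divide_left_mono mult_pos_pos) linarith+
      then show "norm (norm (1 / (1 + 4 * pi\<^sup>2 * (real n)\<^sup>2))) \<le> 1 / (real n)\<^sup>2"
        by (simp add: abs_of_nonneg add_nonneg_nonneg)
    qed
    show "summable (\<lambda>n. 1 / (real n)\<^sup>2)" using inverse_power_summable[of 2, where 'a = real] by (simp add: inverse_eq_divide)
  qed
  have "(\<lambda>k::int. 1 / (1 + 4 * pi\<^sup>2 * (of_int k)\<^sup>2)) summable_on (range int \<union> range (\<lambda>n. - int n))"
    by (rule summable_on_union; subst summable_on_reindex) (use s in \<open>auto simp: o_def inj_on_def\<close>)
  moreover have "range int \<union> range (\<lambda>n. - int n) = UNIV"
    by (auto, metis int_cases rangeI)
  ultimately show ?thesis by simp
qed

text \<open>With a = 1 + 4 pi^2 k^2, each coefficient c satisfies c \<le> 1/a + a c^2, and both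
  terms are summable. The series then converges uniformly to a continuous periodic function with the
  coefficients of u. By \<open>fourier_orth_zero\<close> the two agree at every point, as sampling
  on the grid requires.\<close>

lemma periodic_H1_fourier_series:
  assumes u: "periodic_H1 u"
  shows "(\<lambda>k. cmod (fourier_coeff u k)) summable_on UNIV"
    and "y \<in> {0..1} \<Longrightarrow> ((\<lambda>k. fourier_coeff u k * fourier_mode k y) has_sum of_real (u y)) UNIV"
proof -
  have uc: "continuous_on {0..1} u" and u01: "u 0 = u 1"
    and us: "(\<lambda>k::int. (1 + 4 * pi\<^sup>2 * (of_int k)\<^sup>2) * (cmod (fourier_coeff u k))\<^sup>2) summable_on UNIV"
    using u by (auto simp: periodic_H1_def)
  show s: "(\<lambda>k. cmod (fourier_coeff u k)) summable_on UNIV"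
  proof (rule summable_on_comparison_test)
    show "(\<lambda>k::int. 1 / (1 + 4 * pi\<^sup>2 * (of_int k)\<^sup>2) + (1 + 4 * pi\<^sup>2 * (of_int k)\<^sup>2) * (cmod (fourier_coeff u k))\<^sup>2) summable_on UNIV"
      by (intro summable_on_add inverse_square_summable_int us)
    fix k :: int
    define a where "a = 1 + 4 * pi\<^sup>2 * (of_int k :: real)\<^sup>2"
    define c where "c = cmod (fourier_coeff u k)"
    have a: "a > 0" unfolding a_def by (intro add_pos_nonneg) auto
    have c: "c \<ge> 0" by (simp add: c_def)
    have "c * a \<le> 1 + a\<^sup>2 * c\<^sup>2"
      using zero_le_power2[of "a * c - 1"] mult_nonneg_nonneg[OF less_imp_le[OF a] c] by (simp add: power2_eq_square algebra_simps)
    then have "c \<le> (1 + a\<^sup>2 * c\<^sup>2) / a" using a by (simp add: pos_le_divide_eq)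
    also have "\<dots> = 1 / a + a * c\<^sup>2" using a by (simp add: add_divide_distrib power2_eq_square)
    finally show "cmod (fourier_coeff u k) \<le> 1 / (1 + 4 * pi\<^sup>2 * (of_int k)\<^sup>2) + (1 + 4 * pi\<^sup>2 * (of_int k)\<^sup>2) * (cmod (fourier_coeff u k))\<^sup>2"
      by (simp add: a_def c_def)
  qed auto
  define S where "S y = (\<Sum>\<^sub>\<infinity>k. fourier_coeff u k * fourier_mode k y)" for y
  have Sc: "continuous_on {0..1} S"
    unfolding S_def by (rule termwise_integral(1)[OF _ _ s]) (auto intro!: continuous_intros simp: norm_mult)
  have coeff: "integral {0..1} (\<lambda>y. of_real (u y) * fourier_mode k y) = fourier_coeff u (- k)" for k
  proof -
    have "(\<lambda>y. of_real (u y) * fourier_mode k y) absolutely_integrable_on {0..1}"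
      by (intro absolutely_integrable_continuous_real continuous_intros uc)
    from set_lebesgue_integral_eq_integral(2)[OF this] show ?thesis by (simp add: fourier_coeff_def)
  qed
  have Scoeff: "integral {0..1} (\<lambda>y. S y * fourier_mode j y) = fourier_coeff u (- j)" for j
  proof -
    define f where "f k y = fourier_coeff u k * fourier_mode (k + j) y" for k y
    have eq: "(\<Sum>\<^sub>\<infinity>k. f k y) = S y * fourier_mode j y" for y
      unfolding S_def f_def fourier_mode_add mult.assoc[symmetric] by (rule infsum_cmult_left')
    have "((\<lambda>k. integral {0..1} (f k)) has_sum integral {0..1} (\<lambda>y. S y * fourier_mode j y)) UNIV"
      unfolding eq[symmetric]
      by (rule termwise_integral(2)[OF _ _ s]) (auto simp: f_def[abs_def] norm_mult intro!: continuous_intros)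
    moreover have "(\<lambda>k. integral {0..1} (f k)) = (\<lambda>k. if k = - j then fourier_coeff u (- j) else 0)"
      by (auto simp: f_def[abs_def] integral_fourier_mode)
    moreover have "((\<lambda>k. if k = - j then fourier_coeff u (- j) else 0) has_sum fourier_coeff u (- j)) UNIV"
      by (rule has_sum_finite_neutralI[of "{- j}"]) auto
    ultimately show ?thesis using has_sum_unique by fastforce
  qed
  assume y: "y \<in> {0..1}"
  have "of_real (u y) - S y = 0"
  proof (rule fourier_orth_zero[OF _ _ y])
    have "S 0 = S 1" using fourier_mode_of_int[of _ 0] fourier_mode_of_int[of _ 1] by (simp add: S_def)
    then show "of_real (u 0) - S 0 = of_real (u 1) - S 1" using u01 by simp
    have int: "(\<lambda>y. of_real (u y) * fourier_mode k y) integrable_on {0..1}" "(\<lambda>y. S y * fourier_mode k y) integrable_on {0..1}" for k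
      by (intro integrable_continuous_real continuous_intros uc Sc)+
    show "fourier_orth (\<lambda>y. of_real (u y) - S y)"
      unfolding fourier_orth_def left_diff_distrib
      by (auto intro!: continuous_intros uc Sc
          simp: Henstock_Kurzweil_Integration.integral_diff[OF int] coeff Scoeff)
  qed
  moreover have "(\<lambda>k. fourier_coeff u k * fourier_mode k y) summable_on UNIV"
    by (rule abs_summable_summable) (use s in \<open>simp add: norm_mult\<close>)
  ultimately show "((\<lambda>k. fourier_coeff u k * fourier_mode k y) has_sum of_real (u y)) UNIV"
    using has_sum_infsum[of "\<lambda>k. fourier_coeff u k * fourier_mode k y" UNIV] by (simp add: S_def)
qed

text \<open>The composition factors through the integers with the discrete sigma-algebra, on which
  every function is measurable.\<close>

lemma borel_measurable_comp_grid_floor [measurable]: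
  "(\<lambda>y. F (grid_floor n y)) \<in> borel_measurable borel"
proof -
  have "(\<lambda>i. F (of_int i / real n)) \<in> measurable (count_space UNIV) borel" by simp
  moreover have "(\<lambda>y. \<lfloor>real n * y\<rfloor>) \<in> measurable borel (count_space UNIV)" by measurable
  ultimately show ?thesis unfolding grid_floor_def by (rule measurable_compose[rotated])
qed

text \<open>The integrand is constant on each of the n half-open cells; the endpoint y = 1, which
  \<open>grid_floor\<close> sends to 1, is a null set.\<close>

lemma has_bochner_integral_grid_floor:
  fixes F :: "real \<Rightarrow> complex"
  assumes n: "n > 0"
  shows "has_bochner_integral lborel (\<lambda>y. indicat_real {0..1} y *\<^sub>R F (grid_floor n y)) (\<Sum>k<n. F (real k / real n) / of_nat n)"
proof -
  let ?I = "\<lambda>k::nat. {real k / real n..<real k / real n + 1 / real n}"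
  have "has_bochner_integral lborel (\<lambda>y. \<Sum>k<n. indicat_real (?I k) y *\<^sub>R F (real k / real n)) (\<Sum>k<n. measure lborel (?I k) *\<^sub>R F (real k / real n))"
  proof (intro has_bochner_integral_sum has_bochner_integral_scaleR_left)
    show "has_bochner_integral lborel (indicat_real (?I k)) (measure lborel (?I k))" if "F (real k / real n) \<noteq> 0" for k
      by (rule has_bochner_integral_real_indicator) auto
  qed
  moreover have "AE y in lborel. indicat_real {0..1} y *\<^sub>R F (grid_floor n y) = (\<Sum>k<n. indicat_real (?I k) y *\<^sub>R F (real k / real n))"
    using AE_lborel_singleton[of 1]
  proof eventually_elim
    fix y :: real assume y: "y \<noteq> 1"
    define q where "q = \<lfloor>real n * y\<rfloor>"
    have mem: "y \<in> ?I k \<longleftrightarrow> q = int k" for k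
    proof -
      have "y \<in> ?I k \<longleftrightarrow> real k \<le> real n * y \<and> real n * y < real k + 1"
        using n by (simp add: field_simps add_divide_distrib[symmetric])
      then show ?thesis by (simp add: floor_eq_iff q_def)
    qed
    have r: "(\<Sum>k<n. indicat_real (?I k) y *\<^sub>R F (real k / real n)) = (\<Sum>k<n. if q = int k then F (real k / real n) else 0)"
      by (intro sum.cong refl) (auto simp: indicator_def mem simp del: atLeastLessThan_iff)
    show "indicat_real {0..1} y *\<^sub>R F (grid_floor n y) = (\<Sum>k<n. indicat_real (?I k) y *\<^sub>R F (real k / real n))"
    proof (cases "y \<in> {0..1}")
      case True
      then have q: "0 \<le> q" "q < int n" using y n by (auto simp: q_def floor_less_iff)
      then have "(\<Sum>k<n. if q = int k then F (real k / real n) else 0) = (\<Sum>k<n. if k = nat q then F (real k / real n) else 0)"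
        by (intro sum.cong) auto
      also have "\<dots> = F (grid_floor n y)" using q by (simp add: grid_floor_def q_def[symmetric])
      finally show ?thesis using True unfolding r by simp
    next
      case False
      have "q \<noteq> int k" if "k < n" for k
      proof
        assume "q = int k"
        then have "real k / real n \<le> y" "y < real k / real n + 1 / real n" using mem[of k] by auto
        moreover have "real k / real n + 1 / real n \<le> 1" using that n by (simp add: field_simps)
        ultimately show False using False by (auto intro: order_trans[of 0 "real k / real n"])
      qed
      then have "(\<Sum>k<n. if q = int k then F (real k / real n) else 0) = 0" by (intro sum.neutral) auto
      then show ?thesis using False unfolding r by simp
    qed
  qed
  moreover have "measure lborel (?I k) *\<^sub>R F (real k / real n) = F (real k / real n) / of_nat n" for k
    by (simp add: scaleR_conv_of_real)
  ultimately show ?thesis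
    by (subst has_bochner_integral_cong_AE[where g = "\<lambda>y. \<Sum>k<n. indicat_real (?I k) y *\<^sub>R F (real k / real n)"])
       (auto simp: has_bochner_integral_iff)
qed

text \<open>Aliasing: on the grid every Fourier mode coincides with exactly one resolved mode, so the
  multiplier acts on an absolutely convergent Fourier series coefficientwise.\<close>
lemma multiplier_on_periodic_H1:
  assumes u: "periodic_H1 u" and n: "n > 0" and g: "\<And>j. \<bar>g j\<bar> \<le> Q"
  shows "cmod (LINT y:{0..1}|lborel. (\<Sum>m\<in>modes n. of_real (g (nat \<bar>m\<bar>)) * fourier_mode m w * cnj (fourier_mode m (grid_floor n y)))
            * of_real (u (grid_floor n y))) \<le> (\<Sum>\<^sub>\<infinity>k. cmod (fourier_coeff u k)) * Q"
proof -
  define A where "A = (\<Sum>\<^sub>\<infinity>k. cmod (fourier_coeff u k))"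
  define G where "G y = (\<Sum>m\<in>modes n. of_real (g (nat \<bar>m\<bar>)) * fourier_mode m w * cnj (fourier_mode m y))" for y
  define L where "L v = (\<Sum>k<n. G (real k / real n) * v (real k / real n) / of_nat n)" for v :: "real \<Rightarrow> complex"
  define V where "V N y = (\<Sum>p\<in>{- int N..int N}. fourier_coeff u p * fourier_mode p y)" for N y
  have Q: "Q \<ge> 0" using g[of 0] by linarith
  have "(LINT y:{0..1}|lborel. G (grid_floor n y) * of_real (u (grid_floor n y))) = L (\<lambda>y. of_real (u y))"
    using has_bochner_integral_integral_eq[OF has_bochner_integral_grid_floor[OF n, of "\<lambda>y. G y * of_real (u y)"]]
    by (simp add: set_lebesgue_integral_def L_def)
  moreover have "cmod (L (\<lambda>y. of_real (u y))) \<le> A * Q"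
  proof (rule Lim_norm_ubound[OF sequentially_bot])
    show "(\<lambda>N. L (V N)) \<longlonglongrightarrow> L (\<lambda>y. of_real (u y))"
      unfolding L_def
    proof (intro tendsto_intros)
      fix k assume "k \<in> {..<n}"
      then have "real k / real n \<in> {0..1}" by auto
      from periodic_H1_fourier_series(2)[OF u this]
      show "(\<lambda>N. V N (real k / real n)) \<longlonglongrightarrow> of_real (u (real k / real n))"
        unfolding has_sum_def V_def by (rule filterlim_compose[OF _ filterlim_symmetric_int_intervals])
    qed (use n in auto)
    \<comment> \<open>On the grid the mode p equals the member of \<open>modes n\<close> congruent
      to it, so at most one summand survives and the bound is uniform in p.\<close>
    have Lp: "cmod (L (fourier_mode p)) \<le> Q" for p
    proof -
      let ?P = "{m \<in> modes n. int n dvd p - m}"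
      have "L (fourier_mode p) = (\<Sum>k<n. \<Sum>m\<in>modes n. of_real (g (nat \<bar>m\<bar>)) * fourier_mode m w * (fourier_mode (p - m) (real k / real n) / of_nat n))"
        unfolding L_def G_def sum_distrib_right sum_divide_distrib
        using fourier_mode_add[of p "- _"] by (intro sum.cong refl) (simp add: cnj_fourier_mode)
      also have "\<dots> = (\<Sum>m\<in>modes n. of_real (g (nat \<bar>m\<bar>)) * fourier_mode m w * ((\<Sum>k<n. fourier_mode (p - m) (real k / real n)) / of_nat n))"
        unfolding sum_distrib_left sum_divide_distrib by (rule sum.swap)
      also have "\<dots> = (\<Sum>m\<in>modes n. if int n dvd p - m then of_real (g (nat \<bar>m\<bar>)) * fourier_mode m w else 0)"
        unfolding sum_fourier_mode_grid[OF n] using n by (intro sum.cong refl) auto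
      also have "\<dots> = (\<Sum>m\<in>?P. of_real (g (nat \<bar>m\<bar>)) * fourier_mode m w)"
        by (rule sum.inter_filter[symmetric]) simp
      also have "cmod \<dots> \<le> (\<Sum>m\<in>?P. Q)"
        by (rule sum_norm_le) (simp add: norm_mult g)
      finally have "cmod (L (fourier_mode p)) \<le> (\<Sum>m\<in>?P. Q)" .
      moreover have "card ?P \<le> 1"
      proof -
        have "l = m" if "l \<in> ?P" "m \<in> ?P" for l m
        proof (rule ccontr)
          assume "l \<noteq> m"
          have "int n dvd (p - m) - (p - l)" using that dvd_diff[of "int n" "p - m" "p - l"] by auto
          then have "int n \<le> \<bar>l - m\<bar>" using \<open>l \<noteq> m\<close> dvd_imp_le_int[of "l - m" "int n"] by simp
          then show False using that by (auto simp: modes_def)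
        qed
        then have "card ?P \<le> Suc 0" by (subst card_le_Suc0_iff_eq) auto
        then show ?thesis by simp
      qed
      then have "(\<Sum>m\<in>?P. Q) \<le> 1 * Q" unfolding sum_constant using Q by (intro mult_right_mono) auto
      ultimately show ?thesis by simp
    qed
    have "cmod (L (V N)) \<le> A * Q" for N
    proof -
      have "L (V N) = (\<Sum>p\<in>{- int N..int N}. fourier_coeff u p * L (fourier_mode p))"
        unfolding L_def V_def sum_distrib_left sum_divide_distrib by (subst sum.swap) (simp add: mult_ac)
      also have "cmod \<dots> \<le> (\<Sum>p\<in>{- int N..int N}. cmod (fourier_coeff u p) * Q)"
        using Lp by (intro sum_norm_le) (auto simp: norm_mult intro!: mult_left_mono)
      also have "\<dots> = (\<Sum>p\<in>{- int N..int N}. cmod (fourier_coeff u p)) * Q" by (simp add: sum_distrib_right)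
      also have "\<dots> \<le> A * Q"
        unfolding A_def using Q periodic_H1_fourier_series(1)[OF u]
        by (intro mult_right_mono finite_sum_le_infsum) auto
      finally show ?thesis .
    qed
    then show "\<forall>\<^sub>F N in sequentially. cmod (L (V N)) \<le> A * Q" by simp
  qed
  ultimately show ?thesis by (simp add: G_def A_def)
qed

section \<open>Error for sampled data\<close>

lemma grid_floor_in_unit_interval:
  assumes "n > 0" "y \<in> {0..1}"
  shows "grid_floor n y \<in> {0..1}"
proof -
  have "0 \<le> real n * y" "real n * y \<le> real n" using assms by (auto simp: mult_left_le)
  then have "0 \<le> \<lfloor>real n * y\<rfloor>" "of_int \<lfloor>real n * y\<rfloor> \<le> real n" by (auto simp: floor_le_iff intro: order_trans[OF of_int_floor_le])
  then show ?thesis using assms by (simp add: grid_floor_def)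
qed

text \<open>This fails for \<open>1/2 < \<theta> < 1\<close>, where the symbol tends to \<open>- (1 - \<theta>) / \<theta>\<close> as \<open>z\<close> grows;
  there the unresolved modes are controlled by the regularity of the data instead.\<close>
lemma unresolved_symbol_decay:
  fixes \<theta> \<tau> c t \<alpha> Z :: real and j n :: nat
  defines "z \<equiv> \<tau> * mu n j"
  assumes \<theta>: "\<theta> \<le> 1/2 \<or> \<theta> = 1" and \<tau>: "\<tau> > 0" and t: "\<tau> \<le> t" and c: "0 < c" "c \<le> 1" and Z: "Z > 0"
    and \<alpha>: "0 < \<alpha>" "\<alpha> \<le> 1" and j: "2 * j \<le> n" "n > 0" and z: "z > 1"
    and st: "\<bar>symb \<theta> z\<bar> \<le> 1 - c * (z / (1 + z))" and zZ: "\<theta> \<le> 1/2 \<Longrightarrow> z \<le> Z"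
  shows "(symb \<theta> z ^ nat \<lfloor>t / \<tau>\<rfloor>)\<^sup>2 \<le> (1 + Z) / c * ((real j)\<^sup>2 * t) powr (- \<alpha>)"
proof -
  define k where "k = nat \<lfloor>t / \<tau>\<rfloor>"
  define U where "U = (real j)\<^sup>2 * t"
  have "1 \<le> t / \<tau>" using t \<tau> by simp
  then have f: "1 \<le> \<lfloor>t / \<tau>\<rfloor>" by simp
  then have "real k = of_int \<lfloor>t / \<tau>\<rfloor>" by (simp add: k_def)
  then have k: "1 \<le> real k" "t / \<tau> \<le> real k + 1" using f by linarith+
  \<comment> \<open>Because t \<ge> \<tau> at least one step has been completed, so k + 1 \<le>
    2k.\<close>
  then have "t / \<tau> \<le> 2 * real k" by linarith
  then have tk: "t \<le> 2 * (real k * \<tau>)" using \<tau> by (simp add: pos_divide_le_eq mult_ac)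
  have "mu n j > 0" using z \<tau> mu_nonneg[of n j] unfolding z_def by (cases "mu n j = 0") auto
  then have "j \<noteq> 0" by (cases "j = 0") auto
  then have U: "U > 0" using t \<tau> by (simp add: U_def)
  have "16 * U \<le> mu n j * t" unfolding U_def mult.assoc[symmetric] using mu_ge[OF j] t \<tau> by (intro mult_right_mono) auto
  also have "\<dots> \<le> mu n j * (2 * (real k * \<tau>))" using tk mu_nonneg by (intro mult_left_mono) auto
  finally have kz: "8 * U \<le> real k * z" by (simp add: z_def mult_ac)
  have c1: "1 \<le> (1 + Z) / c" using c Z by simp
  show ?thesis
  proof (cases "\<theta> \<le> 1/2")
    case True
    \<comment> \<open>As z \<le> Z, the ratio z/(1+z) is at least z/(1+Z); the contraction per step
      becomes decay in kz, and kz dominates j^2 t.\<close>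
    have "(symb \<theta> z ^ k)\<^sup>2 \<le> exp (- 2 * c * real k * (z / (1 + z)))"
      using st c z by (intro symb_power_decay) auto
    also have "\<dots> \<le> exp (- (c / (1 + Z) * U))"
    proof -
      have "U \<le> real k * z" using kz U by linarith
      then have "c / (1 + Z) * U \<le> c / (1 + Z) * (real k * z)" using c Z by (intro mult_left_mono) auto
      also have "\<dots> = c * real k * (z / (1 + Z))" by simp
      also have "\<dots> \<le> c * real k * (z / (1 + z))"
        using c z zZ[OF True] by (intro mult_left_mono divide_left_mono) auto
      also have "\<dots> \<le> 2 * c * real k * (z / (1 + z))" using c z by (intro mult_right_mono) auto
      finally show ?thesis by simp
    qed
    also have "\<dots> \<le> 1 / (c / (1 + Z)) * U powr (- \<alpha>)"
      using c Z U \<alpha> by (intro exp_neg_le_powr) auto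
    finally show ?thesis by (simp add: U_def k_def)
  next
    case False
    then have s: "symb \<theta> z = 1 / (1 + z)" using \<theta> by (simp add: symb_def)
    have kz1: "1 \<le> real k * z" using k z mult_mono[of 1 "real k" 1 z] by simp
    \<comment> \<open>For implicit Euler, Bernoulli's inequality bounds the k-th power of the symbol
      by 1/(kz), and kz \<ge> 1 lets the exponent -2 be weakened to -\<alpha>.\<close>
    have "real k * z \<le> (1 + z) ^ k" using Bernoulli_inequality[of z k] z by simp
    then have "(real k * z)\<^sup>2 \<le> ((1 + z) ^ k)\<^sup>2" using kz1 by (intro power_mono) auto
    moreover have "(real k * z)\<^sup>2 > 0" using kz1 by (intro zero_less_power) linarith
    ultimately have "1 / ((1 + z) ^ k)\<^sup>2 \<le> 1 / (real k * z)\<^sup>2"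
      by (intro divide_left_mono mult_pos_pos) linarith+
    moreover have "(symb \<theta> z ^ k)\<^sup>2 = 1 / ((1 + z) ^ k)\<^sup>2" by (simp add: s power_divide)
    ultimately have "(symb \<theta> z ^ k)\<^sup>2 \<le> 1 / (real k * z)\<^sup>2" by simp
    also have "\<dots> = (real k * z) powr (- 2)" using kz1 by (simp add: powr_minus_divide)
    also have "\<dots> \<le> (real k * z) powr (- \<alpha>)" using kz1 \<alpha> by (intro powr_mono) auto
    also have "\<dots> \<le> U powr (- \<alpha>)" using kz U \<alpha> by (intro powr_mono2') auto
    also have "\<dots> \<le> (1 + Z) / c * U powr (- \<alpha>)" using c1 mult_right_mono[of 1 "(1 + Z) / c" "U powr (- \<alpha>)"] by simp
    finally show ?thesis by (simp add: U_def k_def)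
  qed
qed

lemma powr_floor_step_le:
  fixes \<tau> t \<alpha> :: real
  assumes "\<tau> > 0" "\<tau> \<le> t" "\<alpha> > 0"
  shows "t powr (- \<alpha>) \<le> (of_int \<lfloor>t / \<tau>\<rfloor> * \<tau>) powr (- \<alpha>)"
proof (rule powr_mono2')
  have "1 \<le> t / \<tau>" using assms by simp
  then have "1 \<le> \<lfloor>t / \<tau>\<rfloor>" by simp
  then show "0 < of_int \<lfloor>t / \<tau>\<rfloor> * \<tau>" using assms by simp
  have "of_int \<lfloor>t / \<tau>\<rfloor> * \<tau> \<le> t / \<tau> * \<tau>" using assms by (intro mult_right_mono) auto
  then show "of_int \<lfloor>t / \<tau>\<rfloor> * \<tau> \<le> t" using assms by simp
qed (use assms in auto)

text \<open>The multiplier is written as g + h, where h collects the unresolved modes and is nonzero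
  only for 1/2 < \<theta> < 1. The g part is treated by Cauchy-Schwarz and the kernel estimate, the
  h part through the Fourier series of u; the two summands of \<open>C\<close> belong to these two
  parts.\<close>

lemma sampled_error:
  assumes \<theta>: "0 \<le> \<theta>" "\<theta> \<le> 1" and \<tau>: "\<tau> > 0" "\<tau> < 1" and c: "0 < c" "c \<le> 1" and Z: "Z > 0"
    and \<alpha>: "1/2 < \<alpha>" "\<alpha> \<le> 1" and n: "n > 0" and x: "0 \<le> x" and t: "\<tau> \<le> t"
    and st: "\<And>j. \<bar>symb \<theta> (\<tau> * mu n j)\<bar> \<le> 1 - c * (\<tau> * mu n j / (1 + \<tau> * mu n j))"
    and zZ: "\<And>j. \<theta> \<le> 1/2 \<Longrightarrow> \<tau> * mu n j \<le> Z"
    and u: "\<And>y. y \<in> {0..1} \<Longrightarrow> \<bar>u y\<bar> \<le> B"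
    and reg: "\<theta> \<le> 1/2 \<or> \<theta> = 1 \<or> periodic_H1 u"
  defines "A \<equiv> \<Sum>\<^sub>\<infinity>k. cmod (fourier_coeff u k)"
  defines "C \<equiv> 2 * B\<^sup>2 * ((2000000 / c ^ 3 + 640 * ((1 + Z) / c)) * (4 + 1 / (2 * \<alpha> - 1))) + 2 * A\<^sup>2 / c"
  shows "(cmod (LINT y:{0..1}|lborel. (of_real (heat_green t x y) - discrete_green1 \<theta> n \<tau> t x y) * of_real (u (grid_floor n y))))\<^sup>2
     \<le> C * \<tau> powr (\<alpha> - 1/2) * (of_int \<lfloor>t / \<tau>\<rfloor> * \<tau>) powr (- \<alpha>) + C * real n powr (1 - 2 * \<alpha>) * t powr (- \<alpha>)"
proof -
  define K where "K = (1 + Z) / c"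
  define D where "D = (2000000 / c ^ 3 + 640 * K) * (4 + 1 / (2 * \<alpha> - 1))"
  define k where "k = nat \<lfloor>t / \<tau>\<rfloor>"
  define W where "W = (of_int \<lfloor>t / \<tau>\<rfloor> * \<tau>) powr (- \<alpha>)"
  define split where "split \<longleftrightarrow> \<not> (\<theta> \<le> 1/2 \<or> \<theta> = 1)"
  define r where "r j = symb \<theta> (\<tau> * mu n j) ^ k" for j
  define h where "h j = (if split \<and> \<tau> * mu n j > 1 then r j else 0)" for j
  define g where "g j = (if split \<and> \<tau> * mu n j > 1 then 0 else r j)" for j
  define M where "M f y = (\<Sum>m\<in>modes n. of_real (f (nat \<bar>m\<bar>)) * fourier_mode m (grid_floor n x) * cnj (fourier_mode m (grid_floor n y)))"
    for f :: "nat \<Rightarrow> real" and y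
  define H where "H y = of_real (heat_green t x y) - M g y" for y
  have t0: "t > 0" using t \<tau> by simp
  have B0: "B \<ge> 0" using u[of 0] by auto
  have K0: "K \<ge> 0" using c Z by (simp add: K_def)
  have D0: "D \<ge> 0" using c K0 \<alpha> by (simp add: D_def)
  have A0: "A \<ge> 0" unfolding A_def by (rule infsum_nonneg) simp
  have k1: "real k \<ge> 1" "of_int \<lfloor>t / \<tau>\<rfloor> = real k"
  proof -
    have "1 \<le> t / \<tau>" using t \<tau> by simp
    then have f: "1 \<le> \<lfloor>t / \<tau>\<rfloor>" by simp
    then show "of_int \<lfloor>t / \<tau>\<rfloor> = real k" by (simp add: k_def)
    then show "real k \<ge> 1" using f by linarith
  qed
  have [measurable]: "M f \<in> borel_measurable borel" for f
    unfolding M_def cnj_fourier_mode by measurable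
  have [measurable]: "heat_green t x \<in> borel_measurable borel" by (rule borel_measurable_heat_green[OF t0])
  have Hm: "H \<in> borel_measurable borel" unfolding H_def by measurable
  have ub: "\<bar>u (grid_floor n y)\<bar> \<le> B" if "y \<in> {0..1}" for y
    using u grid_floor_in_unit_interval[OF n that] by blast
  have G: "of_real (heat_green t x y) - discrete_green1 \<theta> n \<tau> t x y = H y - M h y" for y
  proof -
    have "discrete_green1 \<theta> n \<tau> t x y = M g y + M h y"
      unfolding M_def sum.distrib[symmetric] discrete_green1_modes[OF n less_imp_le[OF t0]]
      by (intro sum.cong refl) (auto simp: g_def h_def r_def k_def)
    then show ?thesis by (simp add: H_def)
  qed
  define v where "v = D * ((real n powr (1 - 2 * \<alpha>) + \<tau> powr (\<alpha> - 1/2)) * t powr (- \<alpha>))"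
  have v0: "v \<ge> 0" using D0 by (simp add: v_def)
  have Hint: "(cmod (LINT y:{0..1}|lborel. H y * of_real (u (grid_floor n y))))\<^sup>2 \<le> B\<^sup>2 * v"
  proof (rule integral_square_bound[OF Hm ub B0 v0])
    show "(\<integral>\<^sup>+y\<in>{0..1}. ennreal ((cmod (H y))\<^sup>2) \<partial>lborel) \<le> ennreal v"
      unfolding H_def M_def v_def D_def
    proof (rule fixed_time_error[OF \<theta> \<tau> c \<alpha> K0 n x t0 st])
      show "g j = symb \<theta> (\<tau> * mu n j) ^ nat \<lfloor>t / \<tau>\<rfloor>" if "\<tau> * mu n j \<le> 1" for j
        using that by (simp add: g_def r_def k_def)
      show "(g j)\<^sup>2 \<le> K * ((real j)\<^sup>2 * t) powr - \<alpha>" if "\<tau> * mu n j > 1" "2 * j \<le> n" for j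
      proof (cases split)
        case True
        then show ?thesis using that K0 by (simp add: g_def)
      next
        case False
        then have "(r j)\<^sup>2 \<le> K * ((real j)\<^sup>2 * t) powr - \<alpha>"
          unfolding K_def r_def k_def
          by (intro unresolved_symbol_decay) (use \<tau> t c Z \<alpha> n that st zZ in \<open>auto simp: split_def\<close>)
        then show ?thesis using False by (simp add: g_def)
      qed
    qed
  qed
  have hint: "(cmod (LINT y:{0..1}|lborel. M h y * of_real (u (grid_floor n y))))\<^sup>2 \<le> A\<^sup>2 / c * (\<tau> powr (\<alpha> - 1/2) * W)"
  proof (cases split)
    case True
    then have H1: "periodic_H1 u" using reg by (simp add: split_def)
    \<comment> \<open>For z > 1 one has z/(1+z) \<ge> 1/2, so each step contracts an unresolved mode
      by at least exp(-c/2).\<close>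
    define Q where "Q = exp (- (c * real k / 2))"
    have "\<bar>h j\<bar> \<le> Q" for j
    proof (cases "\<tau> * mu n j > 1")
      case True
      define z where "z = \<tau> * mu n j"
      have "(r j)\<^sup>2 \<le> exp (- 2 * c * real k * (z / (1 + z)))"
        unfolding r_def using st c True by (intro symb_power_decay) (auto simp: z_def)
      also have "\<dots> \<le> exp (- (c * real k))"
      proof -
        have "1 / 2 \<le> z / (1 + z)" using True by (simp add: z_def field_simps)
        then have "2 * c * real k * (1 / 2) \<le> 2 * c * real k * (z / (1 + z))"
          using c by (intro mult_left_mono) auto
        then show ?thesis by simp
      qed
      also have "\<dots> = Q\<^sup>2" by (simp add: Q_def power2_eq_square flip: exp_add)
      finally have "\<bar>r j\<bar> \<le> Q" by (simp add: Q_def abs_le_square_iff[symmetric])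
      then show ?thesis by (simp add: h_def Q_def)
    qed (simp add: h_def Q_def)
    from multiplier_on_periodic_H1[OF H1 n this]
    have "cmod (LINT y:{0..1}|lborel. M h y * of_real (u (grid_floor n y))) \<le> A * Q"
      by (simp add: M_def A_def)
    then have "(cmod (LINT y:{0..1}|lborel. M h y * of_real (u (grid_floor n y))))\<^sup>2 \<le> (A * Q)\<^sup>2"
      by (intro power_mono) auto
    also have "\<dots> = A\<^sup>2 * exp (- (c * real k))" by (simp add: Q_def power_mult_distrib power2_eq_square flip: exp_add)
    also have "\<dots> \<le> A\<^sup>2 * (1 / c * real k powr (- \<alpha>))"
      using c k1 \<alpha> by (intro mult_left_mono exp_neg_le_powr) auto
    also have "\<dots> = A\<^sup>2 / c * real k powr (- \<alpha>)" by simp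
    also have "\<dots> \<le> A\<^sup>2 / c * (\<tau> powr (\<alpha> - 1/2) * W)"
    proof (rule mult_left_mono)
      \<comment> \<open>Since \<open>W\<close> is (k\<tau>) powr (-\<alpha>), the target equals k
        powr (-\<alpha>) times \<tau> powr (-1/2), and the last factor is at least 1 for \<tau> <
        1.\<close>
      have "W = real k powr (- \<alpha>) * \<tau> powr (- \<alpha>)" using \<tau> k1 by (simp add: W_def powr_mult)
      then have "\<tau> powr (\<alpha> - 1/2) * W = real k powr (- \<alpha>) * (\<tau> powr (\<alpha> - 1/2) * \<tau> powr (- \<alpha>))" by simp
      also have "\<tau> powr (\<alpha> - 1/2) * \<tau> powr (- \<alpha>) = \<tau> powr (- 1/2)" by (simp flip: powr_add)
      also have "real k powr (- \<alpha>) * 1 \<le> real k powr (- \<alpha>) * \<tau> powr (- 1/2)"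
        using powr_mono'[of "- 1/2" 0 \<tau>] \<tau> by (intro mult_left_mono) auto
      finally show "real k powr (- \<alpha>) \<le> \<tau> powr (\<alpha> - 1/2) * W" by simp
    qed (use c in auto)
    finally show ?thesis .
  next
    case False
    then have "M h y = 0" for y by (simp add: M_def h_def)
    then show ?thesis using c by (simp add: W_def)
  qed
  have fin: "2 * (B\<^sup>2 * v) + 2 * (A\<^sup>2 / c * (\<tau> powr (\<alpha> - 1/2) * W)) \<le> C * \<tau> powr (\<alpha> - 1/2) * W + C * real n powr (1 - 2 * \<alpha>) * t powr (- \<alpha>)"
    (is "?lhs \<le> ?rhs")
  proof -
    define N where "N = real n powr (1 - 2 * \<alpha>)"
    define T where "T = t powr (- \<alpha>)"
    define S where "S = \<tau> powr (\<alpha> - 1/2)"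
    have nn: "N \<ge> 0" "T \<ge> 0" "S \<ge> 0" by (simp_all add: N_def T_def S_def)
    have TW: "T \<le> W" unfolding T_def W_def using \<tau> t \<alpha> by (intro powr_floor_step_le) auto
    have C: "C = 2 * B\<^sup>2 * D + 2 * A\<^sup>2 / c" by (simp add: C_def D_def K_def)
    have "S * T \<le> S * W" using TW nn by (intro mult_left_mono) auto
    then have 1: "2 * B\<^sup>2 * D * (S * T) \<le> 2 * B\<^sup>2 * D * (S * W)" by (rule mult_left_mono) (use D0 in auto)
    have 2: "0 \<le> 2 * A\<^sup>2 / c * (N * T)" using nn c by simp
    have "?lhs = 2 * B\<^sup>2 * D * (N * T) + 2 * B\<^sup>2 * D * (S * T) + 2 * A\<^sup>2 / c * (S * W)"
      by (simp add: v_def algebra_simps N_def T_def S_def)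
    also have "\<dots> \<le> 2 * B\<^sup>2 * D * (N * T) + 2 * A\<^sup>2 / c * (N * T) + 2 * B\<^sup>2 * D * (S * W) + 2 * A\<^sup>2 / c * (S * W)"
      using 1 2 by linarith
    also have "\<dots> = ?rhs" unfolding C by (simp add: algebra_simps N_def T_def S_def)
    finally show ?thesis .
  qed
  let ?I = "LINT y:{0..1}|lborel. (of_real (heat_green t x y) - discrete_green1 \<theta> n \<tau> t x y) * of_real (u (grid_floor n y))"
  have "(cmod ?I)\<^sup>2 \<le> 2 * (B\<^sup>2 * v) + 2 * (A\<^sup>2 / c * (\<tau> powr (\<alpha> - 1/2) * W))"
  proof (cases "set_integrable lborel {0..1} (\<lambda>y. (H y - M h y) * of_real (u (grid_floor n y)))")
    case True
    \<comment> \<open>This product is a step function on the grid, hence integrable; integrability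
      of the difference therefore passes to the part with \<open>H\<close>.\<close>
    have ih: "set_integrable lborel {0..1} (\<lambda>y. M h y * of_real (u (grid_floor n y)))"
      unfolding set_integrable_def M_def
      using has_bochner_integral_grid_floor[OF n, of "\<lambda>w. (\<Sum>m\<in>modes n. of_real (h (nat \<bar>m\<bar>)) * fourier_mode m (grid_floor n x) * cnj (fourier_mode m w)) * of_real (u w)"]
      by (simp add: has_bochner_integral_iff)
    have iH: "set_integrable lborel {0..1} (\<lambda>y. H y * of_real (u (grid_floor n y)))"
      using set_integral_add(1)[OF True ih] by (simp add: algebra_simps)
    have "?I = (LINT y:{0..1}|lborel. H y * of_real (u (grid_floor n y))) - (LINT y:{0..1}|lborel. M h y * of_real (u (grid_floor n y)))"
      unfolding G left_diff_distrib by (rule set_integral_diff(2)[OF iH ih])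
    then have "cmod ?I \<le> cmod (LINT y:{0..1}|lborel. H y * of_real (u (grid_floor n y))) + cmod (LINT y:{0..1}|lborel. M h y * of_real (u (grid_floor n y)))"
      by (simp add: norm_triangle_ineq4)
    then have "(cmod ?I)\<^sup>2 \<le> (cmod (LINT y:{0..1}|lborel. H y * of_real (u (grid_floor n y))) + cmod (LINT y:{0..1}|lborel. M h y * of_real (u (grid_floor n y))))\<^sup>2"
      by (intro power_mono) auto
    also have "\<dots> \<le> 2 * (cmod (LINT y:{0..1}|lborel. H y * of_real (u (grid_floor n y))))\<^sup>2 + 2 * (cmod (LINT y:{0..1}|lborel. M h y * of_real (u (grid_floor n y))))\<^sup>2"
      by (rule sum_squares_bound_add)
    finally show ?thesis using Hint hint by linarith
  next
    case False
    then have "?I = 0" unfolding G set_lebesgue_integral_def set_integrable_def by (rule not_integrable_integral_eq)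
    then show ?thesis using v0 c by (simp add: W_def)
  qed
  also note fin
  finally show ?thesis by (simp add: W_def)
qed

theorem lemma4p1:
  fixes \<theta> \<rho> \<epsilon> :: real
  assumes "0 \<le> \<theta>" "\<theta> \<le> 1" and "\<rho> > 0" and "0 < \<epsilon>" "\<epsilon> < 1/2"
  shows
    "(\<exists>C>0. \<forall>(n::nat) (\<tau>::real) (x::real).
        n \<ge> 3 \<longrightarrow> 0 < \<tau> \<longrightarrow> \<tau> < 1/2 \<longrightarrow> step_condition \<theta> \<rho> \<epsilon> n \<tau> \<longrightarrow> 0 \<le> x \<longrightarrow> x \<le> 1 \<longrightarrow>
        (\<integral>\<^sup>+t\<in>{0<..}. (\<integral>\<^sup>+y\<in>{0..1}.
            ennreal ((cmod (of_real (heat_green t x y) - discrete_green2 \<theta> n \<tau> t x y))\<^sup>2) \<partial>lborel) \<partial>lborel)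
          \<le> ennreal (C * (1 / real n + sqrt \<tau>)))
     \<and>
     (\<forall>(u0 :: real \<Rightarrow> real) (\<alpha>::real).
        bounded (u0 ` {0..1}) \<longrightarrow> (\<forall>y\<in>{0..1}. u0 y \<ge> 0) \<longrightarrow>
        u0 \<in> borel_measurable (lebesgue_on {0..1}) \<longrightarrow> 1/2 < \<alpha> \<longrightarrow> \<alpha> < 1 \<longrightarrow>
        (\<exists>C>0. \<forall>(n::nat) (\<tau>::real) (t::real) (x::real).
           n \<ge> 3 \<longrightarrow> 0 < \<tau> \<longrightarrow> \<tau> < 1/2 \<longrightarrow>
           (\<theta> \<le> 1/2 \<and> step_condition \<theta> \<rho> \<epsilon> n \<tau> \<or> \<theta> = 1 \<or> 1/2 < \<theta> \<and> \<theta> < 1 \<and> periodic_H1 u0) \<longrightarrow>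
           0 \<le> x \<longrightarrow> x \<le> 1 \<longrightarrow> \<tau> \<le> t \<longrightarrow>
           (cmod (LINT y:{0..1}|lborel.
                (of_real (heat_green t x y) - discrete_green1 \<theta> n \<tau> t x y) * of_real (u0 (grid_floor n y))))\<^sup>2
             \<le> C * \<tau> powr (\<alpha> - 1/2) * (of_int \<lfloor>t / \<tau>\<rfloor> * \<tau>) powr (- \<alpha>)
               + C * real n powr (1 - 2 * \<alpha>) * t powr (- \<alpha>)))"
proof -
  obtain c Z where c: "0 < c" "c \<le> 1" and Z: "Z > 0"
    and st: "\<And>n \<tau> j. \<tau> > 0 \<Longrightarrow> step_condition \<theta> \<rho> \<epsilon> n \<tau> \<Longrightarrow>
       \<bar>symb \<theta> (\<tau> * mu n j)\<bar> \<le> 1 - c * (\<tau> * mu n j / (1 + \<tau> * mu n j))"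
    and zZ: "\<And>n \<tau> j. \<theta> \<le> 1/2 \<Longrightarrow> \<tau> > 0 \<Longrightarrow> step_condition \<theta> \<rho> \<epsilon> n \<tau> \<Longrightarrow> \<tau> * mu n j \<le> Z"
    using stability_constant[OF assms(1,2,4,5,3)] by blast
  show ?thesis
  proof (intro conjI allI impI)
    define C where "C = (250000 / c ^ 3 + 1920 * (1 + Z) / c) * 5"
    have "C > 0" using c Z by (auto simp: C_def intro!: add_pos_pos)
    then show "\<exists>C>0. \<forall>(n::nat) (\<tau>::real) (x::real).
        n \<ge> 3 \<longrightarrow> 0 < \<tau> \<longrightarrow> \<tau> < 1/2 \<longrightarrow> step_condition \<theta> \<rho> \<epsilon> n \<tau> \<longrightarrow> 0 \<le> x \<longrightarrow> x \<le> 1 \<longrightarrow>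
        (\<integral>\<^sup>+t\<in>{0<..}. (\<integral>\<^sup>+y\<in>{0..1}.
            ennreal ((cmod (of_real (heat_green t x y) - discrete_green2 \<theta> n \<tau> t x y))\<^sup>2) \<partial>lborel) \<partial>lborel)
          \<le> ennreal (C * (1 / real n + sqrt \<tau>))"
    proof (intro exI[of _ C] conjI allI impI)
      fix n :: nat and \<tau> x :: real
      assume a: "n \<ge> 3" "0 < \<tau>" "\<tau> < 1/2" "step_condition \<theta> \<rho> \<epsilon> n \<tau>" "0 \<le> x" "x \<le> 1"
      show "(\<integral>\<^sup>+t\<in>{0<..}. (\<integral>\<^sup>+y\<in>{0..1}.
            ennreal ((cmod (of_real (heat_green t x y) - discrete_green2 \<theta> n \<tau> t x y))\<^sup>2) \<partial>lborel) \<partial>lborel)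
          \<le> ennreal (C * (1 / real n + sqrt \<tau>))"
        unfolding C_def mult.assoc
        using a c Z assms st zZ by (intro space_time_error[unfolded mult.assoc]) auto
    qed
  next
    fix u :: "real \<Rightarrow> real" and \<alpha> :: real
    assume "bounded (u ` {0..1})" and \<alpha>: "1/2 < \<alpha>" "\<alpha> < 1"
    then obtain B where "\<forall>y\<in>{0..1}. \<bar>u y\<bar> \<le> B" by (auto simp: bounded_iff)
    then have B: "\<And>y. y \<in> {0..1} \<Longrightarrow> \<bar>u y\<bar> \<le> B" by blast
    \<comment> \<open>If the coefficients are not absolutely summable, the infinite sum takes its
      default value 0. Its term is used as a bound only when \<open>periodic_H1 u\<close> holds,
      where the series converges.\<close>
    define C where "C = 2 * B\<^sup>2 * ((2000000 / c ^ 3 + 640 * ((1 + Z) / c)) * (4 + 1 / (2 * \<alpha> - 1))) + 2 * (\<Sum>\<^sub>\<infinity>k. cmod (fourier_coeff u k))\<^sup>2 / c"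
    have C0: "C \<ge> 0" unfolding C_def using c Z \<alpha> by (intro add_nonneg_nonneg mult_nonneg_nonneg divide_nonneg_nonneg) auto
    show "\<exists>C>0. \<forall>(n::nat) (\<tau>::real) (t::real) (x::real).
           n \<ge> 3 \<longrightarrow> 0 < \<tau> \<longrightarrow> \<tau> < 1/2 \<longrightarrow>
           (\<theta> \<le> 1/2 \<and> step_condition \<theta> \<rho> \<epsilon> n \<tau> \<or> \<theta> = 1 \<or> 1/2 < \<theta> \<and> \<theta> < 1 \<and> periodic_H1 u) \<longrightarrow>
           0 \<le> x \<longrightarrow> x \<le> 1 \<longrightarrow> \<tau> \<le> t \<longrightarrow>
           (cmod (LINT y:{0..1}|lborel.
                (of_real (heat_green t x y) - discrete_green1 \<theta> n \<tau> t x y) * of_real (u (grid_floor n y))))\<^sup>2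
             \<le> C * \<tau> powr (\<alpha> - 1/2) * (of_int \<lfloor>t / \<tau>\<rfloor> * \<tau>) powr (- \<alpha>)
               + C * real n powr (1 - 2 * \<alpha>) * t powr (- \<alpha>)"
    \<comment> \<open>For u = 0 the constant may be 0, so 1 is added to make it positive.\<close>
    proof (intro exI[of _ "C + 1"] conjI allI impI)
      show "C + 1 > 0" using C0 by simp
      fix n :: nat and \<tau> t x :: real
      assume a: "n \<ge> 3" "0 < \<tau>" "\<tau> < 1/2" "0 \<le> x" "x \<le> 1" "\<tau> \<le> t"
        and reg: "\<theta> \<le> 1/2 \<and> step_condition \<theta> \<rho> \<epsilon> n \<tau> \<or> \<theta> = 1 \<or> 1/2 < \<theta> \<and> \<theta> < 1 \<and> periodic_H1 u"
      \<comment> \<open>In the alternatives with \<theta> > 1/2 both implications in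
        \<open>step_condition\<close> have false premises.\<close>
      have sc: "step_condition \<theta> \<rho> \<epsilon> n \<tau>" using reg by (auto simp: step_condition_def)
      have "(cmod (LINT y:{0..1}|lborel.
                (of_real (heat_green t x y) - discrete_green1 \<theta> n \<tau> t x y) * of_real (u (grid_floor n y))))\<^sup>2
             \<le> C * \<tau> powr (\<alpha> - 1/2) * (of_int \<lfloor>t / \<tau>\<rfloor> * \<tau>) powr (- \<alpha>)
               + C * real n powr (1 - 2 * \<alpha>) * t powr (- \<alpha>)"
        unfolding C_def
        by (rule sampled_error[where Z = Z and c = c]) (use a c Z \<alpha> B reg assms st[OF a(2) sc] zZ[OF _ a(2) sc] in auto)
      also have "\<dots> \<le> (C + 1) * \<tau> powr (\<alpha> - 1/2) * (of_int \<lfloor>t / \<tau>\<rfloor> * \<tau>) powr (- \<alpha>)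
               + (C + 1) * real n powr (1 - 2 * \<alpha>) * t powr (- \<alpha>)"
        by (intro add_mono mult_right_mono) auto
      finally show "(cmod (LINT y:{0..1}|lborel.
                (of_real (heat_green t x y) - discrete_green1 \<theta> n \<tau> t x y) * of_real (u (grid_floor n y))))\<^sup>2
             \<le> (C + 1) * \<tau> powr (\<alpha> - 1/2) * (of_int \<lfloor>t / \<tau>\<rfloor> * \<tau>) powr (- \<alpha>)
               + (C + 1) * real n powr (1 - 2 * \<alpha>) * t powr (- \<alpha>)" .
    qed
  qed
qed

end
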